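(* Let $0<\varepsilon<\frac12$ be given and let $\Omega=\{s=\sigma+it\in\mathbf{C}\colon t\ge 1,\ 1-\sigma\ge t^{\varepsilon},\ |s-1|\ge 4\pi\}$. Let $\delta$ be a real number with $\delta>\frac12$, and let $\Omega_1=\{s=\sigma+it\in\Omega\colon 1-\sigma\ge t^{\delta}\ge 2\}$. Then there is an absolute constant $A$ such that for $s=\sigma+it\in\Omega_1$ $$\mathcal R(s)=-\chi(s)\,\eta^{s-1}e^{-\pi i\eta^2}\,\frac{\sqrt2\,e^{3\pi i/8}\sin\pi\eta}{2\cos2\pi\eta}\,(1+U),\qquad |U|\le A\,t^{-1/2}.$$
   Context: Here $s=\sigma+it$ with $\sigma,t$ real, and $U=U(s)$ is a complex number depending on $s$. Riemann's auxiliary function is the entire function $$\mathcal R(s)=\int_{0\swarrow1}\frac{x^{-s}e^{\pi i x^2}}{e^{\pi i x}-e^{-\pi i x}}\,dx,$$ where $0\swarrow1$ denotes a straight line parallel to the direction $e^{i\pi/4}$ crossing the real axis at a point strictly between $0$ and $1$, traversed from upper right to lower left (for instance $x=\frac12-ue^{i\pi/4}$, with $u$ going from $-\infty$ to $+\infty$), and $x^{-s}=\exp(-s\log x)$ with the principal logarithm on $\mathbf{C}\setminus(-\infty,0]$. $\chi(s)=\pi^{s-1/2}\,\Gamma\!\left(\frac{1-s}{2}\right)/\Gamma\!\left(\frac s2\right)$ is the factor in the functional equation $\zeta(s)=\chi(s)\zeta(1-s)$ of the Riemann zeta function. $\eta=\sqrt{\frac{s-1}{2\pi i}}=\eta_1+i\eta_2$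 ($\eta_1,\eta_2$ real) is the square root chosen so that $\eta_1+\eta_2>0$. For $s\in\Omega$ this gives $0<\arg\eta<\frac\pi4$, and $\eta^{s-1}=\exp((s-1)\log\eta)$ with this principal argument. *)

theory Defs
  imports "HOL-Analysis.Analysis"
begin

(* The line through 1/2 in direction exp(i pi/4), traversed from upper right to lower left. *)
definition aux_line :: "real \<Rightarrow> complex" where
  "aux_line u = 1/2 - complex_of_real u * exp (\<i> * pi / 4)"

(* The line meets the real axis only at 1/2, where it is positive, so powr is
   exp (-s * Ln x) with the principal logarithm at every point of it.  The factor
   - exp (i pi/4) is the derivative of aux_line.  Crossing the real axis at another
   point strictly between 0 and 1 gives the same value. *)
definition riemann_aux :: "complex \<Rightarrow> complex" where
  "riemann_aux s =
     (\<integral>u. (let x = aux_line u in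
            x powr (-s) * exp (pi * \<i> * x\<^sup>2) / (exp (pi * \<i> * x) - exp (- (pi * \<i> * x))))
          * (- exp (\<i> * pi / 4)) \<partial>lborel)"

(* The factor in the functional equation zeta(s) = chi(s) zeta(1 - s). *)
definition chi :: "complex \<Rightarrow> complex" where
  "chi s = complex_of_real pi powr (s - 1/2) * Gamma ((1 - s) / 2) / Gamma (s / 2)"

(* Determined uniquely unless both square roots have Re + Im = 0, that is, unless
   (s - 1) / (2 pi i) is i times a nonpositive real, which means s real with s >= 1. *)
definition eta :: "complex \<Rightarrow> complex" where
  "eta s = (THE w. w\<^sup>2 = (s - 1) / (2 * pi * \<i>) \<and> Re w + Im w > 0)"

definition Omega :: "real \<Rightarrow> complex set" where
  "Omega \<epsilon> = {s. Im s \<ge> 1 \<and> 1 - Re s \<ge> Im s powr \<epsilon> \<and> cmod (s - 1) \<ge> 4 * pi}"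

definition Omega1 :: "real \<Rightarrow> real \<Rightarrow> complex set" where
  "Omega1 \<epsilon> \<delta> = {s \<in> Omega \<epsilon>. 1 - Re s \<ge> Im s powr \<delta> \<and> Im s powr \<delta> \<ge> 2}"

end

theory Submission
  imports
    Defs
    "HOL-Complex_Analysis.Complex_Analysis"
    "HOL-Probability.Distributions"
    "HOL-Real_Asymp.Real_Asymp"
begin

text \<open>
  Write \<open>L\<^sub>N\<close> for the line through \<open>N + 1/2\<close> in the direction \<open>exp (3 pi i / 4)\<close>. The Mordell integral of
  \<open>exp (- pi i y^2 + 2 pi i u y) / (2 i sin (pi y))\<close> over \<open>L\<^sub>N\<close> has a closed form; integrating it
  against \<open>u powr (- s)\<close> over the ray \<open>arg u = pi / 4\<close>, to which the integral defining the auxiliary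
  function reduces for \<open>Re s \<le> -1\<close>, gives for every \<open>N\<close> that \<open>riemann_aux s / chi s\<close> is the sum of
  \<open>n powr (s - 1)\<close> over \<open>n > N\<close> plus the integral of
  \<open>y powr (s - 1) exp (- pi i y^2) / (2 i sin (pi y))\<close> over \<open>L\<^sub>N\<close>.

  Here \<open>y powr (s - 1) = exp (2 pi i \<eta>^2 Ln y)\<close> is replaced, in the sum and in the integral alike, by
  the second-order Taylor approximation of its exponent at the saddle point \<open>\<eta>\<close>. The sum becomes
  geometric, the integral becomes another Mordell integral, and together they are exactly the main
  term. With \<open>N\<close> the integer part of \<open>Re \<eta> + Im \<eta>\<close>, the line \<open>L\<^sub>N\<close> passes within distance 1/2 of \<open>\<eta>\<close>
  close to the direction of steepest descent, and the replacement costs a relative error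
  \<open>O(1 / |\<eta>|)\<close>; this needs \<open>Im \<eta>\<close> bounded below, which is what
  \<open>1 - Re s \<ge> sqrt (Im s)\<close> provides.
\<close>

section \<open>Contour shifts in strips\<close>

text \<open>The claim concerns a relative error. The main term is only known to be at least of the
  order \<open>norm T * exp (- pi * Im \<eta>)\<close>, and \<open>Im \<eta>\<close> is unbounded on
  the domain, so every error estimate has to carry the factor \<open>exp (- pi * Im \<eta>)\<close>.
  For the integral it comes from \<open>1 / sin (pi y)\<close>, for the sum from the Gaussian
  descent between \<eta> and the real axis. The lower bound on \<open>Im \<eta>\<close> makes the
  terms of the sum decay and keeps \<open>sin (pi * \<eta>)\<close> away from its zeros. Because the
  exact formula holds for every \<open>N\<close>, no path is deformed through the saddle and no
  crossed poles have to be counted: \<open>N\<close> is simply chosen well. The separate models of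
  sum and integral depend on \<open>N\<close>, only their total does not; this is why they are
  treated together. The Taylor model of \<open>y powr (s - 1)\<close> is itself a Gaussian
  \<open>exp (- pi i y^2 + ...)\<close>. Multiplied by the kernel it doubles the quadratic term, so
  that \<open>gauss 1\<close> governs the exact formula and \<open>gauss 2\<close> the main
  term.\<close>

lemma integrable_exp_minus_abs: "integrable lborel (\<lambda>x::real. exp (- \<bar>x\<bar>))"
proof -
  let ?g = "\<lambda>x::real. indicator {0..} x *\<^sub>R exp (- x)"
  have "(\<lambda>x::real. exp (-x)) absolutely_integrable_on {0..}"
    using integrable_on_exp_minus_to_infinity[of 1 0]
    by (intro nonnegative_absolutely_integrable_1) auto
  then have g: "integrable lborel ?g"
    by (subst (asm) set_integrable_def, subst (asm) integrable_completion) auto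
  have "integrable lborel (\<lambda>x. ?g (0 + (-1) * x))"
    by (rule lborel_integrable_real_affine[OF g]) simp
  with g have "integrable lborel (\<lambda>x. ?g x + ?g (0 + (-1) * x))"
    by (rule Bochner_Integration.integrable_add)
  then show ?thesis
    by (rule Bochner_Integration.integrable_bound) (auto simp: indicator_def)
qed

lemma integrable_exp_decay:
  fixes g :: "real \<Rightarrow> complex"
  assumes "continuous_on UNIV g" and "\<And>v. \<bar>v\<bar> \<ge> B \<Longrightarrow> norm (g v) \<le> K * exp (- \<bar>v\<bar>)"
  shows "integrable lborel g"
proof -
  have "compact (g ` {-\<bar>B\<bar>..\<bar>B\<bar>})"
    by (intro compact_continuous_image continuous_on_subset[OF assms(1)]) auto
  then obtain M where M: "\<And>v. v \<in> {-\<bar>B\<bar>..\<bar>B\<bar>} \<Longrightarrow> norm (g v) \<le> M"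
    using compact_imp_bounded bounded_iff by (metis imageI)
  have M0: "M \<ge> 0" by (rule order_trans[OF norm_ge_zero M[of 0]]) simp
  \<comment> \<open>For \<open>|v| < |B|\<close> the bound \<open>M\<close> is affordable because
    \<open>exp |B| * exp (- |v|)\<close> is at least 1.\<close>
  define L where "L = \<bar>K\<bar> + M * exp \<bar>B\<bar>"
  have *: "norm (g v) \<le> L * exp (- \<bar>v\<bar>)" for v
  proof (cases "\<bar>v\<bar> \<ge> \<bar>B\<bar>")
    case True
    then have "norm (g v) \<le> K * exp (- \<bar>v\<bar>)" using assms(2) by force
    also have "\<dots> \<le> L * exp (- \<bar>v\<bar>)"
      using M0 by (intro mult_right_mono) (auto simp: L_def intro: order_trans[of _ "\<bar>K\<bar>"])
    finally show ?thesis .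
  next
    case False
    then have "norm (g v) \<le> M" by (intro M) (auto simp: abs_real_def split: if_splits)
    also have "M \<le> M * (exp \<bar>B\<bar> * exp (- \<bar>v\<bar>))"
      using False M0 by (intro mult_le_cancel_left1[THEN iffD2]) (auto simp: exp_add[symmetric])
    also have "\<dots> \<le> L * exp (- \<bar>v\<bar>)"
      unfolding mult.assoc[symmetric] by (intro mult_right_mono) (auto simp: L_def)
    finally show ?thesis .
  qed
  show ?thesis
  proof (rule Bochner_Integration.integrable_bound)
    show "integrable lborel (\<lambda>v. L * exp (- \<bar>v\<bar>))"
      using integrable_exp_minus_abs by simp
    show "g \<in> borel_measurable lborel"
      using borel_measurable_continuous_onI[OF assms(1)] by simp
    show "AE v in lborel. norm (g v) \<le> norm (L * exp (- \<bar>v\<bar>))"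
      using * by (intro AE_I2) (smt (verit) real_norm_def)
  qed
qed

lemma tendsto_integral_symmetric_interval:
  fixes g :: "real \<Rightarrow> complex"
  assumes g: "integrable lborel g"
  shows "(\<lambda>n. integral {- real n..real n} g) \<longlonglongrightarrow> (\<integral>v. g v \<partial>lborel)"
proof -
  have "(\<lambda>n. \<integral>v. indicator {- real n..real n} v *\<^sub>R g v \<partial>lborel) \<longlonglongrightarrow> (\<integral>v. g v \<partial>lborel)"
  proof (rule integral_dominated_convergence)
    show "integrable lborel (\<lambda>v. norm (g v))" using g by simp
    show "AE v in lborel. (\<lambda>n. indicator {- real n..real n} v *\<^sub>R g v) \<longlonglongrightarrow> g v"
    proof (rule AE_I2)
      fix v
      obtain m where m: "real m \<ge> \<bar>v\<bar>" using real_arch_simple by blast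
      have "\<forall>\<^sub>F n in sequentially. indicator {- real n..real n} v *\<^sub>R g v = g v"
        using eventually_ge_at_top[of m]
      proof eventually_elim
        case (elim n)
        then have "real n \<ge> \<bar>v\<bar>" using m by linarith
        then show ?case by (auto simp: indicator_def)
      qed
      then show "(\<lambda>n. indicator {- real n..real n} v *\<^sub>R g v) \<longlonglongrightarrow> g v"
        by (rule tendsto_eventually)
    qed
  qed (use g in \<open>auto simp: indicator_def\<close>)
  moreover have "(\<integral>v. indicator {- real n..real n} v *\<^sub>R g v \<partial>lborel) = integral {- real n..real n} g" for n
    using set_borel_integral_eq_integral(2)[of "{- real n..real n}" g]
      integrable_mult_indicator[OF _ g, of "{- real n..real n}"]
    by (simp add: set_integrable_def set_lebesgue_integral_def)
  ultimately show ?thesis by simp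
qed

text \<open>The residue theorem on rectangles of growing height; \<open>decay\<close> makes the
  horizontal sides vanish. Parametrising the vertical sides by the imaginary part yields a factor i
  that cancels the one in 2 pi i. The margin \<open>e\<close> leaves room for an open set around the
  closed rectangles.\<close>

theorem strip_residue:
  fixes G :: "complex \<Rightarrow> complex"
  assumes x: "x1 < x2" and e: "e > 0"
    and holo: "G holomorphic_on ({w. x1 - e < Re w \<and> Re w < x2 + e} - {p})"
    and p: "x1 < Re p" "Re p < x2"
    and decay: "\<And>w. x1 \<le> Re w \<Longrightarrow> Re w \<le> x2 \<Longrightarrow> \<bar>Im w\<bar> \<ge> B \<Longrightarrow> norm (G w) \<le> K * exp (- \<bar>Im w\<bar>)"
  shows "(\<integral>v. G (Complex x2 v) \<partial>lborel) - (\<integral>v. G (Complex x1 v) \<partial>lborel) = 2 * pi * residue G p"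
proof -
  define S where "S = {w. x1 - e < Re w \<and> Re w < x2 + e}"
  have S: "open S" "convex S"
  proof -
    have "S = {w. x1 - e < Re w} \<inter> {w. Re w < x2 + e}" by (auto simp: S_def)
    then show "open S" "convex S"
      by (auto intro!: open_Int convex_Int open_halfspace_Re_gt open_halfspace_Re_lt
          convex_halfspace_Re_gt convex_halfspace_Re_lt)
  qed
  have holo: "G holomorphic_on (S - {p})" using holo by (simp add: S_def)
  have cont: "continuous_on (S - {p}) G" by (rule holomorphic_on_imp_continuous_on[OF holo])
  have contv: "continuous_on UNIV (\<lambda>v. G (Complex x v))" if "x = x1 \<or> x = x2" for x
    by (rule continuous_on_compose2[OF cont])
       (use that x p e in \<open>auto simp: S_def complex_eq_iff Complex_eq intro!: continuous_intros\<close>)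
  have d: "norm (G (Complex x v)) \<le> K * exp (- \<bar>v\<bar>)" if "x = x1 \<or> x = x2" "\<bar>v\<bar> \<ge> B" for x v
    using decay[of "Complex x v"] that x by auto
  have int1: "integrable lborel (\<lambda>v. G (Complex x1 v))"
    by (rule integrable_exp_decay[of _ B K]) (use contv d in auto)
  have int2: "integrable lborel (\<lambda>v. G (Complex x2 v))"
    by (rule integrable_exp_decay[of _ B K]) (use contv d in auto)
  define J where "J n = integral {- real n..real n} (\<lambda>v. G (Complex x2 v)) -
      integral {- real n..real n} (\<lambda>v. G (Complex x1 v))" for n
  have J: "norm (J n - 2 * pi * residue G p) \<le> 2 * (\<bar>K\<bar> * exp (- real n) * (x2 - x1))"
    if n: "real n > \<bar>B\<bar>" "real n > \<bar>Im p\<bar>" for n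
  proof -
    define T where "T = real n"
    have T: "T > 0" "T > \<bar>B\<bar>" "T > \<bar>Im p\<bar>" using n by (auto simp: T_def)
    define a1 a2 a3 a4 where "a1 = Complex x1 (-T)" and "a2 = Complex x2 (-T)"
      and "a3 = Complex x2 T" and "a4 = Complex x1 T"
    note a = a1_def a2_def a3_def a4_def
    have rp: "rectpath a1 a3 = linepath a1 a2 +++ linepath a2 a3 +++ linepath a3 a4 +++ linepath a4 a1"
      by (simp add: rectpath_def Let_def a)
    have seg: "closed_segment a1 a2 \<subseteq> S - {p}" "closed_segment a2 a3 \<subseteq> S - {p}"
      "closed_segment a3 a4 \<subseteq> S - {p}" "closed_segment a4 a1 \<subseteq> S - {p}" "closed_segment a1 a4 \<subseteq> S - {p}"
      using x e p T
      by (auto simp: a S_def closed_segment_same_Re closed_segment_same_Im closed_segment_eq_real_ivl)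
    have ci: "G contour_integrable_on (linepath a1 a2)" "G contour_integrable_on (linepath a2 a3)"
      "G contour_integrable_on (linepath a3 a4)" "G contour_integrable_on (linepath a4 a1)"
      by (intro contour_integrable_continuous_linepath continuous_on_subset[OF cont] seg)+
    have sub: "path_image (rectpath a1 a3) \<subseteq> S - {p}"
      using seg by (simp add: rp path_image_join)
    have res: "contour_integral (rectpath a1 a3) G = 2 * pi * \<i> * residue G p"
    proof -
      have "contour_integral (rectpath a1 a3) G =
          2 * pi * \<i> * (\<Sum>q\<in>{p}. winding_number (rectpath a1 a3) q * residue G q)"
      proof (rule Residue_theorem[of S])
        show "\<forall>z. z \<notin> S \<longrightarrow> winding_number (rectpath a1 a3) z = 0"
          using sub S by (auto intro!: winding_number_zero_outside[of _ S])
      qed (use S holo sub in \<open>auto intro: convex_connected\<close>)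
      moreover have "winding_number (rectpath a1 a3) p = 1"
        by (rule winding_number_rectpath) (use p T in \<open>auto simp: in_box_complex_iff a\<close>)
      ultimately show ?thesis by simp
    qed
    have "contour_integral (rectpath a1 a3) G = contour_integral (linepath a1 a2) G +
        (contour_integral (linepath a2 a3) G + (contour_integral (linepath a3 a4) G +
         contour_integral (linepath a4 a1) G))"
      unfolding rp using ci by (simp add: contour_integrable_joinI)
    also have "contour_integral (linepath a4 a1) G = - contour_integral (linepath a1 a4) G"
      using ci by (metis contour_integral_reversepath reversepath_linepath valid_path_linepath)
    also have "contour_integral (linepath a2 a3) G = \<i> * integral {-T..T} (\<lambda>v. G (Complex x2 v))"
      by (rule contour_integral_linepath_same_Re) (use T in \<open>auto simp: a\<close>)
    also have "contour_integral (linepath a1 a4) G = \<i> * integral {-T..T} (\<lambda>v. G (Complex x1 v))"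
      by (rule contour_integral_linepath_same_Re) (use T in \<open>auto simp: a\<close>)
    finally have eq: "2 * pi * \<i> * residue G p = \<i> * J n + (contour_integral (linepath a1 a2) G +
         contour_integral (linepath a3 a4) G)"
      unfolding res by (simp add: J_def T_def algebra_simps)
    have "norm (contour_integral (linepath a1 a2) G) \<le> (\<bar>K\<bar> * exp (-T)) * norm (a2 - a1)"
    proof (rule contour_integral_bound_linepath[OF ci(1)])
      fix w assume "w \<in> closed_segment a1 a2"
      then have w: "Im w = -T" "x1 \<le> Re w" "Re w \<le> x2"
        using x by (auto simp: a closed_segment_same_Im closed_segment_eq_real_ivl)
      have "norm (G w) \<le> K * exp (- \<bar>Im w\<bar>)" by (rule decay) (use w T in auto)
      also have "\<dots> \<le> \<bar>K\<bar> * exp (-T)" using w T by (auto intro: mult_right_mono)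
      finally show "norm (G w) \<le> \<bar>K\<bar> * exp (-T)" .
    qed auto
    moreover have "norm (contour_integral (linepath a3 a4) G) \<le> (\<bar>K\<bar> * exp (-T)) * norm (a4 - a3)"
    proof (rule contour_integral_bound_linepath[OF ci(3)])
      fix w assume "w \<in> closed_segment a3 a4"
      then have w: "Im w = T" "x1 \<le> Re w" "Re w \<le> x2"
        using x by (auto simp: a closed_segment_same_Im closed_segment_eq_real_ivl)
      have "norm (G w) \<le> K * exp (- \<bar>Im w\<bar>)" by (rule decay) (use w T in auto)
      also have "\<dots> \<le> \<bar>K\<bar> * exp (-T)" using w T by (auto intro: mult_right_mono)
      finally show "norm (G w) \<le> \<bar>K\<bar> * exp (-T)" .
    qed auto
    moreover have "norm (a2 - a1) = x2 - x1" "norm (a4 - a3) = x2 - x1"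
      using x by (auto simp: a cmod_def)
    moreover have "norm (J n - 2 * pi * residue G p) =
        norm (contour_integral (linepath a1 a2) G + contour_integral (linepath a3 a4) G)"
    proof -
      have "\<i> * (J n - 2 * pi * residue G p) =
         - (contour_integral (linepath a1 a2) G + contour_integral (linepath a3 a4) G)"
        using eq by (simp add: algebra_simps)
      then have "norm (\<i> * (J n - 2 * pi * residue G p)) =
         norm (contour_integral (linepath a1 a2) G + contour_integral (linepath a3 a4) G)"
        by (metis norm_minus_cancel)
      then show ?thesis by (simp add: norm_mult)
    qed
    ultimately show ?thesis
      using norm_triangle_ineq[of "contour_integral (linepath a1 a2) G" "contour_integral (linepath a3 a4) G"]
      by (simp add: T_def)
  qed
  have "(\<lambda>n. J n - 2 * pi * residue G p) \<longlonglongrightarrow> 0"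
  proof (rule Lim_null_comparison)
    obtain m where m: "real m > \<bar>B\<bar> + \<bar>Im p\<bar>" using reals_Archimedean2 by blast
    show "\<forall>\<^sub>F n in sequentially. norm (J n - 2 * pi * residue G p)
        \<le> 2 * (\<bar>K\<bar> * exp (- real n) * (x2 - x1))"
      using eventually_ge_at_top[of m]
    proof eventually_elim
      case (elim n)
      then have "real n \<ge> real m" by simp
      then show ?case using m by (intro J) linarith+
    qed
    have "(\<lambda>n. exp (- real n)) \<longlonglongrightarrow> 0"
      by (intro filterlim_compose[OF exp_at_bot]) (auto simp: filterlim_uminus_at_bot filterlim_real_sequentially)
    then have "(\<lambda>n. 2 * (\<bar>K\<bar> * exp (- real n) * (x2 - x1))) \<longlonglongrightarrow> 2 * (\<bar>K\<bar> * 0 * (x2 - x1))"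
      by (intro tendsto_intros)
    then show "(\<lambda>n. 2 * (\<bar>K\<bar> * exp (- real n) * (x2 - x1))) \<longlonglongrightarrow> 0" by simp
  qed
  then have "J \<longlonglongrightarrow> 2 * pi * residue G p" by (simp add: LIM_zero_iff)
  moreover have "J \<longlonglongrightarrow> (\<integral>v. G (Complex x2 v) \<partial>lborel) - (\<integral>v. G (Complex x1 v) \<partial>lborel)"
    unfolding J_def by (intro tendsto_diff tendsto_integral_symmetric_interval int1 int2)
  ultimately show "(\<integral>v. G (Complex x2 v) \<partial>lborel) - (\<integral>v. G (Complex x1 v) \<partial>lborel) = 2 * pi * residue G p"
    using LIMSEQ_unique by blast
qed

corollary strip_shift:
  fixes G :: "complex \<Rightarrow> complex"
  assumes x: "x1 < x2" and e: "e > 0"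
    and holo: "G holomorphic_on {w. x1 - e < Re w \<and> Re w < x2 + e}"
    and decay: "\<And>w. x1 \<le> Re w \<Longrightarrow> Re w \<le> x2 \<Longrightarrow> \<bar>Im w\<bar> \<ge> B \<Longrightarrow> norm (G w) \<le> K * exp (- \<bar>Im w\<bar>)"
  shows "(\<integral>v. G (Complex x2 v) \<partial>lborel) = (\<integral>v. G (Complex x1 v) \<partial>lborel)"
proof -
  define S where "S = {w. x1 - e < Re w \<and> Re w < x2 + e}"
  \<comment> \<open>Any interior point can play the pole: \<open>G\<close> is holomorphic there and
    the residue vanishes.\<close>
  define p where "p = complex_of_real ((x1 + x2) / 2)"
  have "S = {w. x1 - e < Re w} \<inter> {w. Re w < x2 + e}" by (auto simp: S_def)
  then have S: "open S" by (auto intro!: open_Int open_halfspace_Re_gt open_halfspace_Re_lt)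
  have p: "x1 < Re p" "Re p < x2" "p \<in> S" using x e by (auto simp: p_def S_def field_simps)
  have "residue G p = 0" by (rule residue_holo[OF S p(3)]) (use holo in \<open>simp add: S_def\<close>)
  have h: "G holomorphic_on ({w. x1 - e < Re w \<and> Re w < x2 + e} - {p})"
    by (rule holomorphic_on_subset[OF holo]) auto
  have "(\<integral>v. G (Complex x2 v) \<partial>lborel) - (\<integral>v. G (Complex x1 v) \<partial>lborel) = 2 * pi * residue G p"
    by (rule strip_residue[OF x e h p(1,2) decay])
  then show "(\<integral>v. G (Complex x2 v) \<partial>lborel) = (\<integral>v. G (Complex x1 v) \<partial>lborel)"
    using \<open>residue G p = 0\<close> by simp
qed

text \<open>Completing the square. Gaussian bounds with linear terms are reduced by it to a multiple
  of \<open>exp (- |v|)\<close>, the only form of decay that the strip lemmas ask for.\<close>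

lemma quadratic_exp_bound:
  fixes B :: real
  assumes "B > 0"
  shows "exp (A * \<bar>v\<bar> - B * v\<^sup>2) \<le> exp ((A + 1)\<^sup>2 / (4 * B)) * exp (- \<bar>v\<bar>)"
proof -
  have "0 \<le> (2 * B * \<bar>v\<bar> - (A + 1))\<^sup>2 / (4 * B)" using assms by simp
  also have "\<dots> = B * v\<^sup>2 - (A + 1) * \<bar>v\<bar> + (A + 1)\<^sup>2 / (4 * B)"
    using assms by (simp add: power2_eq_square field_simps)
  finally show ?thesis by (simp add: exp_add[symmetric] algebra_simps)
qed

section \<open>Gaussian integrals\<close>

lemma gaussian_integral_real:
  fixes a :: real
  assumes a: "a > 0"
  shows "(\<integral>v. exp (- a * v\<^sup>2) \<partial>lborel) = sqrt (pi / a)"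
proof -
  define \<sigma> where "\<sigma> = sqrt (1 / (2 * a))"
  have \<sigma>: "\<sigma> > 0" "\<sigma>\<^sup>2 = 1 / (2 * a)" using a by (auto simp: \<sigma>_def)
  have "1 = (\<integral>v. normal_density 0 \<sigma> v \<partial>lborel)" using \<sigma> by simp
  also have "\<dots> = (\<integral>v. (1 / sqrt (pi / a)) * exp (- a * v\<^sup>2) \<partial>lborel)"
    by (rule Bochner_Integration.integral_cong) (use a in \<open>auto simp: normal_density_def \<sigma>(2) field_simps\<close>)
  also have "\<dots> = (1 / sqrt (pi / a)) * (\<integral>v. exp (- a * v\<^sup>2) \<partial>lborel)" by simp
  finally show ?thesis using a by (simp add: field_simps)
qed

text \<open>The integrand is \<open>exp (a * w^2)\<close> on the vertical line through
  \<open>p\<close>. A translation along the line removes \<open>Im p\<close>, a strip shift removes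
  \<open>Re p\<close>.\<close>

lemma gaussian_integral_complex:
  fixes a :: real and p :: complex
  assumes a: "a > 0"
  shows "(\<integral>v. exp (a * (p + \<i> * of_real v)\<^sup>2) \<partial>lborel) = sqrt (pi / a)"
proof -
  define G where "G w = exp (of_real a * w\<^sup>2)" for w :: complex
  have norm_G: "norm (G w) = exp (a * ((Re w)\<^sup>2 - (Im w)\<^sup>2))" for w
    by (simp add: G_def power2_eq_square)
  have eq: "(\<integral>v. G (Complex x2 v) \<partial>lborel) = (\<integral>v. G (Complex x1 v) \<partial>lborel)" if "x1 < x2" for x1 x2
  proof (rule strip_shift[OF that zero_less_one])
    show "G holomorphic_on {w. x1 - 1 < Re w \<and> Re w < x2 + 1}"
      unfolding G_def by (intro holomorphic_intros)
    fix w assume w: "x1 \<le> Re w" "Re w \<le> x2" "\<bar>Im w\<bar> \<ge> 0"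
    have "\<bar>Re w\<bar> \<le> max \<bar>x1\<bar> \<bar>x2\<bar>" using w by auto
    then have "\<bar>Re w\<bar>\<^sup>2 \<le> (max \<bar>x1\<bar> \<bar>x2\<bar>)\<^sup>2" by (intro power_mono) auto
    then have "norm (G w) \<le> exp (a * (max \<bar>x1\<bar> \<bar>x2\<bar>)\<^sup>2) * exp (0 * \<bar>Im w\<bar> - a * (Im w)\<^sup>2)"
      using a by (simp add: norm_G exp_add[symmetric] algebra_simps)
    also have "\<dots> \<le> exp (a * (max \<bar>x1\<bar> \<bar>x2\<bar>)\<^sup>2) * (exp ((0 + 1)\<^sup>2 / (4 * a)) * exp (- \<bar>Im w\<bar>))"
      by (intro mult_left_mono quadratic_exp_bound a) auto
    finally show "norm (G w) \<le> (exp (a * (max \<bar>x1\<bar> \<bar>x2\<bar>)\<^sup>2) * exp ((0 + 1)\<^sup>2 / (4 * a))) * exp (- \<bar>Im w\<bar>)"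
      by (simp only: mult.assoc)
  qed
  have "(\<integral>v. exp (a * (p + \<i> * of_real v)\<^sup>2) \<partial>lborel) = (\<integral>v. G (Complex (Re p) (Im p + v)) \<partial>lborel)"
  proof (rule Bochner_Integration.integral_cong)
    fix v :: real
    have "p + \<i> * of_real v = Complex (Re p) (Im p + v)" by (simp add: complex_eq_iff)
    then show "exp (a * (p + \<i> * of_real v)\<^sup>2) = G (Complex (Re p) (Im p + v))" by (simp add: G_def)
  qed simp
  also have "\<dots> = (\<integral>v. G (Complex (Re p) v) \<partial>lborel)"
    by (subst (2) lborel_integral_real_affine[of 1 _ "Im p"]) auto
  also have "\<dots> = (\<integral>v. G (Complex 0 v) \<partial>lborel)"
  proof (cases "Re p" "0::real" rule: linorder_cases)
    case less
    then show ?thesis by (rule eq[symmetric])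
  next
    case equal
    then show ?thesis by (simp only:)
  next
    case greater
    then show ?thesis by (rule eq)
  qed
  also have "\<dots> = (\<integral>v. of_real (exp (- a * v\<^sup>2)) \<partial>lborel)"
    by (rule Bochner_Integration.integral_cong)
      (auto simp: G_def Complex_eq power_mult_distrib exp_of_real[symmetric])
  also have "\<dots> = of_real (sqrt (pi / a))"
    using gaussian_integral_real[OF a] by simp
  finally show ?thesis .
qed

text \<open>
  \<open>line c\<close> crosses the real axis at \<open>c\<close> in the direction \<open>exp (3 pi i / 4)\<close>;
  the parameter is the imaginary part, which keeps \<open>sqrt 2\<close> out of the formulas.
\<close>

definition line :: "real \<Rightarrow> real \<Rightarrow> complex" where
  "line c b = of_real c + (\<i> - 1) * of_real b"

definition line_integral :: "real \<Rightarrow> (complex \<Rightarrow> complex) \<Rightarrow> complex" where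
  "line_integral c f = (\<i> - 1) * (\<integral>b. f (line c b) \<partial>lborel)"

lemma Re_line [simp]: "Re (line c b) = c - b" and Im_line [simp]: "Im (line c b) = b"
  by (simp_all add: line_def)

lemma line_plus_one: "line (c + 1) b = line c b + 1"
  by (simp add: line_def)

lemma line_integral_plus_one: "line_integral (c + 1) f = line_integral c (\<lambda>y. f (y + 1))"
  by (simp add: line_integral_def line_plus_one)

lemma norm_line_le: "norm (line c b) \<le> \<bar>c\<bar> + 2 * \<bar>b\<bar>"
  using cmod_le[of "line c b"] by simp

text \<open>At \<open>line c b\<close> the quadratic factor has modulus
  \<open>exp (2 pi a (c b - b^2))\<close>, which is why the paths have this direction. The relevant
  values are \<open>a = 1\<close> and \<open>a = 2\<close>; both make that factor 1 or -1 at the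
  integers.\<close>

definition gauss :: "real \<Rightarrow> complex \<Rightarrow> complex \<Rightarrow> complex" where
  "gauss a \<beta> y = exp (- (pi * \<i> * a * y\<^sup>2) + 2 * pi * \<i> * \<beta> * y)"

lemma holomorphic_gauss: "gauss a \<beta> holomorphic_on S"
  unfolding gauss_def by (intro holomorphic_intros)

lemma continuous_gauss: "continuous_on S (gauss a \<beta>)"
  by (rule holomorphic_on_imp_continuous_on[OF holomorphic_gauss])

lemma line_integral_gauss:
  assumes a: "a > 0"
  shows "line_integral c (gauss a \<beta>) = (\<i> - 1) / sqrt (2 * a) * exp (pi * \<i> * \<beta>\<^sup>2 / a)"
proof -
  \<comment> \<open>Chosen so that \<open>p + i b = i (y - \<beta> / a) / (i - 1)\<close> on the
    line. Since \<open>(i / (i - 1))^2 = - i / 2\<close>, the completed square becomes the exponent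
    of \<open>gaussian_integral_complex\<close> with \<open>2 pi a\<close>.\<close>
  define p where "p = \<i> * (of_real c - \<beta> / a) / (\<i> - 1)"
  have i1: "\<i> - 1 \<noteq> (0::complex)" by (simp add: complex_eq_iff)
  have *: "gauss a \<beta> (line c b) = exp (pi * \<i> * \<beta>\<^sup>2 / a) * exp (of_real (2 * pi * a) * (p + \<i> * of_real b)\<^sup>2)" for b
  proof -
    define y where "y = line c b"
    have "p + \<i> * of_real b = \<i> * (y - \<beta> / a) / (\<i> - 1)"
      using i1 by (simp add: p_def y_def line_def field_simps)
    then have "(p + \<i> * of_real b)\<^sup>2 = (\<i> / (\<i> - 1))\<^sup>2 * (y - \<beta> / a)\<^sup>2"
      by (simp add: power_divide power_mult_distrib)
    also have "(\<i> / (\<i> - 1))\<^sup>2 = - (\<i> / 2)"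
      by (simp add: complex_eq_iff Re_divide Im_divide power2_eq_square)
    finally have "of_real (2 * pi * a) * (p + \<i> * of_real b)\<^sup>2 = - (pi * \<i>) * (a * (y - \<beta> / a)\<^sup>2)"
      by simp
    also have "a * (y - \<beta> / a)\<^sup>2 = a * y\<^sup>2 - 2 * \<beta> * y + \<beta>\<^sup>2 / a"
    proof -
      define q where "q = \<beta> / a"
      have q: "\<beta> = a * q" using a by (simp add: q_def)
      have "a * (y - q)\<^sup>2 = a * y\<^sup>2 - 2 * (a * q) * y + a * q\<^sup>2"
        by (simp add: power2_diff algebra_simps)
      also have "a * q\<^sup>2 = \<beta>\<^sup>2 / a" using a by (simp add: q power2_eq_square)
      finally show ?thesis by (simp only: q_def[symmetric] q[symmetric])
    qed
    finally have "of_real (2 * pi * a) * (p + \<i> * of_real b)\<^sup>2 = - (pi * \<i> * a * y\<^sup>2) + 2 * pi * \<i> * \<beta> * y - pi * \<i> * \<beta>\<^sup>2 / a"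
      by (simp add: algebra_simps)
    then show ?thesis
      unfolding gauss_def y_def by (simp add: exp_add[symmetric])
  qed
  have "(\<integral>b. gauss a \<beta> (line c b) \<partial>lborel) = exp (pi * \<i> * \<beta>\<^sup>2 / a) * sqrt (pi / (2 * pi * a))"
    unfolding * by (simp add: gaussian_integral_complex[of "2 * pi * a" p, simplified] a)
  then show ?thesis using a by (simp add: line_integral_def real_sqrt_divide)
qed

text \<open>With \<open>c = Re y + Im y\<close> one has
  \<open>Re y * Im y = c * Im y - (Im y)^2\<close>, so the Gaussian decay is uniform over all lines
  with \<open>|c|\<close> at most \<open>C\<close>.\<close>

lemma norm_gauss_le:
  assumes a: "a > 0" and y: "\<bar>Re y + Im y\<bar> \<le> C"
  shows "norm (gauss a \<beta> y) \<le> exp (2 * pi * norm \<beta> * C) * exp ((2 * pi * a * C + 4 * pi * norm \<beta> + 1)\<^sup>2 / (8 * pi * a)) * exp (- \<bar>Im y\<bar>)"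
proof -
  define c where "c = Re y + Im y"
  have yl: "y = line c (Im y)" by (simp add: c_def complex_eq_iff)
  have "norm (gauss a \<beta> y) = exp (2 * pi * a * (Re y * Im y) + Re (2 * pi * \<i> * \<beta> * y))"
    by (simp add: gauss_def power2_eq_square)
  also have "\<dots> \<le> exp (2 * pi * a * (C * \<bar>Im y\<bar> - (Im y)\<^sup>2) + 2 * pi * norm \<beta> * (C + 2 * \<bar>Im y\<bar>))"
  proof -
    have "Re y * Im y = c * Im y - (Im y)\<^sup>2" by (simp add: c_def power2_eq_square algebra_simps)
    moreover have "c * Im y \<le> C * \<bar>Im y\<bar>"
    proof -
      have "c * Im y \<le> \<bar>c\<bar> * \<bar>Im y\<bar>" using abs_ge_self[of "c * Im y"] by (simp add: abs_mult)
      also have "\<dots> \<le> C * \<bar>Im y\<bar>" using y by (intro mult_right_mono) (auto simp: c_def)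
      finally show ?thesis .
    qed
    ultimately have 1: "2 * pi * a * (Re y * Im y) \<le> 2 * pi * a * (C * \<bar>Im y\<bar> - (Im y)\<^sup>2)"
      using a by (intro mult_left_mono) auto
    have "Re (2 * pi * \<i> * \<beta> * y) \<le> norm (2 * pi * \<i> * \<beta> * y)" by (rule complex_Re_le_cmod)
    also have "\<dots> = 2 * pi * norm \<beta> * norm y" by (simp add: norm_mult)
    also have "\<dots> \<le> 2 * pi * norm \<beta> * (C + 2 * \<bar>Im y\<bar>)"
      using norm_line_le[of c "Im y"] y yl by (intro mult_left_mono) (auto simp: c_def)
    finally show ?thesis unfolding exp_le_cancel_iff by (rule add_mono[OF 1])
  qed
  also have "\<dots> = exp (2 * pi * norm \<beta> * C) * exp ((2 * pi * a * C + 4 * pi * norm \<beta>) * \<bar>Im y\<bar> - 2 * pi * a * (Im y)\<^sup>2)"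
    by (simp add: exp_add[symmetric] algebra_simps)
  also have "\<dots> \<le> exp (2 * pi * norm \<beta> * C) * (exp ((2 * pi * a * C + 4 * pi * norm \<beta> + 1)\<^sup>2 / (4 * (2 * pi * a))) * exp (- \<bar>Im y\<bar>))"
    by (intro mult_left_mono quadratic_exp_bound) (use a in auto)
  finally show ?thesis by (simp add: mult.assoc)
qed

section \<open>Lower bounds for the sine\<close>

lemma norm_sin_squared':
  fixes z :: complex
  shows "(norm (sin z))\<^sup>2 = (sin (Re z))\<^sup>2 + (sinh (Im z))\<^sup>2"
proof -
  have "(norm (sin z))\<^sup>2 = (exp (2 * Im z) + inverse (exp (2 * Im z)) - 2 * (1 - 2 * (sin (Re z))\<^sup>2)) / 4"
    by (simp add: norm_sin_squared cos_double_sin)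
  also have "\<dots> = (sin (Re z))\<^sup>2 + (sinh (Im z))\<^sup>2"
  proof -
    define E where "E = exp (Im z)"
    have E: "exp (2 * Im z) = E * E" "sinh (Im z) = (E - inverse E) / 2" "E \<noteq> 0"
      by (simp_all add: E_def sinh_field_def exp_minus exp_double power2_eq_square)
    show ?thesis unfolding E(1,2) using E(3) by (simp add: power2_eq_square field_simps)
  qed
  finally show ?thesis .
qed

lemma norm_sin_ge_sinh:
  fixes z :: complex
  shows "\<bar>sinh (Im z)\<bar> \<le> norm (sin z)"
  by (rule power2_le_imp_le) (auto simp: norm_sin_squared')

lemma sinh_ge_self: "x \<ge> 0 \<Longrightarrow> x \<le> sinh (x::real)"
proof -
  assume x: "x \<ge> 0"
  have "sinh 0 - 0 \<le> sinh x - x"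
    by (rule DERIV_nonneg_imp_nondecreasing[OF x])
       (auto intro!: exI derivative_eq_intros simp: cosh_real_ge_1)
  then show ?thesis by simp
qed

lemma abs_sinh_ge: "\<bar>x\<bar> \<le> \<bar>sinh (x::real)\<bar>"
  using sinh_ge_self[of "\<bar>x\<bar>"] by (auto simp: abs_real_def split: if_splits)

lemma norm_sin_pi_ge_Im:
  fixes y :: complex
  shows "pi * \<bar>Im y\<bar> \<le> norm (sin (pi * y))"
  using norm_sin_ge_sinh[of "pi * y"] abs_sinh_ge[of "pi * Im y"] by (simp add: abs_mult)

text \<open>With \<open>x = pi b\<close> the squared modulus is \<open>cos^2 x + sinh^2 x\<close>,
  which is at least 1 because \<open>|sin x| \<le> |sinh x|\<close>. Then
  \<open>exp |x| = 2 sinh |x| + exp (- |x|)\<close> is at most \<open>2 S + 1\<close>, hence at most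
  \<open>3 S\<close>.\<close>

lemma exp_le_norm_sin_half_integer_line:
  "exp (pi * \<bar>b\<bar>) \<le> 3 * norm (sin (pi * line (real N + 1/2) b))"
proof -
  define x where "x = pi * b"
  define S where "S = norm (sin (pi * line (real N + 1/2) b))"
  have "sin (pi * (real N + 1/2 - b)) = sin (real N * pi + (pi / 2 - pi * b))" by (simp add: algebra_simps)
  also have "\<dots> = (-1) ^ N * cos x" by (simp add: sin_add cos_npi sin_npi x_def sin_diff)
  finally have S2: "S\<^sup>2 = (cos x)\<^sup>2 + (sinh x)\<^sup>2"
    unfolding S_def norm_sin_squared' by (simp add: x_def power_mult_distrib flip: power_mult)
  have "\<bar>sin x\<bar> \<le> \<bar>sinh x\<bar>" using abs_sin_x_le_abs_x[of x] abs_sinh_ge[of x] by linarith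
  then have "(sin x)\<^sup>2 \<le> (sinh x)\<^sup>2" by (simp add: abs_le_square_iff)
  then have "1\<^sup>2 \<le> S\<^sup>2" using S2 sin_cos_squared_add[of x] unfolding power_one by linarith
  then have S1: "1 \<le> S" by (rule power2_le_imp_le) (simp add: S_def)
  have Ss: "\<bar>sinh x\<bar> \<le> S" by (rule power2_le_imp_le) (auto simp: S2 S_def[symmetric] , simp add: S_def)
  have "exp \<bar>x\<bar> = 2 * sinh \<bar>x\<bar> + exp (- \<bar>x\<bar>)" by (simp add: sinh_field_def field_simps)
  also have "\<dots> \<le> 2 * S + 1"
    using Ss by (intro add_mono) (auto simp: abs_real_def split: if_splits)
  also have "\<dots> \<le> 3 * S" using S1 by simp
  finally show ?thesis by (simp add: x_def S_def abs_mult)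
qed

text \<open>Multiplication by \<open>1 + i\<close> carries the vertical line
  \<open>Re w = c / 2\<close> to \<open>line c\<close>, which reduces the claim to
  \<open>strip_residue\<close> with the single pole over \<open>N + 1\<close>.\<close>

theorem line_integral_shift:
  fixes g :: "complex \<Rightarrow> complex" and N :: nat
  assumes holo: "g holomorphic_on UNIV" and nonzero: "g (of_nat (Suc N)) \<noteq> 0"
    and decay: "\<And>y. real N + 1/2 \<le> Re y + Im y \<Longrightarrow> Re y + Im y \<le> real N + 3/2 \<Longrightarrow> norm (g y) \<le> K * exp (- \<bar>Im y\<bar>)"
  shows "line_integral (real N + 3/2) (\<lambda>y::complex. g y / (2 * \<i> * sin (pi * y))) =
         line_integral (real N + 1/2) (\<lambda>y::complex. g y / (2 * \<i> * sin (pi * y))) + (-1) ^ Suc N * g (of_nat (Suc N))"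
proof -
  define f :: "complex \<Rightarrow> complex" where "f y = g y / (2 * \<i> * sin (pi * y))" for y :: complex
  define G where "G w = f ((1 + \<i>) * w)" for w
  define p where "p = of_nat (Suc N) / (1 + \<i>)"
  define x1 x2 where "x1 = (real N + 1/2) / 2" and "x2 = (real N + 3/2) / 2"
  have i1: "1 + \<i> \<noteq> (0::complex)" by (simp add: complex_eq_iff)
  have Rep: "Re p = (real N + 1) / 2"
    by (simp add: p_def Re_divide power2_eq_square)
  have translate: "(\<integral>v. G (Complex (c / 2) v) \<partial>lborel) = (\<integral>b. f (line c b) \<partial>lborel)" for c
  proof -
    have "(\<integral>b. f (line c b) \<partial>lborel) = (\<integral>v. f (line c (c / 2 + 1 * v)) \<partial>lborel)"
      by (subst lborel_integral_real_affine[of 1 _ "c/2"]) auto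
    also have "\<dots> = (\<integral>v. G (Complex (c / 2) v) \<partial>lborel)"
      by (rule Bochner_Integration.integral_cong) (auto simp: G_def intro!: arg_cong[of _ _ f] complex_eqI)
    finally show ?thesis ..
  qed
  \<comment> \<open>The margin 1/8 confines \<open>2 * Re w\<close> to the interval from
    \<open>N + 1/4\<close> to \<open>N + 7/4\<close>, whose only integer is
    \<open>N + 1\<close>.\<close>
  have sin_nz: "sin (pi * ((1 + \<i>) * w)) \<noteq> 0"
    if w: "x1 - 1/8 < Re w" "Re w < x2 + 1/8" "w \<noteq> p" for w
  proof
    assume "sin (pi * ((1 + \<i>) * w)) = 0"
    then obtain m :: int where "complex_of_real pi * ((1 + \<i>) * w) = of_real (m * pi)"
      unfolding sin_eq_0 by blast
    then have m: "(1 + \<i>) * w = of_int m" by simp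
    then have "Re ((1 + \<i>) * w) = m" "Im ((1 + \<i>) * w) = 0" by auto
    then have "2 * Re w = m" by simp
    moreover have "2 * Re w > real N + 1/4" using w(1) by (simp add: x1_def field_simps)
    moreover have "2 * Re w < real N + 7/4" using w(2) by (simp add: x2_def field_simps)
    ultimately have "real_of_int m > real_of_int (int N)" "real_of_int m < real_of_int (int N + 2)" by simp_all
    then have "m > int N" "m < int N + 2" by (simp_all only: of_int_less_iff)
    then have "m = int (Suc N)" by linarith
    then have "w = p" using m i1 by (simp add: p_def field_simps)
    with w show False by simp
  qed
  have h1: "(\<lambda>w. g ((1 + \<i>) * w)) holomorphic_on A" for A
    using holomorphic_on_compose_gen[OF _ holo, of "\<lambda>w. (1 + \<i>) * w" A] by (auto simp: o_def intro!: holomorphic_intros)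
  \<comment> \<open>For \<open>y = (1 + i) w\<close> we have \<open>Im y = Re w + Im w\<close>. The
    value of \<open>B\<close> forces \<open>|Im y| \<ge> 1\<close>, where the sine is at least 1 in
    modulus; the factor \<open>exp (N + 3/2)\<close> pays for passing from \<open>Im y\<close> to
    \<open>Im w\<close> in the decay.\<close>
  have "(\<integral>v. G (Complex x2 v) \<partial>lborel) - (\<integral>v. G (Complex x1 v) \<partial>lborel) = 2 * pi * residue G p"
  proof (rule strip_residue[where e = "1/8" and B = "(real N + 3/2) + 1" and K = "\<bar>K\<bar> * exp (real N + 3/2)"])
    show "G holomorphic_on {w. x1 - 1 / 8 < Re w \<and> Re w < x2 + 1 / 8} - {p}"
      unfolding G_def f_def using sin_nz by (auto intro!: holomorphic_intros h1)
    fix w assume w: "x1 \<le> Re w" "Re w \<le> x2" "real N + 3 / 2 + 1 \<le> \<bar>Im w\<bar>"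
    define y where "y = (1 + \<i>) * w"
    have y: "Re y + Im y = 2 * Re w" "Im y = Re w + Im w" by (auto simp: y_def)
    have "pi * 1 \<le> pi * \<bar>Im y\<bar>" using w by (intro mult_left_mono) (auto simp: y x1_def x2_def)
    then have s: "1 \<le> norm (sin (pi * y))" using norm_sin_pi_ge_Im[of y] pi_gt3 by linarith
    have "norm (G w) = norm (g y) / (2 * norm (sin (pi * y)))"
      by (simp add: G_def f_def y_def norm_divide norm_mult)
    also have "\<dots> \<le> norm (g y) / 1" using s by (intro divide_left_mono) auto
    also have "\<dots> \<le> K * exp (- \<bar>Im y\<bar>)" 
      using w by (simp, intro decay) (simp_all add: y(1) x1_def x2_def)
    also have "\<dots> \<le> \<bar>K\<bar> * exp ((real N + 3/2) - \<bar>Im w\<bar>)"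
      using w by (intro mult_mono) (auto simp: y x1_def x2_def)
    also have "\<dots> = \<bar>K\<bar> * exp (real N + 3/2) * exp (- \<bar>Im w\<bar>)"
      by (simp only: mult.assoc exp_add[symmetric] diff_conv_add_uminus)
    finally show "norm (G w) \<le> \<bar>K\<bar> * exp (real N + 3/2) * exp (- \<bar>Im w\<bar>)" .
  qed (auto simp: x1_def x2_def Rep)
  moreover have "residue G p = g (of_nat (Suc N)) / (2 * \<i> * pi * (1 + \<i>) * (-1) ^ Suc N)"
  proof -
    have pp: "(1 + \<i>) * p = of_nat (Suc N)" using i1 by (simp add: p_def)
    have cosN: "cos (complex_of_real pi * of_nat (Suc N)) = (-1) ^ Suc N"
    proof -
      have "cos (complex_of_real pi * of_nat (Suc N)) = of_real (cos (real (Suc N) * pi))"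
        by (simp add: cos_of_real[symmetric] mult.commute)
      then show ?thesis unfolding cos_npi by simp
    qed
    have sinN: "sin (complex_of_real pi * of_nat (Suc N)) = 0"
    proof -
      have "sin (complex_of_real pi * of_nat (Suc N)) = of_real (sin (real (Suc N) * pi))"
        by (simp add: sin_of_real[symmetric] mult.commute)
      then show ?thesis unfolding sin_npi by simp
    qed
    have D: "((\<lambda>w. 2 * \<i> * sin (pi * ((1 + \<i>) * w))) has_field_derivative
          (2 * \<i> * pi * (1 + \<i>) * (-1) ^ Suc N)) (at p)"
      by (rule derivative_eq_intros refl | simp only: pp cosN | simp)+
    show ?thesis
      unfolding G_def f_def
      by (subst residue_simple_pole_deriv[where s = UNIV and g' = "2 * \<i> * pi * (1 + \<i>) * (-1) ^ Suc N"])
         (use D i1 h1 pp sinN nonzero in \<open>auto intro!: holomorphic_intros\<close>)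
  qed
  ultimately have "(\<integral>b. f (line (real N + 3/2) b) \<partial>lborel) - (\<integral>b. f (line (real N + 1/2) b) \<partial>lborel) =
     2 * pi * (g (of_nat (Suc N)) / (2 * \<i> * pi * (1 + \<i>) * (-1) ^ Suc N))"
    by (simp add: x1_def x2_def translate[symmetric])
  then have "line_integral (real N + 3/2) f - line_integral (real N + 1/2) f =
     (\<i> - 1) * (2 * pi * (g (of_nat (Suc N)) / (2 * \<i> * pi * (1 + \<i>) * (-1) ^ Suc N)))"
    by (simp add: line_integral_def algebra_simps flip: right_diff_distrib)
  also have "\<dots> = (-1) ^ Suc N * g (of_nat (Suc N)) * ((\<i> - 1) / (\<i> * (1 + \<i>)))"
    by (cases "even N") (simp_all add: field_simps)
  also have "(\<i> - 1) / (\<i> * (1 + \<i>)) = (1::complex)" by (simp add: algebra_simps complex_eq_iff Re_divide Im_divide)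
  finally show ?thesis by (simp add: f_def[abs_def] algebra_simps)
qed

section \<open>Mordell integrals\<close>

lemma exp_pi_i_minus_exp: "exp (pi * \<i> * z) - exp (- (pi * \<i> * z)) = 2 * \<i> * sin (pi * z)" for z :: complex
proof -
  have "pi * \<i> * z = \<i> * (pi * z)" by simp
  then show ?thesis by (simp only: sin_exp_eq) simp
qed

lemma sin_half_integer_line_nonzero: "sin (pi * line (real N + 1/2) b) \<noteq> 0"
proof
  assume "sin (pi * line (real N + 1/2) b) = 0"
  then have "exp (pi * \<bar>b\<bar>) \<le> 0" using exp_le_norm_sin_half_integer_line[of b N] by simp
  then show False by simp
qed

lemma inverse_sin_half_integer_line_le:
  "norm (1 / (2 * \<i> * sin (pi * line (real N + 1/2) b))) \<le> 3 / 2 * exp (- (pi * \<bar>b\<bar>))"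
proof -
  have "norm (1 / (2 * \<i> * sin (pi * line (real N + 1/2) b))) = 1 / (2 * norm (sin (pi * line (real N + 1/2) b)))"
    by (simp add: norm_divide norm_mult)
  also have "\<dots> \<le> 3 / 2 * exp (- (pi * \<bar>b\<bar>))"
    using exp_le_norm_sin_half_integer_line[of b N] sin_half_integer_line_nonzero[of N b]
    by (simp add: exp_minus field_simps)
  finally show ?thesis .
qed

lemma continuous_line [continuous_intros]: "continuous_on S (line c)"
  unfolding line_def by (intro continuous_intros)

lemma integrable_line_gauss:
  assumes "a > 0"
  shows "integrable lborel (\<lambda>b. gauss a \<beta> (line c b))"
proof (rule integrable_exp_decay)
  show "continuous_on UNIV (\<lambda>b. gauss a \<beta> (line c b))"
    by (rule continuous_on_compose2[OF continuous_gauss]) (auto intro: continuous_intros)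
  show "norm (gauss a \<beta> (line c b)) \<le> (exp (2 * pi * norm \<beta> * \<bar>c\<bar>) *
      exp ((2 * pi * a * \<bar>c\<bar> + 4 * pi * norm \<beta> + 1)\<^sup>2 / (8 * pi * a))) * exp (- \<bar>b\<bar>)" if "\<bar>b\<bar> \<ge> 0" for b
    using norm_gauss_le[of a "line c b" "\<bar>c\<bar>" \<beta>] assms by simp
qed

definition mordell :: "nat \<Rightarrow> real \<Rightarrow> complex \<Rightarrow> complex" where
  "mordell N a \<beta> = line_integral (real N + 1/2) (\<lambda>y::complex. gauss a \<beta> y / (2 * \<i> * sin (pi * y)))"

lemma continuous_half_integer_line_over_sin:
  assumes "continuous_on {y. Re y + Im y = real N + 1/2} g"
  shows "continuous_on UNIV (\<lambda>b. g (line (real N + 1/2) b) / (2 * \<i> * sin (pi * line (real N + 1/2) b)))"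
  by (intro continuous_intros continuous_on_compose2[OF assms])
     (auto simp: sin_half_integer_line_nonzero)

lemma integrable_half_integer_line_over_sin:
  assumes cont: "continuous_on {y. Re y + Im y = real N + 1/2} g"
    and int: "integrable lborel (\<lambda>b. g (line (real N + 1/2) b))"
  shows "integrable lborel (\<lambda>b. g (line (real N + 1/2) b) / (2 * \<i> * sin (pi * line (real N + 1/2) b)))"
proof (rule Bochner_Integration.integrable_bound)
  show "integrable lborel (\<lambda>b. 3 / 2 * norm (g (line (real N + 1/2) b)))"
    using int by simp
  show "(\<lambda>b. g (line (real N + 1/2) b) / (2 * \<i> * sin (pi * line (real N + 1/2) b))) \<in> borel_measurable lborel"
    using borel_measurable_continuous_onI[OF continuous_half_integer_line_over_sin[OF cont]] by simp
  show "AE b in lborel. norm (g (line (real N + 1/2) b) / (2 * \<i> * sin (pi * line (real N + 1/2) b)))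
      \<le> norm (3 / 2 * norm (g (line (real N + 1/2) b)))"
  proof (rule AE_I2)
    fix b
    have "norm (1 / (2 * \<i> * sin (pi * line (real N + 1/2) b))) \<le> 3 / 2 * 1"
      by (rule order_trans[OF inverse_sin_half_integer_line_le]) (intro mult_left_mono, auto)
    then have "norm (g (line (real N + 1/2) b)) * norm (1 / (2 * \<i> * sin (pi * line (real N + 1/2) b)))
        \<le> norm (g (line (real N + 1/2) b)) * (3 / 2)"
      by (intro mult_left_mono) auto
    then show "norm (g (line (real N + 1/2) b) / (2 * \<i> * sin (pi * line (real N + 1/2) b)))
      \<le> norm (3 / 2 * norm (g (line (real N + 1/2) b)))"
      by (simp add: norm_mult norm_divide)
  qed
qed

lemma integrable_mordell:
  assumes "a > 0"
  shows "integrable lborel (\<lambda>b. gauss a \<beta> (line (real N + 1/2) b) / (2 * \<i> * sin (pi * line (real N + 1/2) b)))"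
  by (intro integrable_half_integer_line_over_sin continuous_gauss integrable_line_gauss assms)

lemma mordell_Suc:
  assumes a: "a > 0"
  shows "mordell (Suc N) a \<beta> = mordell N a \<beta> + (-1) ^ Suc N * gauss a \<beta> (of_nat (Suc N))"
proof -
  have e: "real (Suc N) + 1/2 = real N + 3/2" by simp
  show ?thesis
    unfolding mordell_def e
  proof (rule line_integral_shift)
    fix y assume y: "real N + 1/2 \<le> Re y + Im y" "Re y + Im y \<le> real N + 3/2"
    then have "\<bar>Re y + Im y\<bar> \<le> real N + 3/2" by auto
    from norm_gauss_le[OF a this]
    show "norm (gauss a \<beta> y) \<le> (exp (2 * pi * norm \<beta> * (real N + 3/2)) *
      exp ((2 * pi * a * (real N + 3/2) + 4 * pi * norm \<beta> + 1)\<^sup>2 / (8 * pi * a))) * exp (- \<bar>Im y\<bar>)" .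
  qed (auto simp: holomorphic_gauss, simp add: gauss_def)
qed

lemma sin_pi_plus_one: "sin (pi * (y + 1)) = - sin (pi * y)" for y :: complex
  by (simp add: distrib_left sin_add flip: sin_of_real cos_of_real)

text \<open>Under \<open>y + 1\<close> the cross term of the square lowers \<open>u\<close> by 1,
  and the factor \<open>exp (- pi i)\<close> cancels the sign change of the sine.\<close>

lemma mordell_Suc_gauss_1: "mordell (Suc N) 1 u = exp (2 * pi * \<i> * u) * mordell N 1 (u - 1)"
proof -
  have e: "real (Suc N) + 1/2 = (real N + 1/2) + 1" by simp
  have *: "gauss 1 u (y + 1) / (2 * \<i> * sin (pi * (y + 1))) =
      exp (2 * pi * \<i> * u) * (gauss 1 (u - 1) y / (2 * \<i> * sin (pi * y)))" for y :: complex
  proof -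
    have "gauss 1 u (y + 1) = exp (2 * pi * \<i> * u + (- (pi * \<i> * 1 * y\<^sup>2) + 2 * pi * \<i> * (u - 1) * y) + - (of_real pi * \<i>))"
      unfolding gauss_def by (intro arg_cong[of _ _ exp]) (simp add: algebra_simps power2_eq_square)
    also have "\<dots> = - (exp (2 * pi * \<i> * u) * gauss 1 (u - 1) y)"
      unfolding exp_add gauss_def by (simp add: exp_minus)
    finally show ?thesis by (simp only: sin_pi_plus_one) simp
  qed
  show ?thesis
    unfolding mordell_def e line_integral_plus_one *
    unfolding line_integral_def integral_mult_right_zero by (simp only: mult.left_commute)
qed

text \<open>The difference of the numerators is \<open>gauss 1 (u - 1/2) y\<close> times
  \<open>exp (pi i y) - exp (- pi i y)\<close>. This cancels the denominator and leaves a pure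
  Gaussian integral.\<close>

lemma mordell_diff_gauss_1: "mordell N 1 u - mordell N 1 (u - 1) = - exp (pi * \<i> * (u\<^sup>2 - u))"
proof -
  have *: "gauss 1 u y / (2 * \<i> * sin (pi * y)) - gauss 1 (u - 1) y / (2 * \<i> * sin (pi * y)) = gauss 1 (u - 1/2) y"
    if "sin (pi * y) \<noteq> 0" for y :: complex
  proof -
    have "gauss 1 u y = gauss 1 (u - 1/2) y * exp (pi * \<i> * y)"
         "gauss 1 (u - 1) y = gauss 1 (u - 1/2) y * exp (- (pi * \<i> * y))"
      unfolding gauss_def exp_add[symmetric] by (intro arg_cong[of _ _ exp]; simp add: algebra_simps)+
    then have "gauss 1 u y - gauss 1 (u - 1) y = gauss 1 (u - 1/2) y * (2 * \<i> * sin (pi * y))"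
      unfolding exp_pi_i_minus_exp[symmetric] by (simp add: algebra_simps)
    with that show ?thesis by (simp add: diff_divide_distrib[symmetric])
  qed
  have "mordell N 1 u - mordell N 1 (u - 1) = line_integral (real N + 1/2) (gauss 1 (u - 1/2))"
    unfolding mordell_def line_integral_def right_diff_distrib[symmetric]
    by (subst Bochner_Integration.integral_diff[symmetric])
       (auto simp: integrable_mordell * sin_half_integer_line_nonzero)
  also have "\<dots> = (\<i> - 1) / sqrt 2 * exp (pi * \<i> * (u - 1/2)\<^sup>2)"
    by (simp add: line_integral_gauss)
  also have "pi * \<i> * (u - 1/2)\<^sup>2 = pi * \<i> * (u\<^sup>2 - u) + \<i> * of_real (pi / 4)"
    by (simp add: power2_eq_square algebra_simps)
  also have "exp \<dots> = exp (pi * \<i> * (u\<^sup>2 - u)) * ((1 + \<i>) / sqrt 2)"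
    unfolding exp_add cis_conv_exp[symmetric]
    by (simp add: complex_eq_iff cos_45 sin_45 Re_divide Im_divide field_simps)
  also have "(\<i> - 1) / sqrt 2 * (exp (pi * \<i> * (u\<^sup>2 - u)) * ((1 + \<i>) / sqrt 2)) =
      exp (pi * \<i> * (u\<^sup>2 - u)) * ((\<i> - 1) * (1 + \<i>) / (complex_of_real (sqrt 2) * complex_of_real (sqrt 2)))"
    by (simp only: times_divide_eq_right times_divide_eq_left divide_divide_eq_left mult_ac)
  also have "complex_of_real (sqrt 2) * complex_of_real (sqrt 2) = 2"
    by (simp flip: of_real_mult)
  also have "(\<i> - 1) * (1 + \<i>) / 2 = -1"
    by (simp add: algebra_simps)
  finally show ?thesis by simp
qed

text \<open>
  The shift of the path by 1 and the shift of the parameter by 1 give two linear relations between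
  \<open>mordell N 1 u\<close> and \<open>mordell N 1 (u - 1)\<close>, which determine both.
\<close>

theorem mordell_gauss_1:
  fixes u :: complex
  assumes "exp (2 * pi * \<i> * u) \<noteq> 1"
  shows "exp (pi * \<i> * u\<^sup>2) / (2 * \<i> * sin (pi * u)) =
    - mordell N 1 u - exp (2 * pi * \<i> * u) ^ Suc N / (1 - exp (2 * pi * \<i> * u))"
proof -
  define q where "q = exp (2 * pi * \<i> * u)"
  define h where "h = exp (pi * \<i> * u)"
  define E where "E = exp (pi * \<i> * u\<^sup>2)"
  have q: "q = h * h" unfolding q_def h_def exp_add[symmetric] by (intro arg_cong[of _ _ exp]) simp
  have h0: "h \<noteq> 0" by (simp add: h_def)
  have E: "exp (pi * \<i> * (u\<^sup>2 - u)) = E / h" by (simp add: E_def h_def right_diff_distrib exp_diff)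
  have s: "2 * \<i> * sin (pi * u) = h - inverse h"
    unfolding exp_pi_i_minus_exp[symmetric] by (simp add: h_def exp_minus)
  \<comment> \<open>The square of an integer has the parity of the integer, so the sign of the
    quadratic factor cancels that of the residue.\<close>
  have g: "(-1) ^ Suc N * gauss 1 u (of_nat (Suc N)) = q ^ Suc N"
  proof -
    have "gauss 1 u (of_nat (Suc N)) = exp (of_nat (Suc N * Suc N) * (- (pi * \<i>)) + of_nat (Suc N) * (2 * pi * \<i> * u))"
      unfolding gauss_def by (intro arg_cong[of _ _ exp]) (simp add: algebra_simps power2_eq_square)
    also have "\<dots> = (-1) ^ (Suc N * Suc N) * q ^ Suc N"
      unfolding exp_add exp_of_nat_mult q_def by (simp add: exp_minus)
    also have "(-1) ^ (Suc N * Suc N) = ((-1) ^ Suc N :: complex)"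
      by (simp only: minus_one_power_iff even_mult_iff) simp
    finally show ?thesis by (simp add: mult.assoc[symmetric] power_mult_distrib[symmetric])
  qed
  have "mordell N 1 u + q ^ Suc N = q * (mordell N 1 u + E / h)"
    using mordell_Suc_gauss_1[of N u] mordell_Suc[of 1 N u] mordell_diff_gauss_1[of N u]
    unfolding g E q_def[symmetric] by (simp add: algebra_simps)
  moreover have "q * (E / h) = E * h" using h0 by (simp add: q)
  ultimately have "mordell N 1 u * (1 - q) = E * h - q ^ Suc N"
    by (simp add: algebra_simps)
  moreover have "1 - q \<noteq> 0" using assms by (simp add: q_def)
  ultimately have M: "mordell N 1 u = (E * h - q ^ Suc N) / (1 - q)" by (simp add: field_simps)
  have "E / (h - inverse h) = - (E * h / (1 - q))"
  proof -
    have "h - inverse h = - ((1 - q) / h)" using h0 by (simp add: q field_simps)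
    then show ?thesis by simp
  qed
  then show ?thesis
    unfolding s M E_def[symmetric] q_def[symmetric] by (simp add: diff_divide_distrib)
qed

section \<open>A Mellin transform\<close>

text \<open>The integrand of Euler's integral for \<open>Gamma z * a powr (- z)\<close>, extended by
  0 so that it can be integrated, and combined with Fubini, over the whole line.\<close>

definition gamma_kernel :: "complex \<Rightarrow> complex \<Rightarrow> real \<Rightarrow> complex" where
  "gamma_kernel z a t = indicator {0<..} t *\<^sub>R (of_real t powr (z - 1) * exp (- (a * of_real t)))"

lemma borel_measurable_gamma_kernel [measurable]: "gamma_kernel z a \<in> borel_measurable borel"
  unfolding gamma_kernel_def
  by (intro borel_measurable_continuous_on_indicator continuous_intros) auto

lemma norm_gamma_kernel:
  "norm (gamma_kernel z a t) = indicator {0<..} t * (t powr (Re z - 1) * exp (- Re a * t))"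
  by (simp add: gamma_kernel_def norm_mult norm_powr_real_powr indicator_def)

lemma integrable_gamma_kernel:
  assumes z: "Re z > 0" and a: "Re a > 0"
  shows "integrable lborel (gamma_kernel z a)"
proof -
  have "gamma_kernel z (of_real (Re a)) = (\<lambda>t. indicator {0<..} t *\<^sub>R (of_real t powr (z - 1) / of_real (exp (Re a * t))))"
    by (rule ext) (simp add: gamma_kernel_def exp_minus exp_of_real[symmetric] divide_inverse)
  then have "integrable lborel (gamma_kernel z (of_real (Re a)))"
    using absolutely_integrable_Gamma_integral[OF z a]
      integrable_completion[of "gamma_kernel z (of_real (Re a))" lborel]
    by (simp add: set_integrable_def)
  then show ?thesis
    by (rule Bochner_Integration.integrable_bound) (auto simp: norm_gamma_kernel)
qed

lemma gamma_kernel_integral_1: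
  assumes z: "Re z > 0"
  shows "(\<integral>t. gamma_kernel z 1 t \<partial>lborel) = Gamma z"
proof -
  have e: "gamma_kernel z 1 t = indicator {0<..} t *\<^sub>R (of_real t powr (z - 1) / of_real (exp t))" for t
    by (simp add: gamma_kernel_def exp_minus exp_of_real[symmetric] divide_inverse)
  have "set_integrable lborel {0<..} (\<lambda>t. of_real t powr (z - 1) / complex_of_real (exp t))"
    using integrable_gamma_kernel[OF z, of 1] unfolding set_integrable_def e[symmetric] by simp
  from set_borel_integral_eq_integral(2)[OF this]
  have "(\<integral>t. gamma_kernel z 1 t \<partial>lborel) = integral {0<..} (\<lambda>t. of_real t powr (z - 1) / of_real (exp t))"
    by (simp add: set_lebesgue_integral_def e)
  then show ?thesis using Gamma_integral_complex'[OF z] by (simp add: integral_unique)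
qed

lemma gamma_kernel_mult_power:
  "gamma_kernel z a t * of_real t ^ m = gamma_kernel (z + of_nat m) a t"
proof (cases "t > 0")
  case True
  then have "complex_of_real t powr (z + of_nat m - 1) = of_real t powr (z - 1) * of_real t ^ m"
    using powr_add[of "of_real t" "z - 1" "of_nat m"] powr_nat[of "of_real t" m]
    by (simp add: algebra_simps)
  then show ?thesis by (simp add: gamma_kernel_def)
qed (simp add: gamma_kernel_def)

text \<open>Expand \<open>exp (- w t)\<close> and recognise the binomial series of \<open>(1 + w) powr (- z)\<close>.\<close>

lemma gamma_kernel_integral_near_1:
  assumes z: "Re z > 0" and w: "norm w < 1"
  shows "(\<integral>t. gamma_kernel z (1 + w) t \<partial>lborel) = Gamma z * (1 + w) powr (- z)"
proof -
  define S where "S n t = (\<Sum>m<n. (- w) ^ m / fact m * (gamma_kernel z 1 t * of_real t ^ m))" for n t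
  have zm: "Re (z + of_nat m) > 0" for m using z by simp
  have int: "integrable lborel (\<lambda>t. gamma_kernel z 1 t * of_real t ^ m)" for m
    unfolding gamma_kernel_mult_power by (rule integrable_gamma_kernel[OF zm]) simp
  have "z \<notin> \<int>\<^sub>\<le>\<^sub>0" using z by (auto elim!: nonpos_Ints_cases)
  then have poch: "Gamma (z + of_nat m) = pochhammer z m * Gamma z" for m
    using pochhammer_Gamma[of z m] z Gamma_eq_zero_iff[of z] by simp
  have S_int: "(\<integral>t. S n t \<partial>lborel) = (\<Sum>m<n. Gamma z * ((- z gchoose m) * w ^ m))" for n
  proof -
    have "(\<integral>t. S n t \<partial>lborel) = (\<Sum>m<n. (- w) ^ m / fact m * Gamma (z + of_nat m))"
      unfolding S_def using int
      by (simp add: gamma_kernel_mult_power gamma_kernel_integral_1[OF zm])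
    also have "\<dots> = (\<Sum>m<n. Gamma z * ((- z gchoose m) * w ^ m))"
      by (intro sum.cong refl) (simp add: poch gbinomial_pochhammer power_minus[of w])
    finally show ?thesis .
  qed
  have "(\<lambda>n. \<integral>t. S n t \<partial>lborel) \<longlonglongrightarrow> Gamma z * (1 + w) powr (- z)"
    using sums_mult[OF gen_binomial_complex[OF w, of "- z"], of "Gamma z"] unfolding S_int sums_def .
  moreover have "(\<lambda>n. \<integral>t. S n t \<partial>lborel) \<longlonglongrightarrow> (\<integral>t. gamma_kernel z (1 + w) t \<partial>lborel)"
  proof (rule integral_dominated_convergence)
    \<comment> \<open>The partial sums of \<open>exp (- w t)\<close> are bounded by
      \<open>exp (norm w * t)\<close>, which lowers the rate of decay from 1 to
      \<open>1 - norm w > 0\<close>.\<close>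
    show "integrable lborel (\<lambda>t. norm (gamma_kernel z (of_real (1 - norm w)) t))"
      using integrable_gamma_kernel[OF z, of "of_real (1 - norm w)"] w by simp
    show "AE t in lborel. (\<lambda>n. S n t) \<longlonglongrightarrow> gamma_kernel z (1 + w) t"
    proof (rule AE_I2)
      fix t
      have "(\<lambda>m. gamma_kernel z 1 t * ((- w * of_real t) ^ m /\<^sub>R fact m)) sums (gamma_kernel z 1 t * exp (- w * of_real t))"
        by (intro sums_mult exp_converges)
      moreover have "gamma_kernel z 1 t * exp (- w * of_real t) = gamma_kernel z (1 + w) t"
        by (simp add: gamma_kernel_def exp_add[symmetric] algebra_simps)
      moreover have "(\<lambda>m. gamma_kernel z 1 t * ((- w * of_real t) ^ m /\<^sub>R fact m)) =
          (\<lambda>m. (- w) ^ m / fact m * (gamma_kernel z 1 t * of_real t ^ m))"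
        unfolding power_mult_distrib scaleR_conv_of_real by (simp add: divide_inverse mult_ac)
      ultimately show "(\<lambda>n. S n t) \<longlonglongrightarrow> gamma_kernel z (1 + w) t"
        unfolding S_def sums_def by (simp only:)
    qed
    show "AE t in lborel. norm (S n t) \<le> norm (gamma_kernel z (of_real (1 - norm w)) t)" for n
    proof (rule AE_I2)
      fix t
      show "norm (S n t) \<le> norm (gamma_kernel z (of_real (1 - norm w)) t)"
      proof (cases "t > 0")
        case True
        have "norm (S n t) \<le> (\<Sum>m<n. norm (gamma_kernel z 1 t) * ((norm w * t) ^ m / fact m))"
          unfolding S_def using True
          by (intro sum_norm_le) (simp add: norm_mult norm_divide norm_power power_mult_distrib field_simps)
        also have "\<dots> = norm (gamma_kernel z 1 t) * (\<Sum>m<n. (norm w * t) ^ m / fact m)"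
          by (simp add: sum_distrib_left)
        also have "\<dots> \<le> norm (gamma_kernel z 1 t) * exp (norm w * t)"
        proof (intro mult_left_mono)
          have s: "(\<lambda>m. (norm w * t) ^ m / fact m) sums exp (norm w * t)"
            using exp_converges[of "norm w * t"] by (simp add: divide_inverse mult.commute)
          then have "(\<Sum>m<n. (norm w * t) ^ m / fact m) \<le> (\<Sum>m. (norm w * t) ^ m / fact m)"
            using True by (intro sum_le_suminf) (auto simp: sums_iff)
          then show "(\<Sum>m<n. (norm w * t) ^ m / fact m) \<le> exp (norm w * t)"
            using s by (simp add: sums_iff)
        qed simp
        also have "\<dots> = norm (gamma_kernel z (of_real (1 - norm w)) t)"
          using True by (simp add: norm_gamma_kernel exp_add[symmetric] algebra_simps)
        finally show ?thesis .
      qed (simp add: S_def gamma_kernel_def)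
    qed
    show "S n \<in> borel_measurable lborel" for n unfolding S_def by measurable
  qed auto
  ultimately show ?thesis using LIMSEQ_unique by blast
qed

text \<open>Every \<open>a\<close> in the right half plane is within distance \<open>A\<close> of some real \<open>A\<close>.\<close>

theorem gamma_kernel_integral:
  assumes z: "Re z > 0" and a: "Re a > 0"
  shows "(\<integral>t. gamma_kernel z a t \<partial>lborel) = Gamma z * a powr (- z)"
proof -
  \<comment> \<open>From \<open>|a - A|^2 = |a|^2 - 2 A Re a + A^2\<close>, the condition
    \<open>|a - A| < A\<close> means \<open>A > |a|^2 / (2 Re a)\<close>.\<close>
  define A where "A = (norm a)\<^sup>2 / (2 * Re a) + 1"
  have A: "A > 0" using a by (simp add: A_def add_nonneg_pos)
  define w where "w = (a - of_real A) / of_real A"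
  have aw: "a = of_real A * (1 + w)" using A by (simp add: w_def field_simps)
  have "(norm (a - of_real A))\<^sup>2 = (norm a)\<^sup>2 - 2 * A * Re a + A\<^sup>2"
    by (simp add: cmod_power2 power2_diff algebra_simps)
  also have "2 * A * Re a = (norm a)\<^sup>2 + 2 * Re a" using a by (simp add: A_def field_simps)
  finally have "(norm (a - of_real A))\<^sup>2 < A\<^sup>2" using a by simp
  then have "norm (a - of_real A) < A" using A by (simp add: power2_less_imp_less)
  then have w: "norm w < 1" using A by (simp add: w_def norm_divide)
  have "(\<integral>t. gamma_kernel z (1 + w) t \<partial>lborel) = \<bar>A\<bar> *\<^sub>R (\<integral>t. gamma_kernel z (1 + w) (0 + A * t) \<partial>lborel)"
    by (rule lborel_integral_real_affine) (use A in auto)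
  also have "(\<lambda>t. gamma_kernel z (1 + w) (0 + A * t)) = (\<lambda>t. of_real A powr (z - 1) * gamma_kernel z a t)"
  proof
    fix t
    show "gamma_kernel z (1 + w) (0 + A * t) = of_real A powr (z - 1) * gamma_kernel z a t"
    proof (cases "t > 0")
      case True
      then have "complex_of_real (A * t) powr (z - 1) = of_real A powr (z - 1) * of_real t powr (z - 1)"
        using A by (simp add: powr_times_real)
      then show ?thesis using A True by (simp add: gamma_kernel_def aw algebra_simps)
    qed (use A in \<open>simp add: gamma_kernel_def zero_less_mult_iff\<close>)
  qed
  also have "\<bar>A\<bar> *\<^sub>R (\<integral>t. of_real A powr (z - 1) * gamma_kernel z a t \<partial>lborel) =
      of_real A powr z * (\<integral>t. gamma_kernel z a t \<partial>lborel)"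
    using A by (simp add: scaleR_conv_of_real powr_diff)
  finally have 1: "of_real A powr z * (\<integral>t. gamma_kernel z a t \<partial>lborel) = Gamma z * (1 + w) powr (- z)"
    by (simp add: gamma_kernel_integral_near_1[OF z w])
  have 2: "a powr (- z) = of_real A powr (- z) * (1 + w) powr (- z)"
    unfolding aw using A by (intro powr_times_real_left) auto
  have 3: "of_real A powr (- z) * of_real A powr z = (1::complex)"
    using A by (simp add: powr_minus)
  have "(\<integral>t. gamma_kernel z a t \<partial>lborel) = of_real A powr (- z) * of_real A powr z * (\<integral>t. gamma_kernel z a t \<partial>lborel)"
    by (simp only: 3 mult_1)
  also have "\<dots> = of_real A powr (- z) * (Gamma z * (1 + w) powr (- z))"
    by (simp only: mult.assoc 1)
  finally show ?thesis by (simp only: 2 mult_ac)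
qed

section \<open>Shifting the path of integration into the origin\<close>

lemma sin_ge_cubic:
  fixes x :: real
  assumes "x \<ge> 0"
  shows "x - x ^ 3 / 6 \<le> sin x"
proof -
  have "sin 0 - 0 + 0 ^ 3 / 6 \<le> sin x - x + x ^ 3 / 6"
  proof (rule DERIV_nonneg_imp_nondecreasing[OF assms])
    fix y :: real
    have "(sin (y / 2))\<^sup>2 \<le> (y / 2)\<^sup>2"
      using abs_sin_x_le_abs_x[of "y / 2"] by (rule abs_le_square_iff[THEN iffD1])
    then have "cos y - 1 + y\<^sup>2 / 2 \<ge> 0"
      using cos_double_sin[of "y / 2"] by (simp add: power2_eq_square)
    moreover have "((\<lambda>x. sin x - x + x ^ 3 / 6) has_real_derivative (cos y - 1 + y\<^sup>2 / 2)) (at y)"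
      by (auto intro!: derivative_eq_intros simp: power2_eq_square)
    ultimately show "\<exists>d. ((\<lambda>x. sin x - x + x ^ 3 / 6) has_real_derivative d) (at y) \<and> 0 \<le> d" by blast
  qed
  then show ?thesis by simp
qed

text \<open>The only zero of the sine in this region is the origin, so the quotient is bounded. Away
  from the real axis \<open>sinh\<close> alone suffices; near it \<open>|Re z| \<le> 3/4\<close>, a
  range in which the cubic Taylor bound for the sine is still positive.\<close>

lemma norm_le_5_sin_pi:
  fixes z :: complex
  assumes z: "\<bar>Re z\<bar> \<le> \<bar>Im z\<bar> + 1 / 2"
  shows "norm z \<le> 5 * norm (sin (pi * z))"
proof -
  define a b where "a = \<bar>Re z\<bar>" and "b = \<bar>Im z\<bar>"
  have ab: "0 \<le> a" "0 \<le> b" "a \<le> b + 1 / 2" using z by (auto simp: a_def b_def)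
  have S: "(norm (sin (pi * z)))\<^sup>2 = (sin (pi * Re z))\<^sup>2 + (sinh (pi * Im z))\<^sup>2"
    by (simp add: norm_sin_squared')
  have "(pi * b)\<^sup>2 \<le> (sinh (pi * Im z))\<^sup>2"
    using abs_sinh_ge[of "pi * Im z"] by (intro abs_le_square_iff[THEN iffD1]) (simp add: b_def abs_mult)
  moreover have "9 * b\<^sup>2 \<le> (pi * b)\<^sup>2"
  proof -
    have "3\<^sup>2 \<le> pi\<^sup>2" using pi_gt3 by (intro power_mono) auto
    then show ?thesis by (simp add: power_mult_distrib mult_right_mono)
  qed
  ultimately have sh: "9 * b\<^sup>2 \<le> (sinh (pi * Im z))\<^sup>2" by linarith
  have n: "(norm z)\<^sup>2 = a\<^sup>2 + b\<^sup>2" by (simp add: cmod_power2 a_def b_def)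
  have "a\<^sup>2 + b\<^sup>2 \<le> 25 * (norm (sin (pi * z)))\<^sup>2"
  proof (cases "b \<ge> 1 / 4")
    case True
    then have "a\<^sup>2 \<le> (3 * b)\<^sup>2" using ab by (intro power_mono) auto
    then have "a\<^sup>2 \<le> 9 * b\<^sup>2" by (simp add: power_mult_distrib)
    then have "a\<^sup>2 + b\<^sup>2 \<le> 10 * b\<^sup>2" by linarith
    also have "10 * b\<^sup>2 \<le> 25 * (9 * b\<^sup>2)" by simp
    also have "\<dots> \<le> 25 * (norm (sin (pi * z)))\<^sup>2"
      unfolding S using sh by (intro mult_left_mono add_increasing) auto
    finally show ?thesis .
  next
    case False
    then have a: "a \<le> 3 / 4" using ab by simp
    have "pi * a \<le> 3.15 * (3 / 4)" using a ab pi_less_4 pi_approx by (intro mult_mono) auto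
    then have "(pi * a)\<^sup>2 \<le> (3.15 * (3 / 4))\<^sup>2" using ab by (intro power_mono) auto
    also have "(3.15 * (3 / 4))\<^sup>2 \<le> (28 / 5 :: real)" by (simp add: power2_eq_square)
    finally have "1 / 15 \<le> 1 - (pi * a)\<^sup>2 / 6" by linarith
    then have "(pi * a) * (1 / 15) \<le> (pi * a) * (1 - (pi * a)\<^sup>2 / 6)"
      using ab by (intro mult_left_mono) auto
    also have "\<dots> = pi * a - (pi * a) ^ 3 / 6" by (simp add: power2_eq_square power3_eq_cube algebra_simps)
    also have "\<dots> \<le> sin (pi * a)" using ab by (intro sin_ge_cubic) auto
    finally have "(pi * a) * (1 / 15) \<le> sin (pi * a)" .
    moreover have "3 * a \<le> pi * a" using ab pi_gt3 by (intro mult_right_mono) auto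
    ultimately have "a / 5 \<le> sin (pi * a)" by simp
    then have "(a / 5)\<^sup>2 \<le> (sin (pi * a))\<^sup>2" using ab by (intro power_mono) auto
    also have "(sin (pi * a))\<^sup>2 = (sin (pi * Re z))\<^sup>2" by (auto simp: a_def abs_real_def)
    finally have "a\<^sup>2 \<le> 25 * (sin (pi * Re z))\<^sup>2" by (simp add: power_divide)
    moreover have "b\<^sup>2 \<le> 25 * (sinh (pi * Im z))\<^sup>2"
      using sh zero_le_power2[of b] by linarith
    ultimately show ?thesis unfolding S distrib_left by (rule add_mono)
  qed
  then have "(norm z)\<^sup>2 \<le> (5 * norm (sin (pi * z)))\<^sup>2" by (simp add: n power_mult_distrib)
  then show ?thesis by (rule power2_le_imp_le) simp
qed

lemma norm_powr_minus_le:
  fixes x s :: complex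
  assumes "x \<noteq> 0"
  shows "norm (x powr (- s)) \<le> norm x powr (- Re s) * exp (pi * \<bar>Im s\<bar>)"
proof -
  have "Im s * Arg x \<le> \<bar>Im s * Arg x\<bar>" by (rule abs_ge_self)
  also have "\<dots> = \<bar>Im s\<bar> * \<bar>Arg x\<bar>" by (rule abs_mult)
  also have "\<dots> \<le> \<bar>Im s\<bar> * pi"
    using Arg_le_pi[of x] mpi_less_Arg[of x] by (intro mult_left_mono) auto
  finally show ?thesis
    unfolding norm_powr_complex by (intro mult_mono) (simp_all add: mult.commute)
qed

definition aux_integrand :: "complex \<Rightarrow> complex \<Rightarrow> complex" where
  "aux_integrand s x = x powr (- s) * exp (pi * \<i> * x\<^sup>2) / (2 * \<i> * sin (of_real pi * x))"

text \<open>A default value, from \<open>0 powr _ = 0\<close>. It lets the next bound include the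
  origin.\<close>

lemma aux_integrand_0 [simp]: "aux_integrand s 0 = 0"
  by (simp add: aux_integrand_def)

lemma holomorphic_aux_integrand:
  assumes "A \<inter> \<real>\<^sub>\<le>\<^sub>0 = {}" "\<And>x::complex. x \<in> A \<Longrightarrow> sin (pi * x) \<noteq> 0"
  shows "aux_integrand s holomorphic_on A"
  unfolding aux_integrand_def using assms by (auto intro!: holomorphic_intros)

lemma sin_pi_nonzero_of_Im: "Im x \<noteq> 0 \<Longrightarrow> sin (pi * x) \<noteq> 0" for x :: complex
  using norm_sin_pi_ge_Im[of x] pi_gt_zero by (auto simp: mult_le_0_iff simp del: pi_gt_zero)

text \<open>For \<open>Re s \<le> -1\<close> a full factor \<open>norm x\<close> can be split off
  \<open>x powr (- s)\<close>; it cancels the pole of \<open>1 / sin (pi x)\<close> at the origin.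
  The remaining power is at most exponential in \<open>|Im x|\<close> and loses against the
  Gaussian, uniformly up to the line through 0.\<close>

lemma norm_aux_integrand_le:
  assumes s: "Re s \<le> -1"
  shows "\<exists>K. \<forall>x. 0 \<le> Re x - Im x \<longrightarrow> Re x - Im x \<le> 1/2 \<longrightarrow> norm (aux_integrand s x) \<le> K * exp (- \<bar>Im x\<bar>)"
proof -
  define m where "m = - Re s - 1"
  have m: "m \<ge> 0" using s by (simp add: m_def)
  define K where "K = 5 / 2 * exp (pi * \<bar>Im s\<bar>) * exp ((2 * m + 2 * pi + 1)\<^sup>2 / (4 * (2 * pi)))"
  have "norm (aux_integrand s x) \<le> K * exp (- \<bar>Im x\<bar>)" if x: "0 \<le> Re x - Im x" "Re x - Im x \<le> 1/2" for x
  proof (cases "x = 0")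
    case True
    then show ?thesis by (simp add: K_def)
  next
    case False
    define b where "b = \<bar>Im x\<bar>"
    have "\<bar>Re x\<bar> \<le> \<bar>Im x\<bar> + 1 / 2" using x by linarith
    then have n5: "norm x \<le> 5 * norm (sin (pi * x))" and n1: "norm x \<le> 1 + 2 * b"
      using norm_le_5_sin_pi[of x] cmod_le[of x] by (auto simp: b_def)
    have sin0: "norm (sin (pi * x)) > 0" using n5 False by (metis less_le_trans mult_zero_right norm_ge_zero not_le zero_less_norm_iff le_less)
    have "norm x powr (- Re s) = norm x * norm x powr m"
      using False powr_add[of "norm x" 1 m] by (simp add: m_def)
    also have "\<dots> \<le> norm x * exp (2 * m * b)"
    proof (rule mult_left_mono)
      have "norm x powr m \<le> exp (2 * b) powr m"
        using order_trans[OF n1 exp_ge_add_one_self] m by (intro powr_mono2) auto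
      then show "norm x powr m \<le> exp (2 * m * b)" by (simp add: exp_powr_real mult_ac)
    qed simp
    finally have p: "norm (x powr (- s)) \<le> norm x * exp (2 * m * b) * exp (pi * \<bar>Im s\<bar>)"
      using norm_powr_minus_le[OF False, of s] by (meson exp_ge_zero mult_right_mono order_trans)
    have "norm (exp (pi * \<i> * x\<^sup>2)) = exp (2 * pi * (- (Re x * Im x)))"
      by (simp add: power2_eq_square)
    also have "\<dots> \<le> exp (2 * pi * (b - (Im x)\<^sup>2))"
    proof -
      have "- ((Re x - Im x) * Im x) \<le> \<bar>(Re x - Im x) * Im x\<bar>" by linarith
      also have "\<dots> \<le> 1 * b" using x unfolding abs_mult b_def by (intro mult_right_mono) auto
      finally have "- (Re x * Im x) \<le> b - (Im x)\<^sup>2" by (simp add: power2_eq_square algebra_simps)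
      then show ?thesis unfolding exp_le_cancel_iff by (intro mult_left_mono) auto
    qed
    finally have e: "norm (exp (pi * \<i> * x\<^sup>2)) \<le> exp (2 * pi * (b - (Im x)\<^sup>2))" .
    have "norm (aux_integrand s x) = norm (x powr (- s)) * norm (exp (pi * \<i> * x\<^sup>2)) / (2 * norm (sin (pi * x)))"
      by (simp add: aux_integrand_def norm_mult norm_divide)
    also have "\<dots> \<le> (norm x * exp (2 * m * b) * exp (pi * \<bar>Im s\<bar>)) * exp (2 * pi * (b - (Im x)\<^sup>2)) / (2 * norm (sin (pi * x)))"
      using p e by (intro divide_right_mono mult_mono) auto
    also have "\<dots> = (norm x / norm (sin (pi * x))) * (exp (2 * m * b) * exp (pi * \<bar>Im s\<bar>) * exp (2 * pi * (b - (Im x)\<^sup>2)) / 2)"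
      by simp
    also have "\<dots> \<le> 5 * (exp (2 * m * b) * exp (pi * \<bar>Im s\<bar>) * exp (2 * pi * (b - (Im x)\<^sup>2)) / 2)"
      using n5 sin0 by (intro mult_right_mono) (auto simp: field_simps)
    also have "\<dots> = 5 / 2 * exp (pi * \<bar>Im s\<bar>) * exp ((2 * m + 2 * pi) * b - 2 * pi * (Im x)\<^sup>2)"
      by (simp add: exp_add[symmetric] exp_diff[symmetric] algebra_simps)
    also have "\<dots> \<le> 5 / 2 * exp (pi * \<bar>Im s\<bar>) * (exp ((2 * m + 2 * pi + 1)\<^sup>2 / (4 * (2 * pi))) * exp (- \<bar>Im x\<bar>))"
      unfolding b_def by (intro mult_left_mono quadratic_exp_bound) auto
    finally show ?thesis by (simp add: K_def mult.assoc)
  qed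
  then show ?thesis by blast
qed

lemma aux_integral_shift:
  assumes s: "Re s \<le> -1" and c: "0 < c" "c < 1/2"
  shows "(\<integral>b. aux_integrand s (1/2 - (1 + \<i>) * of_real b) \<partial>lborel) =
         (\<integral>b. aux_integrand s (of_real c - (1 + \<i>) * of_real b) \<partial>lborel)"
proof -
  obtain K where K: "\<And>x. 0 \<le> Re x - Im x \<Longrightarrow> Re x - Im x \<le> 1/2 \<Longrightarrow> norm (aux_integrand s x) \<le> K * exp (- \<bar>Im x\<bar>)"
    using norm_aux_integrand_le[OF s] by blast
  define G where "G w = aux_integrand s ((1 - \<i>) * w)" for w
  have translate: "(\<integral>b. aux_integrand s (of_real d - (1 + \<i>) * of_real b) \<partial>lborel) = (\<integral>v. G (Complex (d / 2) v) \<partial>lborel)" for d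
  proof -
    have "(\<integral>b. aux_integrand s (of_real d - (1 + \<i>) * of_real b) \<partial>lborel) =
        (\<integral>v. aux_integrand s (of_real d - (1 + \<i>) * of_real (d / 2 + (-1) * v)) \<partial>lborel)"
      by (subst lborel_integral_real_affine[of "-1" _ "d/2"]) auto
    also have "\<dots> = (\<integral>v. G (Complex (d / 2) v) \<partial>lborel)"
      by (rule Bochner_Integration.integral_cong) (auto simp: G_def intro!: arg_cong[of _ _ "aux_integrand s"] complex_eqI)
    finally show ?thesis .
  qed
  have Kn: "K \<ge> 0" using K[of "0"] by simp
  \<comment> \<open>The margin \<open>c / 4\<close> keeps \<open>2 * Re w\<close> strictly between 0
    and 1, away from the branch cut and from both neighbouring zeros of the sine.\<close>
  have "(\<integral>v. G (Complex (1/4) v) \<partial>lborel) = (\<integral>v. G (Complex (c / 2) v) \<partial>lborel)"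
  proof (rule strip_shift[where e = "c / 4" and B = 0 and K = "K * exp (1/4)"])
    have *: "(1 - \<i>) * w \<notin> \<real>\<^sub>\<le>\<^sub>0 \<and> sin (pi * ((1 - \<i>) * w)) \<noteq> 0"
      if w: "c / 2 - c / 4 < Re w" "Re w < 1/4 + c / 4" for w
    proof (cases "Im ((1 - \<i>) * w) = 0")
      case True
      then have re: "Re ((1 - \<i>) * w) = 2 * Re w" by simp
      have "(1 - \<i>) * w = of_real (2 * Re w)" using True by (intro complex_eqI) auto
      then have "sin (pi * ((1 - \<i>) * w)) = of_real (sin (pi * (2 * Re w)))"
        by (simp only: of_real_mult[symmetric] sin_of_real)
      moreover have "sin (pi * (2 * Re w)) > 0"
        using w c by (intro sin_gt_zero) (auto simp: field_simps)
      ultimately show ?thesis using True re w c by (auto simp: complex_nonpos_Reals_iff)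
    next
      case False
      then show ?thesis using sin_pi_nonzero_of_Im by (auto simp: complex_nonpos_Reals_iff)
    qed
    have h: "aux_integrand s holomorphic_on (\<lambda>w. (1 - \<i>) * w) ` {w. c / 2 - c / 4 < Re w \<and> Re w < 1/4 + c / 4}"
      by (rule holomorphic_aux_integrand) (use * in blast)+
    show "G holomorphic_on {w. c / 2 - c / 4 < Re w \<and> Re w < 1/4 + c / 4}"
      using holomorphic_on_compose[OF _ h] by (auto simp: G_def[abs_def] o_def intro!: holomorphic_intros)
    fix w assume w: "c / 2 \<le> Re w" "Re w \<le> 1/4" "0 \<le> \<bar>Im w\<bar>"
    define x where "x = (1 - \<i>) * w"
    have x: "Re x - Im x = 2 * Re w" "Im x = Im w - Re w" by (auto simp: x_def)
    have "norm (G w) \<le> K * exp (- \<bar>Im x\<bar>)"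
      unfolding G_def x_def[symmetric] by (rule K; unfold x(1); use w c in auto)
    also have "\<dots> \<le> K * exp (1/4 - \<bar>Im w\<bar>)" using w c Kn by (intro mult_left_mono) (auto simp: x)
    also have "\<dots> = K * exp (1/4) * exp (- \<bar>Im w\<bar>)"
      by (simp only: mult.assoc exp_add[symmetric] diff_conv_add_uminus)
    finally show "norm (G w) \<le> K * exp (1/4) * exp (- \<bar>Im w\<bar>)" .
  qed (use c in auto)
  then show ?thesis using translate[of "1/2"] translate[of c] by simp
qed

lemma isCont_aux_integrand:
  fixes x :: complex
  assumes "x \<notin> \<real>\<^sub>\<le>\<^sub>0" "sin (pi * x) \<noteq> 0"
  shows "isCont (aux_integrand s) x"
  unfolding aux_integrand_def using assms by (auto intro!: continuous_intros)

text \<open>The integral is the same for every crossing point in the open interval; the bound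
  uniform down to 0 lets the crossing point tend to 0 by dominated convergence.\<close>

lemma aux_integral_through_0:
  assumes s: "Re s \<le> -1"
  shows "integrable lborel (\<lambda>b. aux_integrand s (- ((1 + \<i>) * of_real b)))"
    and "(\<integral>b. aux_integrand s (1/2 - (1 + \<i>) * of_real b) \<partial>lborel) =
         (\<integral>b. aux_integrand s (- ((1 + \<i>) * of_real b)) \<partial>lborel)"
proof -
  obtain K where K: "\<And>x. 0 \<le> Re x - Im x \<Longrightarrow> Re x - Im x \<le> 1/2 \<Longrightarrow> norm (aux_integrand s x) \<le> K * exp (- \<bar>Im x\<bar>)"
    using norm_aux_integrand_le[OF s] by blast
  \<comment> \<open>With 3 all values are below 1/2, including the one at
    \<open>n = 0\<close>.\<close>
  define c where "c n = 1 / (real n + 3)" for n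
  have c: "0 < c n" "c n < 1/2" for n by (auto simp: c_def field_simps)
  have c0: "c \<longlonglongrightarrow> 0" unfolding c_def by real_asymp
  define f where "f b = aux_integrand s (- ((1 + \<i>) * of_real b))" for b
  have contf: "continuous_on (-{0}) f"
  proof -
    have "isCont (aux_integrand s) (- ((1 + \<i>) * of_real b))" if "b \<noteq> 0" for b
      by (rule isCont_aux_integrand) (use that sin_pi_nonzero_of_Im in \<open>auto simp: complex_nonpos_Reals_iff\<close>)
    then have *: "continuous_on ((\<lambda>b. - ((1 + \<i>) * of_real b)) ` (-{0})) (aux_integrand s)"
      by (auto intro!: continuous_at_imp_continuous_on)
    show ?thesis unfolding f_def
      by (rule continuous_on_compose2[OF *]) (auto intro!: continuous_intros)
  qed
  have f_eq: "f = (\<lambda>b. indicator (-{0}) b *\<^sub>R f b)" by (auto simp: fun_eq_iff indicator_def f_def)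
  have meas: "f \<in> borel_measurable lborel"
    by (subst f_eq) (use borel_measurable_continuous_on_indicator[OF _ contf] in auto)
  have bound: "norm (aux_integrand s (of_real d - (1 + \<i>) * of_real b)) \<le> K * exp (- \<bar>b\<bar>)" if "0 \<le> d" "d \<le> 1/2" for d b
    using K[of "of_real d - (1 + \<i>) * of_real b"] that by simp
  have int: "integrable lborel (\<lambda>b. K * exp (- \<bar>b\<bar>))" using integrable_exp_minus_abs by simp
  have "integrable lborel f"
    by (rule Bochner_Integration.integrable_bound[OF int meas])
       (use bound[of 0] in \<open>auto simp: f_def intro!: AE_I2 order_trans[OF _ abs_ge_self]\<close>)
  then show "integrable lborel (\<lambda>b. aux_integrand s (- ((1 + \<i>) * of_real b)))" by (simp add: f_def[abs_def])
  have "(\<lambda>n. \<integral>b. aux_integrand s (of_real (c n) - (1 + \<i>) * of_real b) \<partial>lborel) \<longlonglongrightarrow> (\<integral>b. f b \<partial>lborel)"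
  proof (rule integral_dominated_convergence[OF meas _ int])
    show "(\<lambda>b. aux_integrand s (of_real (c n) - (1 + \<i>) * of_real b)) \<in> borel_measurable lborel" for n
    proof -
      have "isCont (aux_integrand s) (of_real (c n) - (1 + \<i>) * of_real b)" for b
      proof (rule isCont_aux_integrand)
        show "of_real (c n) - (1 + \<i>) * of_real b \<notin> \<real>\<^sub>\<le>\<^sub>0"
          using c[of n] by (auto simp: complex_nonpos_Reals_iff)
        show "sin (of_real pi * (of_real (c n) - (1 + \<i>) * of_real b)) \<noteq> 0"
        proof (cases "b = 0")
          case True
          have "sin (pi * c n) > 0" using c[of n] by (intro sin_gt_zero) auto
          have "complex_of_real pi * (of_real (c n) - (1 + \<i>) * of_real b) = of_real (pi * c n)"
            using True by simp
          then have "sin (complex_of_real pi * (of_real (c n) - (1 + \<i>) * of_real b)) = of_real (sin (pi * c n))"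
            by (simp only: sin_of_real)
          then show ?thesis using \<open>sin (pi * c n) > 0\<close> by simp
        qed (use sin_pi_nonzero_of_Im in auto)
      qed
      then have *: "continuous_on (range (\<lambda>b. of_real (c n) - (1 + \<i>) * of_real b)) (aux_integrand s)"
        by (auto intro!: continuous_at_imp_continuous_on)
      have "continuous_on UNIV (\<lambda>b. aux_integrand s (of_real (c n) - (1 + \<i>) * of_real b))"
        by (rule continuous_on_compose2[OF *]) (auto intro!: continuous_intros)
      then show ?thesis using borel_measurable_continuous_onI by simp
    qed
    show "AE b in lborel. (\<lambda>n. aux_integrand s (of_real (c n) - (1 + \<i>) * of_real b)) \<longlonglongrightarrow> f b"
    \<comment> \<open>At \<open>b = 0\<close> the limit point is the origin, where the integrand is
      singular; a single point is negligible.\<close>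
    proof (rule AE_mp[OF AE_lborel_singleton[of "0::real"]], rule AE_I2, rule impI)
      fix b :: real assume b: "b \<noteq> 0"
      have "isCont (aux_integrand s) (- ((1 + \<i>) * of_real b))"
        by (rule isCont_aux_integrand) (use b sin_pi_nonzero_of_Im in \<open>auto simp: complex_nonpos_Reals_iff\<close>)
      moreover have "(\<lambda>n. of_real (c n) - (1 + \<i>) * of_real b) \<longlonglongrightarrow> of_real 0 - (1 + \<i>) * of_real b"
        by (intro tendsto_intros c0)
      ultimately show "(\<lambda>n. aux_integrand s (of_real (c n) - (1 + \<i>) * of_real b)) \<longlonglongrightarrow> f b"
        unfolding f_def by (intro isCont_tendsto_compose[of _ "aux_integrand s"]) simp_all
    qed
    show "AE b in lborel. norm (aux_integrand s (of_real (c n) - (1 + \<i>) * of_real b)) \<le> K * exp (- \<bar>b\<bar>)" for n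
      using bound[of "c n"] c[of n] by (intro AE_I2) auto
  qed
  then show "(\<integral>b. aux_integrand s (1/2 - (1 + \<i>) * of_real b) \<partial>lborel) =
         (\<integral>b. aux_integrand s (- ((1 + \<i>) * of_real b)) \<partial>lborel)"
    unfolding aux_integral_shift[OF s c, symmetric] f_def by (simp add: LIMSEQ_const_iff)
qed

text \<open>For \<open>z\<close> in the upper half plane \<open>Ln (- z) = Ln z - pi i\<close>,
  whence the exponential factor; the sign is that of the odd sine.\<close>

lemma aux_integrand_minus:
  assumes b: "b > 0"
  shows "aux_integrand s (- ((1 + \<i>) * of_real b)) = - exp (pi * \<i> * s) * aux_integrand s ((1 + \<i>) * of_real b)"
proof -
  define z where "z = (1 + \<i>) * complex_of_real b"
  have z: "z \<noteq> 0" "Im z > 0" using b by (auto simp: z_def complex_eq_iff)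
  then have "Ln (- z) = Ln z - \<i> * pi" by (subst Ln_minus) auto
  then have "(- z) powr (- s) = z powr (- s) * exp (pi * \<i> * s)"
  proof -
    have "- s * Ln (- z) = - s * Ln z + pi * \<i> * s"
      unfolding \<open>Ln (- z) = Ln z - \<i> * pi\<close> by (simp add: algebra_simps)
    then show ?thesis using z by (simp only: powr_def exp_add[symmetric]) (simp add: algebra_simps exp_add[symmetric])
  qed
  then show ?thesis unfolding z_def[symmetric] by (simp add: aux_integrand_def)
qed

text \<open>
  On the line through the origin, \<open>x \<mapsto> - x\<close> exchanges the two halves and multiplies the
  integrand by \<open>- exp (pi i s)\<close>.
\<close>

theorem riemann_aux_ray:
  assumes s: "Re s \<le> -1"
  shows "riemann_aux s = (1 + \<i>) * (exp (pi * \<i> * s) - 1) *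
      (\<integral>b. indicator {0<..} b *\<^sub>R aux_integrand s ((1 + \<i>) * of_real b) \<partial>lborel)"
proof -
  define f where "f b = aux_integrand s (- ((1 + \<i>) * of_real b))" for b :: real
  define g where "g b = indicator {0<..} b *\<^sub>R aux_integrand s ((1 + \<i>) * of_real b)" for b :: real
  have intf: "integrable lborel f" using aux_integral_through_0(1)[OF s] by (simp add: f_def[abs_def])
  have f_split: "f b = - exp (pi * \<i> * s) * g b + g (0 + (-1) * b)" for b
    using aux_integrand_minus[of b s] by (cases b "0::real" rule: linorder_cases) (auto simp: f_def g_def)
  have "integrable lborel (\<lambda>b. indicator {..<0} b *\<^sub>R f b)"
    by (rule integrable_mult_indicator[OF _ intf]) simp
  then have "integrable lborel (\<lambda>b. indicator {..<0} (0 + (-1) * b) *\<^sub>R f (0 + (-1) * b))"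
    by (rule lborel_integrable_real_affine) simp
  moreover have "(\<lambda>b. indicator {..<0} (0 + (-1) * b) *\<^sub>R f (0 + (-1) * b)) = g"
    by (auto simp: f_def g_def indicator_def)
  ultimately have intg: "integrable lborel g" by simp
  have intg': "integrable lborel (\<lambda>b. g (0 + (-1) * b))"
    by (rule lborel_integrable_real_affine[OF intg]) simp
  have "(\<integral>b. f b \<partial>lborel) = - exp (pi * \<i> * s) * (\<integral>b. g b \<partial>lborel) + (\<integral>b. g (0 + (-1) * b) \<partial>lborel)"
    unfolding f_split using intg intg' by (subst Bochner_Integration.integral_add) auto
  also have "(\<integral>b. g (0 + (-1) * b) \<partial>lborel) = (\<integral>b. g b \<partial>lborel)"
    by (subst (2) lborel_integral_real_affine[of "-1" _ 0]) auto
  finally have f_int: "(\<integral>b. f b \<partial>lborel) = (1 - exp (pi * \<i> * s)) * (\<integral>b. g b \<partial>lborel)"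
    by (simp add: algebra_simps)
  have e4: "exp (\<i> * pi / 4) * sqrt 2 = 1 + \<i>"
  proof -
    have "exp (\<i> * pi / 4) = cis (pi / 4)" by (simp add: cis_conv_exp)
    then have "exp (\<i> * pi / 4) * sqrt 2 = cis (pi / 4) * sqrt 2" by (simp only:)
    also have "\<dots> = 1 + \<i>" by (simp add: complex_eq_iff cos_45 sin_45)
    finally show ?thesis .
  qed
  have "riemann_aux s = (\<integral>u. aux_integrand s (aux_line u) * (- exp (\<i> * pi / 4)) \<partial>lborel)"
    unfolding riemann_aux_def Let_def aux_integrand_def exp_pi_i_minus_exp ..
  \<comment> \<open>\<open>aux_line\<close> is parametrised by arc length; rescaling by
    \<open>sqrt 2\<close> replaces the unit direction by \<open>1 + i\<close>.\<close>
  also have "\<dots> = \<bar>sqrt 2\<bar> *\<^sub>R (\<integral>b. aux_integrand s (aux_line (0 + sqrt 2 * b)) * (- exp (\<i> * pi / 4)) \<partial>lborel)"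
    by (rule lborel_integral_real_affine) simp
  also have "\<dots> = - (exp (\<i> * pi / 4) * sqrt 2) * (\<integral>b. aux_integrand s (aux_line (0 + sqrt 2 * b)) \<partial>lborel)"
    by (simp add: scaleR_conv_of_real)
  also have "(\<lambda>b. aux_integrand s (aux_line (0 + sqrt 2 * b))) = (\<lambda>b. aux_integrand s (1/2 - (1 + \<i>) * of_real b))"
    unfolding aux_line_def e4[symmetric] by (simp add: mult_ac)
  also have "(\<integral>b. aux_integrand s (1/2 - (1 + \<i>) * of_real b) \<partial>lborel) = (\<integral>b. f b \<partial>lborel)"
    unfolding f_def by (rule aux_integral_through_0(2)[OF s])
  finally have "riemann_aux s = - (1 + \<i>) * ((1 - exp (pi * \<i> * s)) * (\<integral>b. g b \<partial>lborel))"
    unfolding e4 f_int .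
  also have "\<dots> = (1 + \<i>) * (exp (pi * \<i> * s) - 1) * (\<integral>b. g b \<partial>lborel)"
    by (simp add: algebra_simps)
  finally show "riemann_aux s = (1 + \<i>) * (exp (pi * \<i> * s) - 1) *
      (\<integral>b. indicator {0<..} b *\<^sub>R aux_integrand s ((1 + \<i>) * of_real b) \<partial>lborel)"
    by (simp add: g_def[abs_def])
qed

section \<open>Continuation of the auxiliary function to the left half plane\<close>

text \<open>The hypothesis puts the argument of \<open>y\<close> between \<open>- pi / 4\<close> and
  \<open>3 pi / 4\<close>. Multiplication by \<open>1 - i\<close> turns this half plane into the
  right one without meeting the branch cut.\<close>

lemma Ln_rotate:
  fixes y :: complex
  assumes "Re y + Im y > 0"
  shows "Ln ((1 - \<i>) * y) = Ln (1 - \<i>) + Ln y"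
proof -
  define u where "u = (1 - \<i>) * y"
  have i1: "1 - \<i> \<noteq> (0::complex)" by (simp add: complex_eq_iff)
  have "Re u > 0" using assms by (simp add: u_def)
  then have u: "\<bar>Im (Ln u)\<bar> < pi / 2" "u \<noteq> 0" using Re_Ln_pos_lt_imp[of u] by auto
  have v: "\<bar>Im (Ln (inverse (1 - \<i>)))\<bar> < pi / 2"
    by (rule Re_Ln_pos_lt_imp) (simp add: Re_divide)
  have e: "inverse (1 - \<i>) * u = y" using i1 by (simp add: u_def)
  have "Ln (inverse (1 - \<i>) * u) = Ln (inverse (1 - \<i>)) + Ln u"
    using u v i1 pi_gt_zero by (intro Ln_times_simple) (auto simp: abs_less_iff simp del: pi_gt_zero)
  moreover have "Ln (inverse (1 - \<i>)) = - Ln (1 - \<i>)"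
    by (rule Ln_inverse) (simp add: complex_nonpos_Reals_iff)
  ultimately have "Ln y = - Ln (1 - \<i>) + Ln u" unfolding e by simp
  then show ?thesis unfolding u_def[symmetric] by simp
qed

lemma Ln_one_plus_i_minus: "Ln (1 + \<i>) - Ln (1 - \<i>) = \<i> * of_real (pi / 2)"
proof -
  have e: "exp (of_real (ln (sqrt 2)) + \<i> * of_real x) = of_real (sqrt 2) * cis x" for x
    by (simp add: exp_add cis_conv_exp exp_of_real)
  have L1: "Ln (1 + \<i>) = of_real (ln (sqrt 2)) + \<i> * of_real (pi / 4)"
  proof (rule Ln_unique)
    show "exp (of_real (ln (sqrt 2)) + \<i> * of_real (pi / 4)) = 1 + \<i>"
      unfolding e by (simp add: complex_eq_iff cos_45 sin_45)
  qed auto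
  have L2: "Ln (1 - \<i>) = of_real (ln (sqrt 2)) + \<i> * of_real (- (pi / 4))"
  proof (rule Ln_unique)
    show "exp (of_real (ln (sqrt 2)) + \<i> * of_real (- (pi / 4))) = 1 - \<i>"
      unfolding e by (simp add: complex_eq_iff cos_45 sin_45)
  qed (use pi_gt_zero in \<open>simp_all del: pi_gt_zero\<close>)
  show ?thesis unfolding L1 L2 by simp
qed

lemma powr_rotate:
  fixes y :: complex
  assumes "Re y + Im y > 0"
  shows "(2 * pi * (1 - \<i>) * y) powr w = of_real (2 * pi) powr w * (1 - \<i>) powr w * y powr w"
proof -
  have y: "y \<noteq> 0" and i1: "1 - \<i> \<noteq> (0::complex)" using assms by (auto simp: complex_eq_iff)
  have "(2 * pi * (1 - \<i>) * y) powr w = (of_real (2 * pi) * ((1 - \<i>) * y)) powr w" by (simp add: mult.assoc)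
  also have "\<dots> = of_real (2 * pi) powr w * ((1 - \<i>) * y) powr w"
    by (rule powr_times_real_left) auto
  also have "((1 - \<i>) * y) powr w = (1 - \<i>) powr w * y powr w"
    unfolding powr_def Ln_rotate[OF assms] using y i1 by (simp add: exp_add[symmetric] distrib_left)
  finally show ?thesis by (simp add: mult.assoc)
qed

lemma not_nonpos_Int_of_Im: "Im z \<noteq> 0 \<Longrightarrow> z \<notin> \<int>\<^sub>\<le>\<^sub>0" for z :: complex
  by (auto elim!: nonpos_Ints_cases)

text \<open>Reflection at \<open>s / 2\<close> produces the sine, duplication at
  \<open>(1 - s) / 2\<close> merges the two Gamma factors. The factor \<open>Gamma (1 - s)\<close>
  is the one that the Mellin transforms below produce.\<close>

lemma chi_eq:
  fixes s :: complex
  assumes "Im s \<noteq> 0"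
  shows "chi s = 2 * of_real (2 * pi) powr (s - 1) * sin (pi * s / 2) * Gamma (1 - s)"
proof -
  have G: "Gamma (s / 2) * Gamma (1 - s / 2) = pi / sin (pi * (s / 2))"
    using Gamma_reflection_complex[of "s / 2"] by simp
  have g0: "Gamma (s / 2) \<noteq> 0" "Gamma (1 - s / 2) \<noteq> 0"
    using assms by (auto simp: Gamma_eq_zero_iff not_nonpos_Int_of_Im)
  have G': "Gamma (s / 2) = pi / (sin (pi * (s / 2)) * Gamma (1 - s / 2))"
    unfolding divide_divide_eq_left[symmetric] G[symmetric] using g0 by simp
  have e: "(1 - s) / 2 + 1 / 2 = 1 - s / 2" "2 * ((1 - s) / 2) = 1 - s" by (simp_all add: field_simps)
  have D: "Gamma ((1 - s) / 2) * Gamma (1 - s / 2) = exp (s * of_real (ln 2)) * of_real (sqrt pi) * Gamma (1 - s)"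
    using Gamma_legendre_duplication[of "(1 - s) / 2"] assms unfolding e by (simp add: not_nonpos_Int_of_Im)
  have p: "complex_of_real pi powr (s - 1/2) = exp (of_real (ln pi) * s) / of_real (sqrt pi)"
  proof -
    have "complex_of_real pi powr (s - 1/2) = complex_of_real pi powr s / complex_of_real pi powr (1/2)"
      by (rule powr_diff)
    also have "complex_of_real pi powr (1/2) = of_real (pi powr (1/2))"
      using powr_of_real[of pi "1/2"] by simp
    also have "pi powr (1/2) = sqrt pi" by (simp add: powr_half_sqrt)
    finally show ?thesis by (simp add: powr_def Ln_of_real mult.commute)
  qed
  have q: "of_real (2 * pi) powr (s - 1) = exp (s * of_real (ln 2)) * exp (of_real (ln pi) * s) / (2 * pi)"
  proof -
    have "of_real (2 * pi) powr (s - 1) = of_real (2 * pi) powr s / complex_of_real (2 * pi)"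
      by (subst powr_diff) simp
    also have "of_real (2 * pi) powr s = exp (s * of_real (ln 2)) * exp (of_real (ln pi) * s)"
    proof -
      have "Ln (complex_of_real (2 * pi)) = of_real (ln (2 * pi))" by (rule Ln_of_real) simp
      also have "\<dots> = of_real (ln 2) + of_real (ln pi)" by (simp only: ln_mult) simp
      finally have "of_real (2 * pi) powr s = exp (s * (of_real (ln 2) + of_real (ln pi)))"
        unfolding powr_def by simp
      then show ?thesis by (simp only: distrib_left exp_add mult.commute[of s "of_real (ln pi)"])
    qed
    finally show ?thesis .
  qed
  have sq: "complex_of_real (sqrt pi) \<noteq> 0" by simp
  have "chi s = exp (of_real (ln pi) * s) / of_real (sqrt pi) * (Gamma ((1 - s) / 2) * Gamma (1 - s / 2)) * sin (pi * (s / 2)) / pi"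
    unfolding chi_def p G' using g0 by simp
  also have "\<dots> = exp (of_real (ln pi) * s) * exp (s * of_real (ln 2)) * Gamma (1 - s) * sin (pi * (s / 2)) / pi"
    unfolding D using sq by simp
  finally show ?thesis unfolding q by simp
qed

lemma gauss_split: "gauss a u y = gauss a 0 y * exp (2 * pi * \<i> * u * y)"
  by (simp add: gauss_def exp_add[symmetric])

definition mellin_integrand :: "complex \<Rightarrow> complex \<Rightarrow> complex" where
  "mellin_integrand s y = y powr (s - 1) * gauss 1 0 y / (2 * \<i> * sin (of_real pi * y))"

text \<open>The factor of \<open>gauss 1 u y\<close> containing \<open>u\<close> is
  \<open>exp (2 pi i u y)\<close>. For \<open>u = (1 + i) b\<close> it is an exponential in
  \<open>b\<close>, so after Fubini the inner integral is Euler's.\<close>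

lemma mellin_mordell:
  assumes s: "Re s < 1"
  shows "integrable lborel (\<lambda>b. indicator {0<..} b *\<^sub>R (of_real b powr (- s) * mordell N 1 ((1 + \<i>) * of_real b)))" (is ?th1)
    and "(\<integral>b. indicator {0<..} b *\<^sub>R (of_real b powr (- s) * mordell N 1 ((1 + \<i>) * of_real b)) \<partial>lborel) =
      Gamma (1 - s) * of_real (2 * pi) powr (s - 1) * (1 - \<i>) powr (s - 1) *
      line_integral (real N + 1/2) (mellin_integrand s)" (is ?th2)
proof -
  define c where "c = real N + 1/2"
  define k where "k \<beta> = gauss 1 0 (line c \<beta>) / (2 * \<i> * sin (pi * line c \<beta>))" for \<beta>
  define a where "a \<beta> = 2 * pi * (1 - \<i>) * line c \<beta>" for \<beta>
  define f where "f b \<beta> = gamma_kernel (1 - s) (a \<beta>) b * k \<beta>" for b \<beta>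
  have z: "Re (1 - s) > 0" using s by simp
  \<comment> \<open>This real part is constant along the line, so the modulus of the double
    integrand is exactly a product and absolute integrability is immediate.\<close>
  have Re_a: "Re (a \<beta>) = 2 * pi * c" for \<beta> by (simp add: a_def algebra_simps)
  then have Re_a_pos: "Re (a \<beta>) > 0" for \<beta> by (simp add: c_def)
  have intk: "integrable lborel k"
    using integrable_mordell[of 1 0 N] by (simp add: k_def[abs_def] c_def)
  have meask: "k \<in> borel_measurable borel" using intk by (auto dest: borel_measurable_integrable)
  have f_eq: "f b \<beta> = gamma_kernel (1 - s) 0 b * exp (- (a \<beta> * of_real b)) * k \<beta>" for b \<beta>
    by (simp add: f_def gamma_kernel_def)
  have meas_a: "a \<in> borel_measurable borel"
    unfolding a_def by (intro borel_measurable_continuous_onI continuous_intros)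
  have meas: "case_prod f \<in> borel_measurable (lborel \<Otimes>\<^sub>M lborel)"
    unfolding f_eq case_prod_beta using meask meas_a by measurable
  have nf: "norm (f b \<beta>) = norm (gamma_kernel (1 - s) (of_real (2 * pi * c)) b) * norm (k \<beta>)" for b \<beta>
    by (simp add: f_def norm_mult norm_gamma_kernel Re_a)
  have intg: "integrable lborel (gamma_kernel (1 - s) (of_real (2 * pi * c)))"
    by (rule integrable_gamma_kernel[OF z]) (simp add: c_def)
  have intf: "integrable (lborel \<Otimes>\<^sub>M lborel) (case_prod f)"
  proof (rule lborel_pair.Fubini_integrable[OF meas])
    show "integrable lborel (\<lambda>b. \<integral>\<beta>. norm (case_prod f (b, \<beta>)) \<partial>lborel)"
      using intg by (simp add: nf)
    show "AE b in lborel. integrable lborel (\<lambda>\<beta>. case_prod f (b, \<beta>))"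
    proof (rule AE_I2)
      fix b
      have m: "(\<lambda>\<beta>. case_prod f (b, \<beta>)) \<in> borel_measurable lborel"
        unfolding f_eq case_prod_conv using meask meas_a by measurable
      show "integrable lborel (\<lambda>\<beta>. case_prod f (b, \<beta>))"
        by (rule Bochner_Integration.integrable_bound[OF _ m,
              of "\<lambda>\<beta>. norm (gamma_kernel (1 - s) (of_real (2 * pi * c)) b) * norm (k \<beta>)"])
           (use intk in \<open>auto simp: nf\<close>)
    qed
  qed
  have inner1: "(\<i> - 1) * (\<integral>\<beta>. f b \<beta> \<partial>lborel) =
      indicator {0<..} b *\<^sub>R (of_real b powr (- s) * mordell N 1 ((1 + \<i>) * of_real b))" for b
  proof -
    have f1: "f b \<beta> = (indicator {0<..} b *\<^sub>R (of_real b powr (- s))) *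
        (gauss 1 ((1 + \<i>) * of_real b) (line c \<beta>) / (2 * \<i> * sin (pi * line c \<beta>)))" for \<beta>
    proof -
      have "exp (- (a \<beta> * of_real b)) = exp (2 * pi * \<i> * ((1 + \<i>) * of_real b) * line c \<beta>)"
        unfolding a_def by (intro arg_cong[of _ _ exp]) (simp add: algebra_simps)
      then show ?thesis unfolding f_def gamma_kernel_def k_def gauss_split[of 1 "(1 + \<i>) * of_real b"]
        by simp
    qed
    show ?thesis
      unfolding f1 integral_mult_right_zero mordell_def line_integral_def c_def
      by (simp add: mult_scaleR_left mult_scaleR_right mult_ac)
  qed
  have inner2: "(\<integral>b. f b \<beta> \<partial>lborel) =
      Gamma (1 - s) * of_real (2 * pi) powr (s - 1) * (1 - \<i>) powr (s - 1) * mellin_integrand s (line c \<beta>)" for \<beta>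
  proof -
    have "(\<integral>b. f b \<beta> \<partial>lborel) = Gamma (1 - s) * a \<beta> powr (s - 1) * k \<beta>"
      unfolding f_def using gamma_kernel_integral[OF z Re_a_pos[of \<beta>]] by simp
    also have "a \<beta> powr (s - 1) = of_real (2 * pi) powr (s - 1) * (1 - \<i>) powr (s - 1) * line c \<beta> powr (s - 1)"
      unfolding a_def by (rule powr_rotate) (simp add: c_def)
    finally show ?thesis by (simp add: k_def mellin_integrand_def)
  qed
  have "integrable lborel (\<lambda>b. \<integral>\<beta>. f b \<beta> \<partial>lborel)"
    using lborel_pair.integrable_fst'[OF intf] by simp
  then have "integrable lborel (\<lambda>b. (\<i> - 1) * (\<integral>\<beta>. f b \<beta> \<partial>lborel))" by simp
  then show ?th1 unfolding inner1 .
  have "(\<integral>b. indicator {0<..} b *\<^sub>R (of_real b powr (- s) * mordell N 1 ((1 + \<i>) * of_real b)) \<partial>lborel)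
      = (\<i> - 1) * (\<integral>b. (\<integral>\<beta>. f b \<beta> \<partial>lborel) \<partial>lborel)"
    unfolding inner1[symmetric] by simp
  also have "(\<integral>b. (\<integral>\<beta>. f b \<beta> \<partial>lborel) \<partial>lborel) = (\<integral>\<beta>. (\<integral>b. f b \<beta> \<partial>lborel) \<partial>lborel)"
    by (rule lborel_pair.Fubini_integral[OF intf, symmetric])
  finally show ?th2
    unfolding inner2 by (simp add: line_integral_def c_def mult_ac)
qed

text \<open>Termwise integration, each power of the exponential giving one Euler integral. The
  interchange is justified because the integrals of the moduli are proportional to
  \<open>n powr (Re s - 1)\<close>, with exponent at most -2.\<close>

lemma mellin_geometric:
  assumes s: "Re s \<le> -1"
  shows "summable (\<lambda>n. of_nat (n + N + 1) powr (s - 1))" (is ?th0)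
    and "integrable lborel (\<lambda>b. indicator {0<..} b *\<^sub>R (of_real b powr (- s) *
        (\<Sum>n. exp (2 * pi * \<i> * ((1 + \<i>) * of_real b)) ^ (n + N + 1))))" (is ?th1)
    and "(\<integral>b. indicator {0<..} b *\<^sub>R (of_real b powr (- s) *
        (\<Sum>n. exp (2 * pi * \<i> * ((1 + \<i>) * of_real b)) ^ (n + N + 1))) \<partial>lborel) =
      Gamma (1 - s) * of_real (2 * pi) powr (s - 1) * (1 - \<i>) powr (s - 1) *
        (\<Sum>n. of_nat (n + N + 1) powr (s - 1))" (is ?th2)
proof -
  define a where "a n = 2 * pi * (1 - \<i>) * of_nat (n + N + 1)" for n :: nat
  define f where "f n b = gamma_kernel (1 - s) (a n) b" for n b
  have z: "Re (1 - s) > 0" "Re (complex_of_real (Re (1 - s))) > 0" using s by auto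
  have Re_a: "Re (a n) = 2 * pi * real (n + N + 1)" for n by (simp add: a_def)
  then have Re_a_pos: "Re (a n) > 0" for n by simp
  have "summable (\<lambda>n. real n powr (Re s - 1))" using s by (simp add: summable_real_powr_iff)
  then have sum_re: "summable (\<lambda>n. real (n + N + 1) powr (Re s - 1))"
    using summable_iff_shift[of "\<lambda>n. real n powr (Re s - 1)" "N + 1"] by (simp add: add.assoc)
  show ?th0
    by (rule summable_norm_cancel) (use sum_re in \<open>simp add: norm_powr_real_powr flip: of_nat_Suc of_nat_add\<close>)
  have intf: "integrable lborel (f n)" for n
    unfolding f_def by (rule integrable_gamma_kernel[OF z(1) Re_a_pos])
  \<comment> \<open>The modulus of a Gamma kernel is again one, with real parameters, so its
    integral is known exactly.\<close>
  have norm_int: "(\<integral>b. norm (f n b) \<partial>lborel) = norm (Gamma (complex_of_real (Re (1 - s))) * of_real (2 * pi) powr (Re s - 1)) * real (n + N + 1) powr (Re s - 1)" for n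
  proof -
    have "complex_of_real (\<integral>b. norm (f n b) \<partial>lborel) = (\<integral>b. of_real (norm (f n b)) \<partial>lborel)" by simp
    also have "(\<lambda>b. complex_of_real (norm (f n b))) = gamma_kernel (of_real (Re (1 - s))) (of_real (Re (a n)))"
    proof
      fix b
      show "complex_of_real (norm (f n b)) = gamma_kernel (of_real (Re (1 - s))) (of_real (Re (a n))) b"
        unfolding f_def norm_gamma_kernel
        by (cases "b > 0") (auto simp: gamma_kernel_def powr_of_real[symmetric] exp_of_real[symmetric])
    qed
    also have "(\<integral>b. gamma_kernel (of_real (Re (1 - s))) (of_real (Re (a n))) b \<partial>lborel) =
        Gamma (of_real (Re (1 - s))) * of_real (Re (a n)) powr (- of_real (Re (1 - s)))"
      by (rule gamma_kernel_integral) (use z Re_a_pos in auto)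
    finally have e: "complex_of_real (\<integral>b. norm (f n b) \<partial>lborel) = \<dots>" .
    have "(\<integral>b. norm (f n b) \<partial>lborel) = norm (complex_of_real (\<integral>b. norm (f n b) \<partial>lborel))"
      by (simp add: integral_nonneg_AE)
    also have "\<dots> = norm (Gamma (complex_of_real (Re (1 - s)))) * (2 * pi * real (n + N + 1)) powr (Re s - 1)"
      unfolding e by (simp add: norm_mult norm_powr_real_powr Re_a)
    also have "\<dots> = norm (Gamma (complex_of_real (Re (1 - s))) * of_real (2 * pi) powr (Re s - 1)) * real (n + N + 1) powr (Re s - 1)"
      by (simp add: norm_mult norm_powr_real_powr powr_mult)
    finally show ?thesis .
  qed
  have f_eq: "indicator {0<..} b *\<^sub>R (of_real b powr (- s) * exp (2 * pi * \<i> * ((1 + \<i>) * of_real b)) ^ (n + N + 1)) = f n b" for n b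
  proof -
    have "exp (2 * pi * \<i> * ((1 + \<i>) * of_real b)) ^ (n + N + 1) = exp (- (a n * of_real b))"
      unfolding exp_of_nat_mult[symmetric] a_def by (intro arg_cong[of _ _ exp]) (simp add: algebra_simps)
    then show ?thesis by (simp add: f_def gamma_kernel_def)
  qed
  have geo: "summable (\<lambda>n. norm (f n b))" for b
  proof (cases "b > 0")
    case True
    have "norm (exp (2 * pi * \<i> * ((1 + \<i>) * of_real b))) < 1" using True by simp
    then have "summable (\<lambda>n. norm (of_real b powr (- s)) * norm (exp (2 * pi * \<i> * ((1 + \<i>) * of_real b))) ^ (n + N + 1))"
      unfolding power_add by (intro summable_mult summable_mult2 summable_geometric) simp
    then show ?thesis using True unfolding f_eq[symmetric] by (simp add: norm_mult norm_power)
  qed (simp add: f_def gamma_kernel_def)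
  have suminf_eq: "(\<Sum>n. f n b) = indicator {0<..} b *\<^sub>R (of_real b powr (- s) *
        (\<Sum>n. exp (2 * pi * \<i> * ((1 + \<i>) * of_real b)) ^ (n + N + 1)))" for b
  proof (cases "b > 0")
    case True
    have "norm (exp (2 * pi * \<i> * ((1 + \<i>) * of_real b))) < 1" using True by simp
    then have "summable (\<lambda>n. exp (2 * pi * \<i> * ((1 + \<i>) * of_real b)) ^ (n + N + 1))"
      unfolding power_add by (intro summable_mult2 summable_geometric)
    then show ?thesis using True unfolding f_eq[symmetric] by (simp add: suminf_mult)
  qed (simp add: f_def gamma_kernel_def)
  have sn: "summable (\<lambda>n. \<integral>b. norm (f n b) \<partial>lborel)"
    unfolding norm_int by (intro summable_mult sum_re)
  note si = intf AE_I2[OF geo] sn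
  have "integrable lborel (\<lambda>b. \<Sum>n. f n b)"
    by (rule integrable_suminf) (use si in auto)
  then show ?th1 unfolding suminf_eq .
  have "(\<integral>b. (\<Sum>n. f n b) \<partial>lborel) = (\<Sum>n. \<integral>b. f n b \<partial>lborel)"
    by (rule integral_suminf) (use si in auto)
  also have "(\<lambda>n. \<integral>b. f n b \<partial>lborel) = (\<lambda>n. Gamma (1 - s) * of_real (2 * pi) powr (s - 1) * (1 - \<i>) powr (s - 1) * of_nat (n + N + 1) powr (s - 1))"
  proof
    fix n
    have "(\<integral>b. f n b \<partial>lborel) = Gamma (1 - s) * a n powr (s - 1)"
      unfolding f_def using gamma_kernel_integral[OF z(1) Re_a_pos[of n]] by simp
    also have "a n powr (s - 1) = of_real (2 * pi) powr (s - 1) * (1 - \<i>) powr (s - 1) * of_nat (n + N + 1) powr (s - 1)"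
      unfolding a_def by (rule powr_rotate) (simp flip: of_nat_Suc of_nat_add)
    finally show "(\<integral>b. f n b \<partial>lborel) = Gamma (1 - s) * of_real (2 * pi) powr (s - 1) * (1 - \<i>) powr (s - 1) * of_nat (n + N + 1) powr (s - 1)"
      by simp
  qed
  also have "(\<Sum>n. Gamma (1 - s) * of_real (2 * pi) powr (s - 1) * (1 - \<i>) powr (s - 1) * of_nat (n + N + 1) powr (s - 1)) =
     Gamma (1 - s) * of_real (2 * pi) powr (s - 1) * (1 - \<i>) powr (s - 1) * (\<Sum>n. of_nat (n + N + 1) powr (s - 1))"
    by (rule suminf_mult[OF \<open>?th0\<close>])
  finally show ?th2 unfolding suminf_eq .
qed

theorem riemann_aux_eq:
  assumes s: "Re s \<le> -1" and t: "Im s \<noteq> 0"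
  shows "riemann_aux s = chi s * ((\<Sum>n. of_nat (n + N + 1) powr (s - 1)) +
    line_integral (real N + 1/2) (mellin_integrand s))"
proof -
  define Z where "Z = (\<Sum>n. complex_of_nat (n + N + 1) powr (s - 1))"
  define J where "J = line_integral (real N + 1/2) (mellin_integrand s)"
  define C where "C = Gamma (1 - s) * of_real (2 * pi) powr (s - 1) * (1 - \<i>) powr (s - 1)"
  have i1: "1 + \<i> \<noteq> (0::complex)" by (simp add: complex_eq_iff)
  have integrand: "indicator {0<..} b *\<^sub>R aux_integrand s ((1 + \<i>) * of_real b) =
      - ((1 + \<i>) powr (- s)) *
      (indicator {0<..} b *\<^sub>R (of_real b powr (- s) * mordell N 1 ((1 + \<i>) * of_real b)) +
       indicator {0<..} b *\<^sub>R (of_real b powr (- s) *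
        (\<Sum>n. exp (2 * pi * \<i> * ((1 + \<i>) * of_real b)) ^ (n + N + 1))))" for b
  proof (cases "b > 0")
    case True
    define u where "u = (1 + \<i>) * complex_of_real b"
    define q where "q = exp (2 * pi * \<i> * u)"
    have q: "norm q < 1" using True by (simp add: q_def u_def)
    then have q1: "q \<noteq> 1" by auto
    have "(\<Sum>n. q ^ (n + N + 1)) = (\<Sum>n. q ^ Suc N * q ^ n)" by (simp add: power_add mult_ac)
    also have "\<dots> = q ^ Suc N / (1 - q)"
      using q by (simp add: suminf_mult summable_geometric suminf_geometric)
    finally have g: "(\<Sum>n. q ^ (n + N + 1)) = q ^ Suc N / (1 - q)" .
    have "aux_integrand s u = u powr (- s) * (exp (pi * \<i> * u\<^sup>2) / (2 * \<i> * sin (pi * u)))"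
      by (simp add: aux_integrand_def)
    also have "\<dots> = u powr (- s) * (- mordell N 1 u - (\<Sum>n. q ^ (n + N + 1)))"
      using mordell_gauss_1[of u N] q1 unfolding g by (simp add: q_def)
    also have "u powr (- s) = (1 + \<i>) powr (- s) * of_real b powr (- s)"
      unfolding u_def using True powr_times_real_left[of "of_real b" "1 + \<i>" "- s"] by (simp add: mult.commute)
    finally show ?thesis using True unfolding q_def u_def by (simp add: algebra_simps)
  qed simp
  have "(\<integral>b. indicator {0<..} b *\<^sub>R aux_integrand s ((1 + \<i>) * of_real b) \<partial>lborel) =
      - ((1 + \<i>) powr (- s)) * (C * J + C * Z)"
    unfolding integrand C_def J_def Z_def
    using s mellin_mordell[of s N] mellin_geometric[OF s, of N]
    by (subst integral_mult_right_zero, subst Bochner_Integration.integral_add) auto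
  then have R: "riemann_aux s = (1 + \<i>) * (exp (pi * \<i> * s) - 1) * (- ((1 + \<i>) powr (- s)) * (C * J + C * Z))"
    unfolding riemann_aux_ray[OF s] by simp
  \<comment> \<open>The ray contributes \<open>1 + i\<close>, the decay rate in the Mellin transform
    \<open>1 - i\<close>; their logarithms differ by \<open>i pi / 2\<close>. Together with the
    factor from the two halves of the line this becomes the sine in \<open>chi_eq\<close>.\<close>
  have P: "(1 + \<i>) * (1 + \<i>) powr (- s) * (1 - \<i>) powr (s - 1) = \<i> * exp (- (pi * \<i> * s / 2))"
  proof -
    have i2: "1 - \<i> \<noteq> (0::complex)" by (simp add: complex_eq_iff)
    have "(1 + \<i>) * (1 + \<i>) powr (- s) * (1 - \<i>) powr (s - 1) = exp ((1 - s) * (Ln (1 + \<i>) - Ln (1 - \<i>)))"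
    proof -
      have "(1 + \<i>) * (1 + \<i>) powr (- s) = exp (Ln (1 + \<i>)) * (1 + \<i>) powr (- s)" using i1 by simp
      then show ?thesis using i1 i2 by (simp only: powr_def exp_add[symmetric] if_False) (simp add: algebra_simps)
    qed
    also have "(1 - s) * (Ln (1 + \<i>) - Ln (1 - \<i>)) = \<i> * of_real (pi / 2) + - (pi * \<i> * s / 2)"
      unfolding Ln_one_plus_i_minus by (simp add: algebra_simps diff_divide_distrib add_divide_distrib)
    finally show ?thesis unfolding exp_add cis_conv_exp[symmetric] by simp
  qed
  have T: "- (exp (pi * \<i> * s) - 1) * (\<i> * exp (- (pi * \<i> * s / 2))) = 2 * sin (pi * s / 2)"
  proof -
    define h where "h = exp (\<i> * (pi * s / 2))"
    have h0: "h \<noteq> 0" by (simp add: h_def)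
    have A: "exp (pi * \<i> * s) = h * h" unfolding h_def exp_add[symmetric] by (intro arg_cong[of _ _ exp]) simp
    have B: "exp (- (pi * \<i> * s / 2)) = inverse h" unfolding h_def exp_minus[symmetric] by (intro arg_cong[of _ _ exp]) simp
    have C: "sin (pi * s / 2) = (h - inverse h) / (2 * \<i>)"
      unfolding h_def sin_exp_eq exp_minus[symmetric] ..
    have "- (h * h - 1) * (\<i> * inverse h) = - \<i> * (h - inverse h)"
      using h0 by (simp add: algebra_simps)
    also have "\<dots> = 2 * ((h - inverse h) / (2 * \<i>))" by simp
    finally show ?thesis unfolding A B C .
  qed
  have "riemann_aux s = (- (exp (pi * \<i> * s) - 1) * ((1 + \<i>) * (1 + \<i>) powr (- s) * (1 - \<i>) powr (s - 1))) *
      (Gamma (1 - s) * of_real (2 * pi) powr (s - 1) * (Z + J))"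
    unfolding R C_def by (simp add: algebra_simps)
  also have "\<dots> = chi s * (Z + J)"
    unfolding P T chi_eq[OF t] by simp
  finally show ?thesis by (simp only: Z_def J_def)
qed

section \<open>The model integral\<close>

text \<open>Because \<open>n * n\<close> has the parity of \<open>n\<close>, the values at integers
  form a geometric progression.\<close>

lemma gauss_of_nat: "gauss (real k) \<beta> (of_nat n) = (-1) ^ (k * n) * exp (2 * pi * \<i> * \<beta>) ^ n"
proof -
  have "gauss (real k) \<beta> (of_nat n) = exp (of_nat (k * (n * n)) * (- (pi * \<i>)) + of_nat n * (2 * pi * \<i> * \<beta>))"
    unfolding gauss_def by (intro arg_cong[of _ _ exp]) (simp add: algebra_simps power2_eq_square)
  also have "\<dots> = (-1) ^ (k * (n * n)) * exp (2 * pi * \<i> * \<beta>) ^ n"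
    unfolding exp_add exp_of_nat_mult by (simp add: exp_minus)
  also have "(-1) ^ (k * (n * n)) = ((-1) ^ (k * n) :: complex)"
    by (simp only: minus_one_power_iff even_mult_iff) simp
  finally show ?thesis .
qed

text \<open>For \<open>a = 2\<close> the cross term under \<open>y + 1\<close> is
  \<open>exp (- 4 pi i y)\<close>, which is 1 at the integers. Subtracting 1 from it therefore
  cancels the denominator: up to a factor, the same integral returns, with two pure Gaussians
  added.\<close>

lemma mordell_Suc_gauss_2:
  "mordell (Suc N) 2 \<beta> = - exp (2 * pi * \<i> * \<beta>) *
    (mordell N 2 \<beta> - line_integral (real N + 1/2) (\<lambda>y. gauss 2 (\<beta> - 1/2) y + gauss 2 (\<beta> - 3/2) y))"
proof -
  have e: "real (Suc N) + 1/2 = (real N + 1/2) + 1" by simp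
  have *: "gauss 2 \<beta> (y + 1) / (2 * \<i> * sin (pi * (y + 1))) =
      - exp (2 * pi * \<i> * \<beta>) * (gauss 2 \<beta> y / (2 * \<i> * sin (pi * y)) - (gauss 2 (\<beta> - 1/2) y + gauss 2 (\<beta> - 3/2) y))"
    if s: "sin (pi * y) \<noteq> 0" for y :: complex
  proof -
    define h where "h = exp (pi * \<i> * y)"
    have h0: "h \<noteq> 0" by (simp add: h_def)
    have g1: "gauss 2 (\<beta> - 1/2) y = gauss 2 \<beta> y * inverse h"
      unfolding gauss_def h_def exp_minus[symmetric] exp_add[symmetric] by (intro arg_cong[of _ _ exp]) (simp add: algebra_simps)
    have g3: "gauss 2 (\<beta> - 3/2) y = gauss 2 \<beta> y * (inverse h * (inverse h * inverse h))"
      unfolding gauss_def h_def exp_minus[symmetric] exp_add[symmetric] by (intro arg_cong[of _ _ exp]) (simp add: algebra_simps)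
    have sh: "2 * \<i> * sin (pi * y) = h - inverse h"
      unfolding exp_pi_i_minus_exp[symmetric] by (simp add: h_def exp_minus)
    have g4: "gauss 2 \<beta> (y + 1) = exp (2 * pi * \<i> * \<beta>) * gauss 2 \<beta> y * (inverse h * (inverse h * (inverse h * inverse h)))"
    proof -
      have "gauss 2 \<beta> (y + 1) = exp (2 * pi * \<i> * \<beta> + (- (pi * \<i> * 2 * y\<^sup>2) + 2 * pi * \<i> * \<beta> * y) + - (4 * (pi * \<i> * y)) + - (2 * of_real pi * \<i>))"
        unfolding gauss_def by (intro arg_cong[of _ _ exp]) (simp add: algebra_simps power2_eq_square)
      also have "\<dots> = exp (2 * pi * \<i> * \<beta>) * gauss 2 \<beta> y * exp (- (4 * (pi * \<i> * y)))"
        unfolding exp_add gauss_def by (simp add: exp_minus)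
      also have "exp (- (4 * (pi * \<i> * y))) = inverse h * (inverse h * (inverse h * inverse h))"
        unfolding h_def exp_minus[symmetric] exp_add[symmetric] by (intro arg_cong[of _ _ exp]) simp
      finally show ?thesis .
    qed
    have d: "h - inverse h \<noteq> 0" using s sh by auto
    \<comment> \<open>With \<open>v = 1 / h\<close> this is the factorisation
      \<open>1 - v^4 = (v + v^3) (h - v)\<close>.\<close>
    have k: "inverse h * (inverse h * (inverse h * inverse h)) / (h - inverse h) =
        1 / (h - inverse h) - (inverse h + inverse h * (inverse h * inverse h))"
    proof -
      define v where "v = inverse h"
      have hv: "h * v = 1" using h0 by (simp add: v_def)
      have "(v + v * (v * v)) * (h - v) = (h * v) + (h * v) * (v * v) - v * v - v * (v * (v * v))"
        by (simp add: algebra_simps)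
      also have "\<dots> = 1 - v * (v * (v * v))" unfolding hv by simp
      finally have "v + v * (v * v) = (1 - v * (v * (v * v))) / (h - v)"
        using d by (simp add: v_def nonzero_eq_divide_eq)
      then show ?thesis unfolding v_def[symmetric] by (simp add: diff_divide_distrib)
    qed
    have "gauss 2 \<beta> (y + 1) / (2 * \<i> * sin (pi * (y + 1))) =
        - (exp (2 * pi * \<i> * \<beta>) * gauss 2 \<beta> y * (inverse h * (inverse h * (inverse h * inverse h)) / (h - inverse h)))"
      unfolding sin_pi_plus_one mult_minus_right sh g4
      by (simp only: divide_minus_right times_divide_eq_right)
    also have "\<dots> = - exp (2 * pi * \<i> * \<beta>) * (gauss 2 \<beta> y / (h - inverse h) - (gauss 2 \<beta> y * inverse h + gauss 2 \<beta> y * (inverse h * (inverse h * inverse h))))"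
      unfolding k by (simp add: algebra_simps)
    finally show ?thesis unfolding sh g1 g3 .
  qed
  have "mordell (Suc N) 2 \<beta> = (\<i> - 1) * (\<integral>b. - exp (2 * pi * \<i> * \<beta>) *
      (gauss 2 \<beta> (line (real N + 1/2) b) / (2 * \<i> * sin (pi * line (real N + 1/2) b)) -
      (gauss 2 (\<beta> - 1/2) (line (real N + 1/2) b) + gauss 2 (\<beta> - 3/2) (line (real N + 1/2) b))) \<partial>lborel)"
    unfolding mordell_def e line_integral_plus_one unfolding line_integral_def
    by (simp only: *[OF sin_half_integer_line_nonzero])
  also have "\<dots> = - exp (2 * pi * \<i> * \<beta>) *
    (mordell N 2 \<beta> - line_integral (real N + 1/2) (\<lambda>y. gauss 2 (\<beta> - 1/2) y + gauss 2 (\<beta> - 3/2) y))"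
    unfolding integral_mult_right_zero
    by (subst Bochner_Integration.integral_diff)
       (auto simp: integrable_mordell integrable_line_gauss mordell_def line_integral_def right_diff_distrib)
  finally show ?thesis .
qed

text \<open>
  The tail of the Gauss sum absorbs the residue, so that the left-hand side is invariant under
  the shift of the path by 1; this determines it.
\<close>

theorem mordell_gauss_2:
  fixes \<eta> :: complex
  assumes \<eta>: "Im \<eta> > 0"
  shows "summable (\<lambda>n. gauss 1 (2 * \<eta>) (of_nat (n + N + 1)))" (is ?th1)
    and "(\<Sum>n. gauss 1 (2 * \<eta>) (of_nat (n + N + 1))) + mordell N 2 (2 * \<eta>) =
      - (exp (2 * pi * \<i> * \<eta>\<^sup>2) * (sqrt 2 * exp (3 * pi * \<i> / 8) * sin (pi * \<eta>) / (2 * cos (2 * pi * \<eta>))))" (is ?th2)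
proof -
  define w where "w = exp (2 * pi * \<i> * (2 * \<eta>))"
  have w: "norm (- w) < 1" using \<eta> by (simp add: w_def)
  have w1: "1 + w \<noteq> 0"
  proof
    assume "1 + w = 0"
    then have "w = -1" by (simp add: add_eq_0_iff)
    then show False using w by simp
  qed
  have tm: "gauss 1 (2 * \<eta>) (of_nat (n + N + 1)) = (- w) ^ Suc N * (- w) ^ n" for n
  proof -
    have "gauss 1 (2 * \<eta>) (of_nat (n + N + 1)) = (-1) ^ (n + N + 1) * w ^ (n + N + 1)"
      using gauss_of_nat[of 1 "2 * \<eta>" "n + N + 1"] unfolding w_def[symmetric] by simp
    also have "\<dots> = (- w) ^ (Suc N + n)" unfolding power_minus[of w "Suc N + n"] by (simp add: add.commute)
    finally show ?thesis by (simp only: power_add)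
  qed
  show ?th1 unfolding tm by (intro summable_mult summable_geometric w)
  have S: "(\<Sum>n. gauss 1 (2 * \<eta>) (of_nat (n + N + 1))) = (- w) ^ Suc N / (1 + w)"
    unfolding tm using w by (subst suminf_mult) (auto simp: suminf_geometric summable_geometric)
  define Gs where "Gs = line_integral (real N + 1/2) (\<lambda>y. gauss 2 (2 * \<eta> - 1/2) y + gauss 2 (2 * \<eta> - 3/2) y)"
  have "mordell N 2 (2 * \<eta>) + (- w) ^ Suc N = - w * (mordell N 2 (2 * \<eta>) - Gs)"
  proof -
    have "gauss 2 (2 * \<eta>) (of_nat (Suc N)) = w ^ Suc N"
      using gauss_of_nat[of 2 "2 * \<eta>" "Suc N"] unfolding w_def[symmetric] by simp
    then have "(-1) ^ Suc N * gauss 2 (2 * \<eta>) (of_nat (Suc N)) = (- w) ^ Suc N"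
      by (simp only: power_minus[of w "Suc N"])
    then show ?thesis
      using mordell_Suc[of 2 N "2 * \<eta>"] mordell_Suc_gauss_2[of N "2 * \<eta>"]
      unfolding w_def[symmetric] Gs_def[symmetric] by simp
  qed
  then have "(mordell N 2 (2 * \<eta>) + (- w) ^ Suc N / (1 + w)) * (1 + w) = w * Gs"
    using w1 by (simp add: field_simps)
  then have Q: "(- w) ^ Suc N / (1 + w) + mordell N 2 (2 * \<eta>) = w / (1 + w) * Gs"
    using w1 by (simp add: nonzero_eq_divide_eq add.commute)
  define h where "h = exp (2 * pi * \<i> * \<eta>)"
  have h0: "h \<noteq> 0" by (simp add: h_def)
  have wh: "w = h * h" unfolding w_def h_def exp_add[symmetric] by (intro arg_cong[of _ _ exp]) simp
  have cosh: "2 * cos (2 * pi * \<eta>) = h + inverse h"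
  proof -
    have "exp (\<i> * (2 * pi * \<eta>)) = h" unfolding h_def by (intro arg_cong[of _ _ exp]) simp
    then show ?thesis unfolding cos_exp_eq exp_minus by simp
  qed
  have wc: "w / (1 + w) = h / (2 * cos (2 * pi * \<eta>))"
  proof -
    have "h + inverse h = (1 + w) / h" using h0 by (simp add: wh field_simps)
    then show ?thesis unfolding cosh using h0 by (simp add: wh)
  qed
  have Gs: "Gs = (\<i> - 1) / 2 * (exp (pi * \<i> * (2 * \<eta> - 1/2)\<^sup>2 / 2) + exp (pi * \<i> * (2 * \<eta> - 3/2)\<^sup>2 / 2))"
  proof -
    have "Gs = line_integral (real N + 1/2) (gauss 2 (2 * \<eta> - 1/2)) + line_integral (real N + 1/2) (gauss 2 (2 * \<eta> - 3/2))"
      unfolding Gs_def line_integral_def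
      by (subst Bochner_Integration.integral_add) (auto simp: integrable_line_gauss algebra_simps)
    then show ?thesis by (simp add: line_integral_gauss distrib_left)
  qed
  have E1: "exp (pi * \<i> * (2 * \<eta> - 1/2)\<^sup>2 / 2) = exp (2 * pi * \<i> * \<eta>\<^sup>2) * exp (pi * \<i> / 8) * inverse h * exp (\<i> * (pi * \<eta>))"
    unfolding h_def exp_minus[symmetric] exp_add[symmetric]
    by (intro arg_cong[of _ _ exp]) (simp add: power2_eq_square algebra_simps diff_divide_distrib add_divide_distrib)
  have E2: "exp (pi * \<i> * (2 * \<eta> - 3/2)\<^sup>2 / 2) = - (exp (2 * pi * \<i> * \<eta>\<^sup>2) * exp (pi * \<i> / 8) * inverse h * exp (- (\<i> * (pi * \<eta>))))"
  proof -
    have "exp (pi * \<i> * (2 * \<eta> - 3/2)\<^sup>2 / 2) = exp (2 * pi * \<i> * \<eta>\<^sup>2) * exp (pi * \<i> / 8) * inverse h * exp (- (\<i> * (pi * \<eta>))) * exp (of_real pi * \<i>)"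
      unfolding h_def exp_minus[symmetric] exp_add[symmetric]
      by (intro arg_cong[of _ _ exp]) (simp add: power2_eq_square algebra_simps diff_divide_distrib add_divide_distrib)
    then show ?thesis by simp
  qed
  have Gs': "Gs = (\<i> - 1) * \<i> * exp (pi * \<i> / 8) * exp (2 * pi * \<i> * \<eta>\<^sup>2) * inverse h * sin (pi * \<eta>)"
  proof -
    define X p m where "X = exp (2 * pi * \<i> * \<eta>\<^sup>2) * exp (pi * \<i> / 8) * inverse h"
      and "p = exp (\<i> * (pi * \<eta>))" and "m = exp (- (\<i> * (pi * \<eta>)))"
    have sn: "sin (pi * \<eta>) = (p - m) / (2 * \<i>)" unfolding sin_exp_eq p_def m_def ..
    have "Gs = (\<i> - 1) / 2 * (X * p + - (X * m))" unfolding Gs E1 E2 X_def p_def m_def ..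
    also have "X * p + - (X * m) = X * (p - m)" by (simp add: right_diff_distrib)
    also have "(\<i> - 1) / 2 * (X * (p - m)) = (\<i> - 1) * X * ((p - m) / 2)"
      by (simp only: times_divide_eq_left times_divide_eq_right mult.assoc)
    also have "(p - m) / 2 = \<i> * sin (pi * \<eta>)" unfolding sn by (simp add: field_simps)
    finally show ?thesis by (simp add: X_def mult_ac)
  qed
  \<comment> \<open>The phase \<open>3 pi / 8\<close> is \<open>pi / 4\<close> from the direction of
    the path plus \<open>pi / 8\<close> from completing the squares.\<close>
  have c38: "(\<i> - 1) * \<i> * exp (pi * \<i> / 8) = - (sqrt 2 * exp (3 * pi * \<i> / 8))"
  proof -
    have a: "(\<i> - 1) * \<i> = - (of_real (sqrt 2) * exp (\<i> * of_real (pi / 4)))"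
      unfolding cis_conv_exp[symmetric] by (simp add: complex_eq_iff cos_45 sin_45)
    have "exp (\<i> * of_real (pi / 4)) * exp (pi * \<i> / 8) = exp (3 * pi * \<i> / 8)"
      unfolding exp_add[symmetric] by (intro arg_cong[of _ _ exp]) (simp add: field_simps)
    then show ?thesis unfolding a by (simp add: mult.assoc)
  qed
  have "w / (1 + w) * Gs = (h * inverse h) * ((\<i> - 1) * \<i> * exp (pi * \<i> / 8)) * exp (2 * pi * \<i> * \<eta>\<^sup>2) * sin (pi * \<eta>) / (2 * cos (2 * pi * \<eta>))"
    unfolding wc Gs' by simp
  also have "\<dots> = - (exp (2 * pi * \<i> * \<eta>\<^sup>2) * (sqrt 2 * exp (3 * pi * \<i> / 8) * sin (pi * \<eta>) / (2 * cos (2 * pi * \<eta>))))"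
    unfolding c38 using h0 by simp
  finally show ?th2 unfolding S Q .
qed

section \<open>The saddle point\<close>

text \<open>Mean value inequality on the segment. The maximum keeps the decay of both exponentials
  even where \<open>x - y\<close> is large, as it is far from the saddle.\<close>

lemma norm_exp_diff_le:
  fixes x y :: complex
  shows "norm (exp x - exp y) \<le> norm (x - y) * max (exp (Re x)) (exp (Re y))"
proof -
  have "norm (exp x - exp y) \<le> max (exp (Re x)) (exp (Re y)) * norm (x - y)"
  proof (rule field_differentiable_bound[of "closed_segment x y" exp exp])
    show "(exp has_field_derivative exp z) (at z within closed_segment x y)" for z :: complex
      by (rule DERIV_subset[OF DERIV_exp]) simp
    show "norm (exp z) \<le> max (exp (Re x)) (exp (Re y))" if "z \<in> closed_segment x y" for z
    proof -
      obtain u where u: "0 \<le> u" "u \<le> 1" "z = (1 - u) *\<^sub>R x + u *\<^sub>R y"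
        using \<open>z \<in> closed_segment x y\<close> by (auto simp: in_segment)
      have "Re z = (1 - u) * Re x + u * Re y" using u by simp
      also have "\<dots> \<le> (1 - u) * max (Re x) (Re y) + u * max (Re x) (Re y)"
        using u by (intro add_mono mult_left_mono) auto
      also have "\<dots> = max (Re x) (Re y)" by (simp add: algebra_simps)
      finally show ?thesis by (auto simp: max_def split: if_splits)
    qed
  qed auto
  then show ?thesis by (simp add: mult.commute)
qed

text \<open>The third derivative is \<open>2 / u^3\<close>. The radius 1/3 is what
  \<open>norm_HP\<close> guarantees for \<open>u = x / \<eta>\<close>.\<close>

lemma Ln_Taylor_2:
  fixes p :: complex
  assumes seg: "\<And>u. u \<in> closed_segment 1 p \<Longrightarrow> u \<notin> \<real>\<^sub>\<le>\<^sub>0 \<and> norm u \<ge> 1/3"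
  shows "norm (Ln p - ((p - 1) - (p - 1)\<^sup>2 / 2)) \<le> 27 * norm (p - 1) ^ 3"
proof -
  define f :: "nat \<Rightarrow> complex \<Rightarrow> complex" where
    "f i x = (if i = 0 then Ln x else if i = 1 then inverse x else if i = 2 then - (inverse x ^ 2) else 2 * inverse x ^ 3)" for i x
  \<comment> \<open>\<open>54 = 2 * 3 ^ 3\<close>; the complex Taylor bound divides by
    \<open>fact 2\<close>, not \<open>fact 3\<close>.\<close>
  have "norm (f 0 p - (\<Sum>i\<le>2. f i 1 * (p - 1) ^ i / fact i)) \<le> 54 * norm (p - 1) ^ Suc 2 / fact 2"
  proof (rule field_Taylor[of "closed_segment 1 p"])
    fix i :: nat and x assume x: "x \<in> closed_segment 1 p" and i: "i \<le> 2"
    have x0: "x \<notin> \<real>\<^sub>\<le>\<^sub>0" "x \<noteq> 0" using seg[OF x] by auto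
    consider "i = 0" | "i = 1" | "i = 2" using i by linarith
    then show "(f i has_field_derivative f (Suc i) x) (at x within closed_segment 1 p)"
    proof cases
      case 1
      show ?thesis unfolding 1 f_def using x0 by (auto intro!: derivative_eq_intros)
    next
      case 2
      have "f 1 = inverse" "f (Suc 1) x = - (inverse x ^ 2)" by (auto simp: f_def fun_eq_iff)
      then show ?thesis unfolding 2 using x0 by (auto intro!: derivative_eq_intros simp: power2_eq_square)
    next
      case 3
      have "f 2 = (\<lambda>x. - (inverse x ^ 2))" "f (Suc 2) x = 2 * inverse x ^ 3" by (auto simp: f_def fun_eq_iff)
      then show ?thesis unfolding 3 using x0
        by (auto intro!: derivative_eq_intros simp: power2_eq_square power3_eq_cube)
    qed
  next
    fix x assume x: "x \<in> closed_segment 1 p"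
    have "norm x \<ge> 1/3" using seg[OF x] by simp
    then have "inverse (norm x) \<le> inverse (1/3)" by (intro le_imp_inverse_le) auto
    then have "inverse (norm x) ^ 3 \<le> 3 ^ 3" by (intro power_mono) auto
    then show "norm (f (Suc 2) x) \<le> 54"
      by (simp add: f_def norm_mult norm_power norm_inverse)
  qed auto
  also have "(\<Sum>i\<le>2. f i 1 * (p - 1) ^ i / fact i) = (p - 1) - (p - 1)\<^sup>2 / 2"
    by (simp add: f_def numeral_2_eq_2)
  finally show ?thesis by (simp add: f_def numeral_2_eq_2 numeral_3_eq_3)
qed

text \<open>Bernoulli's inequality for real exponents.\<close>

lemma one_plus_mult_le_powr:
  fixes x a :: real
  assumes x: "x \<ge> 0" and a: "a \<ge> 1"
  shows "1 + a * x \<le> (1 + x) powr a"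
proof -
  have "(1 + 0) powr a - a * 0 \<le> (1 + x) powr a - a * x"
  proof (rule DERIV_nonneg_imp_nondecreasing[OF x])
    fix y :: real assume y: "0 \<le> y"
    have "((\<lambda>x. (1 + x) powr a - a * x) has_real_derivative (a * (1 + y) powr (a - 1) - a)) (at y)"
      using y by (auto intro!: derivative_eq_intros)
    moreover have "(1 + y) powr (a - 1) \<ge> 1" using y a by (intro ge_one_powr_ge_zero) auto
    then have "a * (1 + y) powr (a - 1) - a \<ge> 0" using a by simp
    ultimately show "\<exists>d. ((\<lambda>x. (1 + x) powr a - a * x) has_real_derivative d) (at y) \<and> 0 \<le> d" by blast
  qed
  then show ?thesis by simp
qed

text \<open>The value 19/100 lies just below \<open>1 / sqrt (8 pi + 1)\<close>, the lower bound for
  \<open>Im \<eta>\<close> that follows from \<open>t_le\<close> and \<open>Re_\<eta>\<close>. It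
  suffices for \<open>4 pi * 19/100 \<ge> 2\<close>, used for the decay of the sum, and
  \<open>2 pi * 19/100 \<ge> 1\<close>, used in \<open>norm_G_ge\<close>.\<close>

locale saddle =
  fixes s \<eta> :: complex
  assumes s_eq: "s - 1 = 2 * pi * \<i> * \<eta>\<^sup>2"
    and Im_\<eta>: "19/100 \<le> Im \<eta>" and Re_\<eta>: "1 \<le> Re \<eta>" and Im_less_Re: "Im \<eta> < Re \<eta>"
    and k_ge_2: "1 - Re s \<ge> 2" and t_ge_1: "Im s \<ge> 1" and t_le: "Im s \<le> (1 - Re s)\<^sup>2"
begin

text \<open>
  \<open>HM\<close> is the second-order Taylor polynomial of \<open>H\<close> at the saddle point \<open>\<eta>\<close>, and
  \<open>x powr (s - 1) * exp (- pi i x^2) = T * exp (H x)\<close>. Both are used on the half plane \<open>HP\<close>,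
  whose points stay away from the origin by at least \<open>r / 3\<close>.
\<close>

definition "r = norm \<eta>"
definition "q = Re \<eta> + Im \<eta>"
definition "k = 1 - Re s"
definition "H x = 2 * pi * \<i> * \<eta>\<^sup>2 * Ln (x / \<eta>) - pi * \<i> * (x\<^sup>2 - \<eta>\<^sup>2)" for x :: complex
definition "HM x = - (2 * pi * \<i> * (x - \<eta>)\<^sup>2)" for x :: complex
definition "T = \<eta> powr (s - 1) * exp (- (pi * \<i> * \<eta>\<^sup>2))"
definition "C = \<eta> powr (s - 1) * exp (- (3 * pi * \<i> * \<eta>\<^sup>2))"
definition "HP = {x::complex. q - 1/2 \<le> Re x + Im x}"

lemma s_eq': "s = 1 + 2 * pi * \<i> * \<eta>\<^sup>2" using s_eq by (simp add: algebra_simps)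

lemma Re_s: "Re s = 1 - 4 * pi * Re \<eta> * Im \<eta>" and Im_s: "Im s = 2 * pi * ((Re \<eta>)\<^sup>2 - (Im \<eta>)\<^sup>2)"
  by (simp_all add: s_eq' power2_eq_square)

lemma k_eq: "k = 4 * pi * Re \<eta> * Im \<eta>" by (simp add: k_def Re_s)

lemma \<eta>_nonzero: "\<eta> \<noteq> 0" using Re_\<eta> by auto

lemma r_ge_1: "1 \<le> r" using Re_\<eta> complex_Re_le_cmod[of \<eta>] by (simp add: r_def)

lemma r_le_q: "r \<le> q" using cmod_le[of \<eta>] Re_\<eta> Im_\<eta> by (simp add: r_def q_def)

text \<open>Converts the natural error \<open>1 / r\<close> of the saddle point into the
  \<open>t powr (-1/2)\<close> of the claim; the 9 is a bound for \<open>2 pi\<close>.\<close>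

lemma inverse_r_le: "1 / r \<le> 3 / sqrt (Im s)"
proof -
  have "Im s \<le> 9 * r\<^sup>2"
  proof -
    have "Im s \<le> (2 * pi) * r\<^sup>2"
      unfolding Im_s r_def cmod_power2 by (intro mult_left_mono) auto
    also have "\<dots> \<le> 9 * r\<^sup>2" using pi_less_4 pi_approx by (intro mult_right_mono) auto
    finally show ?thesis .
  qed
  also have "9 * r\<^sup>2 = (3 * r)\<^sup>2" by (simp add: power_mult_distrib)
  finally have "sqrt (Im s) \<le> 3 * r" using r_ge_1 by (intro real_le_lsqrt) auto
  then have "3 / (3 * r) \<le> 3 / sqrt (Im s)" using t_ge_1 r_ge_1 by (intro divide_left_mono mult_pos_pos) auto
  then show ?thesis by simp
qed

lemma convex_HP: "convex HP"
proof -
  have "HP = {x. q - 1/2 \<le> (1 + \<i>) \<bullet> x}" by (auto simp: HP_def inner_complex_def)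
  then show ?thesis by (simp only: convex_halfspace_ge)
qed

lemma HP_pos: "x \<in> HP \<Longrightarrow> Re x + Im x \<ge> r / 2" and q_pos: "q > 0"
  using r_le_q r_ge_1 by (auto simp: HP_def)

lemma norm_HP: assumes "x \<in> HP" shows "norm x \<ge> r / 3"
proof -
  have "r / 2 \<le> Re x + Im x" by (rule HP_pos[OF assms])
  then have "(r / 2)\<^sup>2 \<le> (Re x + Im x)\<^sup>2" using r_ge_1 by (intro power_mono) auto
  also have "\<dots> \<le> 2 * (norm x)\<^sup>2"
    unfolding cmod_power2
    using zero_le_power2[of "Re x - Im x"] by (simp add: power2_eq_square algebra_simps)
  finally have "r\<^sup>2 \<le> 8 * (norm x)\<^sup>2" by (simp add: power_divide)
  then have "r\<^sup>2 \<le> 9 * (norm x)\<^sup>2" using zero_le_power2[of "norm x"] by linarith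
  then have "(r / 3)\<^sup>2 \<le> (norm x)\<^sup>2" by (simp add: power_divide)
  then show ?thesis by (rule power2_le_imp_le) simp
qed

lemma HP_nonzero: "x \<in> HP \<Longrightarrow> x \<noteq> 0" using norm_HP[of x] r_ge_1 by auto

lemma norm_\<eta>_div_HP: assumes "x \<in> HP" shows "norm (\<eta> / x) \<le> 3"
  using norm_HP[OF assms] HP_nonzero[OF assms] by (simp add: norm_divide r_def field_simps)

lemma HP_div_\<eta>: assumes "x \<in> HP" shows "x / \<eta> \<notin> \<real>\<^sub>\<le>\<^sub>0"
proof
  assume "x / \<eta> \<in> \<real>\<^sub>\<le>\<^sub>0"
  then obtain \<rho> where \<rho>: "x / \<eta> = of_real \<rho>" "\<rho> \<le> 0" by (auto elim!: nonpos_Reals_cases)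
  then have "x = of_real \<rho> * \<eta>" using \<eta>_nonzero by (simp add: field_simps)
  then have "Re x + Im x = \<rho> * q" by (simp add: q_def algebra_simps)
  also have "\<dots> \<le> 0" using \<rho> q_pos by (simp add: mult_nonpos_nonneg)
  finally show False using HP_pos[OF assms] r_ge_1 by linarith
qed

text \<open>Makes \<open>1 + Re (\<eta> / x) \<ge> 1/2\<close>, so that \<open>Re H\<close> descends
  along the whole line. The claim amounts to \<open>2 Re (\<eta> cnj x) + |x|^2 \<ge> 0\<close>. For
  \<open>Re x \<ge> 0\<close> already the first summand is nonnegative; otherwise
  \<open>Re \<eta> \<le> 2 (Re x + Im x)\<close> and the square compensates.\<close>

lemma Re_\<eta>_div_HP: assumes "x \<in> HP" shows "Re (\<eta> / x) \<ge> - 1/2"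
proof -
  define a b where "a = Re x" and "b = Im x"
  have x0: "a + b \<ge> q - 1/2" "a + b > 0" using assms HP_pos[OF assms] r_ge_1 by (auto simp: HP_def a_def b_def)
  have n: "a\<^sup>2 + b\<^sup>2 > 0" using HP_nonzero[OF assms] by (simp add: a_def b_def complex_neq_0)
  have "0 \<le> 2 * (Re \<eta> * a + Im \<eta> * b) + (a\<^sup>2 + b\<^sup>2)"
  proof (cases "a \<ge> 0")
    case True
    have "0 \<le> Im \<eta> * (a + b)" using Im_\<eta> x0 by simp
    also have "\<dots> \<le> Re \<eta> * a + Im \<eta> * b"
      using True Im_less_Re by (simp add: distrib_left mult_right_mono)
    finally have "0 \<le> 2 * (Re \<eta> * a + Im \<eta> * b)" by (rule mult_nonneg_nonneg[OF zero_le_numeral])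
    then show ?thesis by (rule add_nonneg_nonneg) simp
  next
    case False
    define y where "y = - a"
    have y: "y > 0" "b = (a + b) + y" using False by (auto simp: y_def)
    have 1: "Re \<eta> * y \<le> (2 * (a + b)) * y"
      using x0 y Re_\<eta> Im_\<eta> by (intro mult_right_mono) (auto simp: q_def)
    have 2: "4 * (a + b) * y \<le> a\<^sup>2 + b\<^sup>2"
    proof -
      have "0 \<le> y\<^sup>2 + (y - (a + b))\<^sup>2" by simp
      also have "\<dots> = a\<^sup>2 + b\<^sup>2 - 4 * (a + b) * y" by (simp add: y_def power2_eq_square algebra_simps)
      finally show ?thesis by simp
    qed
    have "0 \<le> Im \<eta> * b" using Im_\<eta> x0 y by simp
    define P where "P = (a + b) * y"
    have "Re \<eta> * y \<le> 2 * P" "4 * P \<le> a\<^sup>2 + b\<^sup>2" using 1 2 by (simp_all only: P_def mult.assoc)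
    moreover have "Re \<eta> * a = - (Re \<eta> * y)" by (simp add: y_def)
    ultimately show ?thesis using \<open>0 \<le> Im \<eta> * b\<close> unfolding distrib_left by linarith
  qed
  moreover have "- (1/2) * Y \<le> X" if "0 \<le> 2 * X + Y" for X Y :: real using that by simp
  ultimately have "- (1/2) * (a\<^sup>2 + b\<^sup>2) \<le> Re \<eta> * a + Im \<eta> * b" by blast
  then have "- (1/2) \<le> (Re \<eta> * a + Im \<eta> * b) / (a\<^sup>2 + b\<^sup>2)" using n by (simp add: pos_le_divide_eq)
  then show ?thesis by (simp add: Re_divide a_def b_def)
qed

text \<open>From \<open>\<eta>^2 / x - x = - (x - \<eta>) (1 + \<eta> / x)\<close>. Freezing the
  last factor at its value 2 at \<eta> gives the derivative of \<open>HM\<close>.\<close>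

lemma H_deriv:
  assumes "x \<in> HP"
  shows "(H has_field_derivative - (2 * pi * \<i> * (x - \<eta>) * (1 + \<eta> / x))) (at x)"
proof -
  have "(H has_field_derivative (2 * pi * \<i> * \<eta>\<^sup>2 * (inverse (x / \<eta>) * (1 / \<eta>)) - pi * \<i> * (2 * x))) (at x)"
    unfolding H_def using HP_div_\<eta>[OF assms] \<eta>_nonzero
    by (auto intro!: derivative_eq_intros)
  also have "2 * pi * \<i> * \<eta>\<^sup>2 * (inverse (x / \<eta>) * (1 / \<eta>)) - pi * \<i> * (2 * x) = - (2 * pi * \<i> * (x - \<eta>) * (1 + \<eta> / x))"
    using HP_nonzero[OF assms] \<eta>_nonzero by (simp add: field_simps power2_eq_square)
  finally show ?thesis .
qed

lemma line_minus_\<eta>: "line (q + e) b - \<eta> = of_real e + (\<i> - 1) * of_real (b - Im \<eta>)"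
  by (simp add: complex_eq_iff q_def)

lemma line_in_HP: "\<bar>e\<bar> \<le> 1/2 \<Longrightarrow> line (q + e) b \<in> HP"
  by (auto simp: HP_def)

text \<open>The starting value for integration along the line, which passes through
  \<open>\<eta> + e\<close> at the height of \<eta>.\<close>

lemma H_near_\<eta>:
  assumes e: "\<bar>e\<bar> \<le> 1/2"
  shows "Re (H (\<eta> + of_real e)) \<le> 2 * pi"
proof -
  have seg: "closed_segment \<eta> (\<eta> + of_real e) \<subseteq> HP"
    by (rule closed_segment_subset[OF _ _ convex_HP]) (use e in \<open>auto simp: HP_def q_def\<close>)
  have H\<eta>: "H \<eta> = 0" using \<eta>_nonzero by (simp add: H_def)
  have "norm (H (\<eta> + of_real e) - H \<eta>) \<le> (4 * pi) * norm (\<eta> + of_real e - \<eta>)"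
  proof (rule field_differentiable_bound[of "closed_segment \<eta> (\<eta> + of_real e)" H])
    fix x assume x: "x \<in> closed_segment \<eta> (\<eta> + of_real e)"
    then have xh: "x \<in> HP" using seg by auto
    show "(H has_field_derivative - (2 * pi * \<i> * (x - \<eta>) * (1 + \<eta> / x))) (at x within closed_segment \<eta> (\<eta> + of_real e))"
      by (rule has_field_derivative_at_within[OF H_deriv[OF xh]])
    have "norm (x - \<eta>) \<le> 1/2" using segment_bound(1)[OF x] e by (simp add: norm_minus_commute)
    moreover have "norm (1 + \<eta> / x) \<le> 4" using norm_triangle_ineq[of 1 "\<eta> / x"] norm_\<eta>_div_HP[OF xh] by simp
    ultimately have "norm (x - \<eta>) * norm (1 + \<eta> / x) \<le> (1/2) * 4" by (intro mult_mono) auto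
    then have "2 * pi * (norm (x - \<eta>) * norm (1 + \<eta> / x)) \<le> 2 * pi * ((1/2) * 4)" by (intro mult_left_mono) auto
    then show "norm (- (2 * pi * \<i> * (x - \<eta>) * (1 + \<eta> / x))) \<le> 4 * pi" by (simp add: norm_mult mult.assoc)
  qed auto
  also have "\<dots> \<le> (4 * pi) * (1/2)" using e by (intro mult_left_mono) auto
  finally have "norm (H (\<eta> + of_real e)) \<le> 2 * pi" by (simp add: H\<eta>)
  then show ?thesis using complex_Re_le_cmod[of "H (\<eta> + of_real e)"] by linarith
qed

text \<open>On the line \<open>x - \<eta> = e + (i - 1) (b - Im \<eta>)\<close>. Since
  \<open>(i - 1)^2 = - 2 i\<close>, the part proportional to \<open>b - Im \<eta>\<close> gets a
  real coefficient: the direction is that of steepest descent, and only the displacement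
  \<open>e\<close> disturbs it.\<close>

lemma H_line_deriv:
  assumes e: "\<bar>e\<bar> \<le> 1/2"
  defines "D \<equiv> \<lambda>b. (2 * pi * e - 4 * pi * (b - Im \<eta>)) * (1 + Re (\<eta> / line (q + e) b)) - 2 * pi * e * Im (\<eta> / line (q + e) b)"
  shows "((\<lambda>b. Re (H (line (q + e) b))) has_real_derivative D b) (at b)"
proof -
  define x where "x = line (q + e) b"
  have lv: "(line (q + e) has_vector_derivative (\<i> - 1)) (at b)"
    unfolding line_def[abs_def] by (auto intro!: derivative_eq_intros)
  have "((H \<circ> line (q + e)) has_vector_derivative (\<i> - 1) * - (2 * pi * \<i> * (x - \<eta>) * (1 + \<eta> / x))) (at b)"
    by (rule field_vector_diff_chain_at[OF lv]) (use H_deriv[OF line_in_HP[OF e]] in \<open>simp add: x_def\<close>)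
  then have v: "((\<lambda>b. Re ((H \<circ> line (q + e)) b)) has_vector_derivative Re ((\<i> - 1) * - (2 * pi * \<i> * (x - \<eta>) * (1 + \<eta> / x)))) (at b)"
    by (rule bounded_linear.has_vector_derivative[OF bounded_linear_Re])
  have eq1: "(\<i> - 1) * - (2 * pi * \<i> * (x - \<eta>) * (1 + \<eta> / x)) =
      (of_real (2 * pi * e) * (1 + \<i>) - of_real (4 * pi * (b - Im \<eta>))) * (1 + \<eta> / x)"
  proof -
    have "(\<i> - 1) * - (2 * P * \<i> * (E + (\<i> - 1) * B) * W) = (2 * P * E * (1 + \<i>) - 4 * P * B) * W"
      for P E B W :: complex by (simp add: algebra_simps)
    then show ?thesis unfolding x_def line_minus_\<eta> by simp
  qed
  have eq2: "Re ((of_real (2 * pi * e) * (1 + \<i>) - of_real (4 * pi * (b - Im \<eta>))) * (1 + \<eta> / x)) = D b"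
  proof -
    have "Re ((of_real \<alpha> * (1 + \<i>) - of_real \<gamma>) * (1 + W)) = (\<alpha> - \<gamma>) * (1 + Re W) - \<alpha> * Im W"
      for \<alpha> \<gamma> :: real and W :: complex by (simp add: algebra_simps)
    then show ?thesis unfolding D_def x_def by (simp only:)
  qed
  show ?thesis
    using v unfolding eq1 eq2 has_real_derivative_iff_has_vector_derivative o_def .
qed

text \<open>The factor \<open>1 + A \<ge> 1/2\<close> at worst halves the rate \<open>4 pi\<close>;
  the displacement costs at most \<open>2 pi * (1/2) * 7\<close>, as
  \<open>|1 + A - B| \<le> 7\<close>.\<close>

lemma H_line_deriv_bound:
  assumes e: "\<bar>e\<bar> \<le> 1/2"
  defines "D \<equiv> \<lambda>b. (2 * pi * e - 4 * pi * (b - Im \<eta>)) * (1 + Re (\<eta> / line (q + e) b)) - 2 * pi * e * Im (\<eta> / line (q + e) b)"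
  shows "b \<ge> Im \<eta> \<Longrightarrow> D b \<le> - 2 * pi * (b - Im \<eta>) + 7 * pi"
    and "b \<le> Im \<eta> \<Longrightarrow> D b \<ge> - 2 * pi * (b - Im \<eta>) - 7 * pi"
proof -
  define A B where "A = Re (\<eta> / line (q + e) b)" and "B = Im (\<eta> / line (q + e) b)"
  have n3: "norm (\<eta> / line (q + e) b) \<le> 3" by (rule norm_\<eta>_div_HP[OF line_in_HP[OF e]])
  have AB: "\<bar>A\<bar> \<le> 3" "\<bar>B\<bar> \<le> 3" "A \<ge> - 1/2"
    using abs_Re_le_cmod[of "\<eta> / line (q + e) b"] abs_Im_le_cmod[of "\<eta> / line (q + e) b"] n3
      Re_\<eta>_div_HP[OF line_in_HP[OF e, of b]] by (auto simp: A_def B_def)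
  have "\<bar>e * (1 + A - B)\<bar> \<le> (1/2) * 7"
    unfolding abs_mult using e AB by (intro mult_mono) auto
  then have "2 * pi * \<bar>e * (1 + A - B)\<bar> \<le> 2 * pi * ((1/2) * 7)" by (intro mult_left_mono) auto
  then have E: "\<bar>2 * pi * (e * (1 + A - B))\<bar> \<le> 7 * pi" by (simp add: abs_mult)
  have D: "D b = 2 * pi * (e * (1 + A - B)) - 4 * pi * (b - Im \<eta>) * (1 + A)"
  proof -
    have "D b = (2 * pi * e - 4 * pi * (b - Im \<eta>)) * (1 + A) - 2 * pi * e * B"
      by (simp only: D_def A_def B_def)
    then show ?thesis by (simp add: algebra_simps)
  qed
  define Z where "Z = 4 * pi * (b - Im \<eta>) * (1 + A)"
  have D': "D b = 2 * pi * (e * (1 + A - B)) - Z" unfolding D Z_def ..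
  show "D b \<le> - 2 * pi * (b - Im \<eta>) + 7 * pi" if "b \<ge> Im \<eta>"
  proof -
    have "4 * pi * (b - Im \<eta>) * (1/2) \<le> Z"
      unfolding Z_def using that AB by (intro mult_left_mono) auto
    then have "2 * pi * (b - Im \<eta>) \<le> Z" by simp
    then show ?thesis using E unfolding D' by linarith
  qed
  show "D b \<ge> - 2 * pi * (b - Im \<eta>) - 7 * pi" if "b \<le> Im \<eta>"
  proof -
    have "Z \<le> 4 * pi * (b - Im \<eta>) * (1/2)"
      unfolding Z_def using that AB by (intro mult_left_mono_neg) (auto simp: mult_nonneg_nonpos)
    then have "Z \<le> 2 * pi * (b - Im \<eta>)" by simp
    then show ?thesis using E unfolding D' by linarith
  qed
qed

text \<open>The derivative bounds are integrated from \<open>b = Im \<eta>\<close> in both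
  directions, as monotonicity of the difference to the claimed majorant.\<close>

lemma Re_H_line_le:
  assumes e: "\<bar>e\<bar> \<le> 1/2"
  shows "Re (H (line (q + e) b)) \<le> 2 * pi + 7 * pi * \<bar>b - Im \<eta>\<bar> - pi * (b - Im \<eta>)\<^sup>2"
proof -
  define P where "P b = Re (H (line (q + e) b))" for b
  define D where "D = (\<lambda>b. (2 * pi * e - 4 * pi * (b - Im \<eta>)) * (1 + Re (\<eta> / line (q + e) b)) - 2 * pi * e * Im (\<eta> / line (q + e) b))"
  have dP: "(P has_real_derivative D b) (at b)" for b
    unfolding P_def D_def by (rule H_line_deriv[OF e])
  have "line (q + e) (Im \<eta>) = \<eta> + of_real e" by (simp add: complex_eq_iff q_def)
  then have P0: "P (Im \<eta>) \<le> 2 * pi" using H_near_\<eta>[OF e] by (simp add: P_def)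
  show ?thesis
  proof (cases "b \<ge> Im \<eta>")
    case True
    have "P b + pi * (b - Im \<eta>)\<^sup>2 - 7 * pi * (b - Im \<eta>) \<le> P (Im \<eta>) + pi * (Im \<eta> - Im \<eta>)\<^sup>2 - 7 * pi * (Im \<eta> - Im \<eta>)"
    proof (rule DERIV_nonpos_imp_nonincreasing[OF True])
      fix x assume x: "Im \<eta> \<le> x"
      have "((\<lambda>b. P b + pi * (b - Im \<eta>)\<^sup>2 - 7 * pi * (b - Im \<eta>)) has_real_derivative (D x + 2 * pi * (x - Im \<eta>) - 7 * pi)) (at x)"
        by (auto intro!: derivative_eq_intros dP)
      moreover have "D x + 2 * pi * (x - Im \<eta>) - 7 * pi \<le> 0"
        using H_line_deriv_bound(1)[OF e x] by (simp add: D_def)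
      ultimately show "\<exists>y. ((\<lambda>b. P b + pi * (b - Im \<eta>)\<^sup>2 - 7 * pi * (b - Im \<eta>)) has_real_derivative y) (at x) \<and> y \<le> 0"
        by blast
    qed
    then show ?thesis using P0 True by (simp add: P_def)
  next
    case False
    then have b: "b \<le> Im \<eta>" by simp
    have "P b + pi * (b - Im \<eta>)\<^sup>2 + 7 * pi * (b - Im \<eta>) \<le> P (Im \<eta>) + pi * (Im \<eta> - Im \<eta>)\<^sup>2 + 7 * pi * (Im \<eta> - Im \<eta>)"
    proof (rule DERIV_nonneg_imp_nondecreasing[OF b])
      fix x assume x: "x \<le> Im \<eta>"
      have "((\<lambda>b. P b + pi * (b - Im \<eta>)\<^sup>2 + 7 * pi * (b - Im \<eta>)) has_real_derivative (D x + 2 * pi * (x - Im \<eta>) + 7 * pi)) (at x)"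
        by (auto intro!: derivative_eq_intros dP)
      moreover have "0 \<le> D x + 2 * pi * (x - Im \<eta>) + 7 * pi"
        using H_line_deriv_bound(2)[OF e x] by (simp add: D_def)
      ultimately show "\<exists>y. ((\<lambda>b. P b + pi * (b - Im \<eta>)\<^sup>2 + 7 * pi * (b - Im \<eta>)) has_real_derivative y) (at x) \<and> 0 \<le> y"
        by blast
    qed
    then show ?thesis using P0 b by (simp add: P_def algebra_simps)
  qed
qed

lemma Re_HM_line:
  "Re (HM (line (q + e) b)) = 4 * pi * e * (b - Im \<eta>) - 4 * pi * (b - Im \<eta>)\<^sup>2"
  unfolding HM_def line_minus_\<eta> by (simp add: power2_eq_square algebra_simps)

text \<open>Deliberately weakened to the majorant of \<open>Re_H_line_le\<close>, so that one
  function bounds both exponentials.\<close>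

lemma Re_HM_line_le:
  assumes e: "\<bar>e\<bar> \<le> 1/2"
  shows "Re (HM (line (q + e) b)) \<le> 2 * pi + 7 * pi * \<bar>b - Im \<eta>\<bar> - pi * (b - Im \<eta>)\<^sup>2"
proof -
  define \<beta> where "\<beta> = b - Im \<eta>"
  have "e * \<beta> \<le> \<bar>e * \<beta>\<bar>" by simp
  also have "\<dots> \<le> 1/2 * \<bar>\<beta>\<bar>" unfolding abs_mult using e by (intro mult_right_mono) auto
  finally have "pi * (e * \<beta>) \<le> pi * (1/2 * \<bar>\<beta>\<bar>)" by (intro mult_left_mono) auto
  then have X: "pi * (e * \<beta>) \<le> 1/2 * (pi * \<bar>\<beta>\<bar>)" by simp
  have Y: "0 \<le> pi * \<bar>\<beta>\<bar>" "0 \<le> pi * \<beta>\<^sup>2" by simp_all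
  have "4 * pi * e * \<beta> - 4 * pi * \<beta>\<^sup>2 = 4 * (pi * (e * \<beta>)) - 4 * (pi * \<beta>\<^sup>2)" by simp
  also have "\<dots> \<le> 2 * pi + 7 * (pi * \<bar>\<beta>\<bar>) - pi * \<beta>\<^sup>2"
    using X Y pi_gt_zero by linarith
  finally show ?thesis unfolding Re_HM_line \<beta>_def[symmetric] by (simp add: mult.assoc)
qed

text \<open>In terms of \<open>p = x / \<eta>\<close> the difference is
  \<open>2 pi i \<eta>^2\<close> times the Taylor remainder of \<open>Ln\<close> at 1. The gain
  \<open>1 / r\<close> is \<open>r^2\<close> against the cube of
  \<open>norm (x - \<eta>) / r\<close>; convexity of \<open>HP\<close> keeps the segment
  inside.\<close>

lemma H_minus_HM:
  assumes x: "x \<in> HP"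
  shows "norm (H x - HM x) \<le> 54 * pi * norm (x - \<eta>) ^ 3 / r"
proof -
  define p where "p = x / \<eta>"
  have x_eq: "x = \<eta> * p" using \<eta>_nonzero by (simp add: p_def)
  have "H x - HM x = 2 * pi * \<i> * \<eta>\<^sup>2 * (Ln p - ((p - 1) - (p - 1)\<^sup>2 / 2))"
    unfolding H_def HM_def p_def[symmetric] unfolding x_eq
    by (simp add: power2_eq_square algebra_simps add_divide_distrib diff_divide_distrib)
  then have "norm (H x - HM x) = 2 * pi * r\<^sup>2 * norm (Ln p - ((p - 1) - (p - 1)\<^sup>2 / 2))"
    by (simp add: norm_mult norm_power r_def)
  also have "\<dots> \<le> 2 * pi * r\<^sup>2 * (27 * norm (p - 1) ^ 3)"
  proof (intro mult_left_mono Ln_Taylor_2)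
    fix u assume "u \<in> closed_segment 1 p"
    then obtain c where c: "0 \<le> c" "c \<le> 1" "u = (1 - c) *\<^sub>R 1 + c *\<^sub>R p" by (auto simp: in_segment)
    have "\<eta> \<in> HP" by (simp add: HP_def q_def)
    then have "(1 - c) *\<^sub>R \<eta> + c *\<^sub>R x \<in> HP"
      using x convex_HP c by (auto simp: convex_alt)
    also have "(1 - c) *\<^sub>R \<eta> + c *\<^sub>R x = u * \<eta>" by (simp add: c(3) x_eq scaleR_conv_of_real algebra_simps)
    finally have u: "u * \<eta> \<in> HP" .
    have "u \<notin> \<real>\<^sub>\<le>\<^sub>0" using HP_div_\<eta>[OF u] \<eta>_nonzero by simp
    moreover have "norm u \<ge> 1/3"
    proof (rule mult_right_le_imp_le)
      show "1/3 * r \<le> norm u * r" using norm_HP[OF u] by (simp add: norm_mult r_def)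
    qed (use r_ge_1 in simp)
    ultimately show "u \<notin> \<real>\<^sub>\<le>\<^sub>0 \<and> norm u \<ge> 1/3" ..
  qed auto
  also have "norm (p - 1) = norm (x - \<eta>) / r"
  proof -
    have "x - \<eta> = \<eta> * (p - 1)" by (simp add: x_eq algebra_simps)
    then show ?thesis using \<eta>_nonzero by (simp add: norm_mult r_def)
  qed
  also have "2 * pi * r\<^sup>2 * (27 * (norm (x - \<eta>) / r) ^ 3) = 54 * pi * norm (x - \<eta>) ^ 3 / r"
    using r_ge_1 by (simp add: power_divide power2_eq_square power3_eq_cube)
  finally show ?thesis .
qed

lemma exp_H_minus_exp_HM:
  assumes x: "x \<in> HP" and B: "exp (Re (H x)) \<le> B" "exp (Re (HM x)) \<le> B"
  shows "norm (exp (H x) - exp (HM x)) \<le> 54 * pi * norm (x - \<eta>) ^ 3 / r * B"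
proof -
  have "norm (exp (H x) - exp (HM x)) \<le> norm (H x - HM x) * max (exp (Re (H x))) (exp (Re (HM x)))"
    by (rule norm_exp_diff_le)
  also have "\<dots> \<le> (54 * pi * norm (x - \<eta>) ^ 3 / r) * B"
    using B r_ge_1 by (intro mult_mono H_minus_HM[OF x]) (auto simp: le_max_iff_disj)
  finally show ?thesis .
qed

text \<open>Both points lie in the half plane \<open>Re x + Im x > 0\<close>, so their arguments
  differ by less than pi.\<close>

lemma Ln_div_\<eta>:
  assumes "x \<in> HP"
  shows "Ln (x / \<eta>) = Ln x - Ln \<eta>"
proof (rule Ln_unique)
  have pos: "Re x + Im x > 0" "Re \<eta> + Im \<eta> > 0"
    using HP_pos[OF assms] r_ge_1 q_pos by (auto simp: q_def)
  have "\<bar>Im (Ln ((1 - \<i>) * x))\<bar> < pi / 2" "\<bar>Im (Ln ((1 - \<i>) * \<eta>))\<bar> < pi / 2"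
    by (rule Re_Ln_pos_lt_imp; use pos in simp)+
  then have "\<bar>Im (Ln x - Ln \<eta>)\<bar> < pi"
    unfolding Ln_rotate[OF pos(1)] Ln_rotate[OF pos(2)] plus_complex.sel minus_complex.sel by linarith
  then show "- pi < Im (Ln x - Ln \<eta>)" "Im (Ln x - Ln \<eta>) \<le> pi" by (auto simp: abs_less_iff)
  show "exp (Ln x - Ln \<eta>) = x / \<eta>" using HP_nonzero[OF assms] \<eta>_nonzero by (simp add: exp_diff)
qed

lemma powr_gauss_eq:
  assumes "x \<in> HP"
  shows "x powr (s - 1) * gauss 1 0 x = T * exp (H x)"
proof -
  have "x powr (s - 1) = \<eta> powr (s - 1) * exp (2 * pi * \<i> * \<eta>\<^sup>2 * Ln (x / \<eta>))"
    using HP_nonzero[OF assms] \<eta>_nonzero unfolding Ln_div_\<eta>[OF assms] s_eq[symmetric]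
    by (simp add: powr_def exp_add[symmetric] right_diff_distrib)
  moreover have "gauss 1 0 x = exp (- (pi * \<i> * \<eta>\<^sup>2)) * exp (- (pi * \<i> * (x\<^sup>2 - \<eta>\<^sup>2)))"
    unfolding gauss_def exp_add[symmetric] by (intro arg_cong[of _ _ exp]) (simp add: algebra_simps)
  ultimately have "x powr (s - 1) * gauss 1 0 x = T * (exp (2 * pi * \<i> * \<eta>\<^sup>2 * Ln (x / \<eta>)) * exp (- (pi * \<i> * (x\<^sup>2 - \<eta>\<^sup>2))))"
    by (simp add: T_def)
  then show ?thesis unfolding H_def exp_add[symmetric] by simp
qed

text \<open>Expanding the second-order Taylor polynomial of \<open>2 pi i \<eta>^2 Ln y\<close> in
  powers of \<open>y\<close> leaves \<open>- pi i y^2 + 4 pi i \<eta> y - 3 pi i \<eta>^2\<close>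
  besides the value at \<eta>. This is the origin of \<open>C\<close> and of the parameter
  \<open>2 * \<eta>\<close>.\<close>

lemma C_gauss_2: "C * gauss 2 (2 * \<eta>) x = T * exp (HM x)"
proof -
  have "exp (- (3 * pi * \<i> * \<eta>\<^sup>2)) * gauss 2 (2 * \<eta>) x = exp (- (pi * \<i> * \<eta>\<^sup>2)) * exp (HM x)"
    unfolding gauss_def HM_def exp_add[symmetric]
    by (intro arg_cong[of _ _ exp]) (simp add: power2_eq_square algebra_simps)
  then show ?thesis by (simp add: C_def T_def mult.assoc)
qed

lemma C_gauss_1: "C * gauss 1 (2 * \<eta>) x * gauss 1 0 x = T * exp (HM x)"
proof -
  have "gauss 1 (2 * \<eta>) x * gauss 1 0 x = gauss 2 (2 * \<eta>) x"
    unfolding gauss_def exp_add[symmetric] by (intro arg_cong[of _ _ exp]) (simp add: algebra_simps)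
  then show ?thesis using C_gauss_2[of x] by (simp add: mult.assoc)
qed

lemma C_exp: "C * exp (2 * pi * \<i> * \<eta>\<^sup>2) = T"
  unfolding C_def T_def mult.assoc exp_add[symmetric]
  by (intro arg_cong2[of _ _ _ _ "(*)"] arg_cong[of _ _ exp] refl) (simp add: algebra_simps)

end

section \<open>Error estimates\<close>

text \<open>The cube stems from the Taylor error. The \<open>7 pi\<close> of
  \<open>Re_H_line_le\<close> has grown to \<open>8 pi\<close> because extracting
  \<open>exp (- pi * Im \<eta>)\<close> from the sine costs
  \<open>exp (pi * |\<beta>|)\<close>.\<close>

definition line_weight :: "real \<Rightarrow> real" where
  "line_weight \<beta> = (1/2 + 2 * \<bar>\<beta>\<bar>) ^ 3 * exp (8 * pi * \<bar>\<beta>\<bar> - pi * \<beta>\<^sup>2)"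

definition line_const :: real where "line_const = (\<integral>\<beta>. line_weight \<beta> \<partial>lborel)"

definition sum_const :: real where "sum_const = (\<Sum>n. 1 / (1 + real n / 6)\<^sup>2)"

text \<open>The first summand serves \<open>k \<ge> 6\<close>: 3 from \<open>inverse_r_le\<close>,
  \<open>54 pi\<close> from \<open>H_minus_HM\<close>, and \<open>216 = 6 ^ 3\<close> from the scale
  \<open>u / 6\<close>. The second serves \<open>k < 6\<close>.\<close>

definition sum_factor :: real where "sum_factor = 3 * (54 * pi * 216) + 12"

text \<open>The constant of \<open>F_le\<close>, from completing the square in
  \<open>(6 + 8 pi) y - pi y^2\<close>.\<close>

definition exp_factor :: real where "exp_factor = exp (2 * pi + (6 + 8 * pi + 1)\<^sup>2 / (4 * pi))"

lemma line_weight_nonneg: "0 \<le> line_weight \<beta>"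
  by (simp add: line_weight_def)

lemma line_weight_le: "line_weight \<beta> \<le> exp ((6 + 8 * pi + 1)\<^sup>2 / (4 * pi)) * exp (- \<bar>\<beta>\<bar>)"
proof -
  have "(1/2 + 2 * \<bar>\<beta>\<bar>) ^ 3 \<le> exp (2 * \<bar>\<beta>\<bar>) ^ 3"
    using exp_ge_add_one_self[of "2 * \<bar>\<beta>\<bar>"] by (intro power_mono) linarith+
  also have "\<dots> = exp (6 * \<bar>\<beta>\<bar>)" by (simp add: exp_of_nat_mult[symmetric])
  finally have "line_weight \<beta> \<le> exp (6 * \<bar>\<beta>\<bar>) * exp (8 * pi * \<bar>\<beta>\<bar> - pi * \<beta>\<^sup>2)"
    unfolding line_weight_def by (intro mult_right_mono) auto
  also have "\<dots> = exp ((6 + 8 * pi) * \<bar>\<beta>\<bar> - pi * \<beta>\<^sup>2)"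
    by (simp add: exp_add[symmetric] algebra_simps)
  also have "\<dots> \<le> exp ((6 + 8 * pi + 1)\<^sup>2 / (4 * pi)) * exp (- \<bar>\<beta>\<bar>)"
    by (rule quadratic_exp_bound) simp
  finally show ?thesis .
qed

lemma integrable_line_weight: "integrable lborel line_weight"
proof (rule Bochner_Integration.integrable_bound)
  show "integrable lborel (\<lambda>\<beta>. exp ((6 + 8 * pi + 1)\<^sup>2 / (4 * pi)) * exp (- \<bar>\<beta>\<bar>))"
    using integrable_exp_minus_abs by simp
  show "line_weight \<in> borel_measurable lborel"
    unfolding line_weight_def[abs_def] by measurable
  show "AE \<beta> in lborel. norm (line_weight \<beta>) \<le> norm (exp ((6 + 8 * pi + 1)\<^sup>2 / (4 * pi)) * exp (- \<bar>\<beta>\<bar>))"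
    using line_weight_le line_weight_nonneg by (intro AE_I2) simp
qed

lemma summable_sum_const: "summable (\<lambda>n. 1 / (1 + real n / 6)\<^sup>2)"
proof (rule summable_comparison_test')
  show "summable (\<lambda>n. 36 * (1 / (real n)\<^sup>2))"
    using summable_mult[of "\<lambda>n. 1 / (real n)\<^sup>2" 36] inverse_power_summable[of 2, where ?'a = real]
    by (simp add: inverse_eq_divide)
  fix n :: nat assume n: "n \<ge> 1"
  have "(real n / 6)\<^sup>2 \<le> (1 + real n / 6)\<^sup>2" by (intro power_mono) auto
  then have "1 / (1 + real n / 6)\<^sup>2 \<le> 1 / (real n / 6)\<^sup>2" using n by (intro divide_left_mono) auto
  then show "norm (1 / (1 + real n / 6)\<^sup>2) \<le> 36 * (1 / (real n)\<^sup>2)" by (simp add: power_divide)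
qed

context saddle
begin

text \<open>
  The steepest path through \<open>\<eta>\<close> meets the real axis at \<open>q\<close>; it is moved by \<open>e\<close> to the middle
  between two integers, where \<open>1 / sin (pi x)\<close> is bounded.
\<close>

definition "N = nat \<lfloor>q\<rfloor>"
definition "e = real N + 1/2 - q"

lemma N_le: "real N \<le> q" and q_less: "q < real N + 1"
  using q_pos by (auto simp: N_def)

lemma e_le: "\<bar>e\<bar> \<le> 1/2" and q_plus_e: "q + e = real N + 1/2"
  using N_le q_less unfolding e_def by linarith+

lemma line_in_HP': "line (real N + 1/2) b \<in> HP"
  using line_in_HP[OF e_le, of b] by (simp only: q_plus_e)

section \<open>Error of the integral\<close>

definition "line_error b = mellin_integrand s (line (real N + 1/2) b) -
  C * (gauss 2 (2 * \<eta>) (line (real N + 1/2) b) / (2 * \<i> * sin (pi * line (real N + 1/2) b)))"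

lemma norm_line_error_le:
  "norm (line_error b) \<le> 81 * pi * exp (2 * pi) / r * norm T * exp (- pi * Im \<eta>) * line_weight (b - Im \<eta>)"
proof -
  define x where "x = line (real N + 1/2) b"
  define \<beta> where "\<beta> = b - Im \<eta>"
  define S where "S = 2 * \<i> * sin (pi * x)"
  have x: "x \<in> HP" unfolding x_def by (rule line_in_HP')
  have "line_error b = T * (exp (H x) - exp (HM x)) * (1 / S)"
    unfolding line_error_def mellin_integrand_def x_def[symmetric] S_def[symmetric] powr_gauss_eq[OF x]
    using C_gauss_2[of x] by (simp add: diff_divide_distrib right_diff_distrib)
  then have "norm (line_error b) = norm T * norm (exp (H x) - exp (HM x)) * norm (1 / S)"
    by (simp only: norm_mult)
  also have "\<dots> \<le> norm T * (54 * pi * norm (x - \<eta>) ^ 3 / r * exp (2 * pi + 7 * pi * \<bar>\<beta>\<bar> - pi * \<beta>\<^sup>2)) * (3 / 2 * exp (- (pi * \<bar>b\<bar>)))"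
  proof (intro mult_mono exp_H_minus_exp_HM x)
    show "exp (Re (H x)) \<le> exp (2 * pi + 7 * pi * \<bar>\<beta>\<bar> - pi * \<beta>\<^sup>2)"
      using Re_H_line_le[OF e_le, of b] by (simp add: x_def \<beta>_def q_plus_e)
    show "exp (Re (HM x)) \<le> exp (2 * pi + 7 * pi * \<bar>\<beta>\<bar> - pi * \<beta>\<^sup>2)"
      using Re_HM_line_le[OF e_le, of b] by (simp add: x_def \<beta>_def q_plus_e)
    show "norm (1 / S) \<le> 3 / 2 * exp (- (pi * \<bar>b\<bar>))"
      unfolding S_def x_def by (rule inverse_sin_half_integer_line_le)
  qed (use r_ge_1 in auto)
  also have "\<dots> \<le> norm T * (54 * pi * (1/2 + 2 * \<bar>\<beta>\<bar>) ^ 3 / r * exp (2 * pi + 7 * pi * \<bar>\<beta>\<bar> - pi * \<beta>\<^sup>2)) * (3 / 2 * exp (- pi * Im \<eta> + pi * \<bar>\<beta>\<bar>))"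
  proof (intro mult_mono divide_right_mono power_mono order_refl)
    have "x - \<eta> = of_real e + (\<i> - 1) * of_real \<beta>"
      using line_minus_\<eta>[of e b] by (simp add: x_def \<beta>_def q_plus_e)
    then have "norm (x - \<eta>) \<le> \<bar>e\<bar> + norm (\<i> - 1) * \<bar>\<beta>\<bar>"
      using norm_triangle_ineq[of "of_real e" "(\<i> - 1) * of_real \<beta>"] by (simp add: norm_mult)
    also have "\<dots> \<le> 1/2 + 2 * \<bar>\<beta>\<bar>"
      using e_le norm_triangle_ineq4[of \<i> 1] by (intro add_mono mult_right_mono) auto
    finally show "norm (x - \<eta>) \<le> 1/2 + 2 * \<bar>\<beta>\<bar>" .
    \<comment> \<open>Trades the decay of \<open>1 / sin\<close> in \<open>b\<close> for the factor
      \<open>exp (- pi * Im \<eta>)\<close> that the main term carries.\<close>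
    have "Im \<eta> - \<bar>\<beta>\<bar> \<le> \<bar>b\<bar>" by (simp add: \<beta>_def)
    then have "pi * (Im \<eta> - \<bar>\<beta>\<bar>) \<le> pi * \<bar>b\<bar>" by (intro mult_left_mono) auto
    then show "exp (- (pi * \<bar>b\<bar>)) \<le> exp (- pi * Im \<eta> + pi * \<bar>\<beta>\<bar>)" by (simp add: algebra_simps)
  qed (use r_ge_1 in auto)
  also have "\<dots> = 81 * pi * exp (2 * pi) / r * norm T * exp (- pi * Im \<eta>) * line_weight \<beta>"
  proof -
    have e1: "exp (2 * pi + 7 * pi * \<bar>\<beta>\<bar> - pi * \<beta>\<^sup>2) * exp (- pi * Im \<eta> + pi * \<bar>\<beta>\<bar>) =
        exp (2 * pi) * exp (- pi * Im \<eta>) * exp (8 * pi * \<bar>\<beta>\<bar> - pi * \<beta>\<^sup>2)"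
      unfolding exp_add[symmetric] by (intro arg_cong[of _ _ exp]) simp
    have "norm T * (54 * pi * (1/2 + 2 * \<bar>\<beta>\<bar>) ^ 3 / r * exp (2 * pi + 7 * pi * \<bar>\<beta>\<bar> - pi * \<beta>\<^sup>2)) * (3 / 2 * exp (- pi * Im \<eta> + pi * \<bar>\<beta>\<bar>))
      = 81 * pi / r * norm T * (1/2 + 2 * \<bar>\<beta>\<bar>) ^ 3 * (exp (2 * pi + 7 * pi * \<bar>\<beta>\<bar> - pi * \<beta>\<^sup>2) * exp (- pi * Im \<eta> + pi * \<bar>\<beta>\<bar>))"
      by simp
    also have "\<dots> = 81 * pi / r * norm T * (1/2 + 2 * \<bar>\<beta>\<bar>) ^ 3 * (exp (2 * pi) * exp (- pi * Im \<eta>) * exp (8 * pi * \<bar>\<beta>\<bar> - pi * \<beta>\<^sup>2))"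
      unfolding e1 ..
    finally show ?thesis by (simp add: line_weight_def)
  qed
  finally show ?thesis by (simp only: \<beta>_def)
qed

lemma continuous_mellin_line: "continuous_on UNIV (\<lambda>b. mellin_integrand s (line (real N + 1/2) b))"
proof -
  have "isCont (\<lambda>y. y powr (s - 1)) y" if "Re y + Im y = real N + 1/2" for y
  proof -
    have "y \<notin> \<real>\<^sub>\<le>\<^sub>0" using that by (auto simp: complex_nonpos_Reals_iff)
    then show ?thesis by (auto intro!: continuous_intros)
  qed
  then have "continuous_on {y. Re y + Im y = real N + 1/2} (\<lambda>y. y powr (s - 1))"
    by (auto intro!: continuous_at_imp_continuous_on)
  then have "continuous_on {y. Re y + Im y = real N + 1/2} (\<lambda>y. y powr (s - 1) * gauss 1 0 y)"
    by (intro continuous_on_mult continuous_gauss)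
  from continuous_half_integer_line_over_sin[OF this] show ?thesis
    by (simp add: mellin_integrand_def)
qed

lemma line_integral_error:
  "norm (line_integral (real N + 1/2) (mellin_integrand s) - C * mordell N 2 (2 * \<eta>)) \<le>
    162 * pi * exp (2 * pi) * line_const / r * (norm T * exp (- pi * Im \<eta>))"
proof -
  define K where "K = 81 * pi * exp (2 * pi) / r * norm T * exp (- pi * Im \<eta>)"
  define m where "m b = gauss 2 (2 * \<eta>) (line (real N + 1/2) b) / (2 * \<i> * sin (pi * line (real N + 1/2) b))" for b
  have intm: "integrable lborel m" unfolding m_def by (rule integrable_mordell) simp
  have intw: "integrable lborel (\<lambda>b. line_weight (b - Im \<eta>))"
    using lborel_integrable_real_affine[OF integrable_line_weight, of 1 "- Im \<eta>"] by (simp add: add.commute)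
  have meas: "line_error \<in> borel_measurable lborel"
  proof -
    have "line_error = (\<lambda>b. mellin_integrand s (line (real N + 1/2) b) - C * m b)"
      by (simp add: fun_eq_iff line_error_def m_def)
    then show ?thesis
      using borel_measurable_continuous_onI[OF continuous_mellin_line] borel_measurable_integrable[OF intm]
      by simp
  qed
  have bound: "norm (line_error b) \<le> K * line_weight (b - Im \<eta>)" for b
    unfolding K_def by (rule norm_line_error_le)
  have interr: "integrable lborel line_error"
    by (rule Bochner_Integration.integrable_bound[OF integrable_mult_right[OF intw, of K] meas])
       (use bound in \<open>auto intro!: AE_I2 order_trans[OF _ abs_ge_self]\<close>)
  have mel: "mellin_integrand s (line (real N + 1/2) b) = line_error b + C * m b" for b
    by (simp add: line_error_def m_def)
  have "line_integral (real N + 1/2) (mellin_integrand s) - C * mordell N 2 (2 * \<eta>) = (\<i> - 1) * (\<integral>b. line_error b \<partial>lborel)"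
    unfolding line_integral_def mordell_def mel m_def[symmetric] using interr intm
    by (simp add: algebra_simps)
  also have "norm \<dots> \<le> 2 * (K * line_const)"
    unfolding norm_mult
  proof (intro mult_mono)
    show "norm (\<i> - 1) \<le> 2" using norm_triangle_ineq4[of \<i> 1] by simp
    have "norm (\<integral>b. line_error b \<partial>lborel) \<le> (\<integral>b. norm (line_error b) \<partial>lborel)" by (rule integral_norm_bound)
    also have "\<dots> \<le> (\<integral>b. K * line_weight (b - Im \<eta>) \<partial>lborel)"
      using interr intw bound by (intro integral_mono) auto
    also have "\<dots> = K * (\<integral>b. line_weight (b - Im \<eta>) \<partial>lborel)" by simp
    also have "(\<integral>b. line_weight (b - Im \<eta>) \<partial>lborel) = line_const"
      unfolding line_const_def by (subst (2) lborel_integral_real_affine[of 1 _ "- Im \<eta>"]) (auto simp: add.commute)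
    finally show "norm (\<integral>b. line_error b \<partial>lborel) \<le> K * line_const" .
  qed auto
  also have "\<dots> = 162 * pi * exp (2 * pi) * line_const / r * (norm T * exp (- pi * Im \<eta>))"
    by (simp add: K_def)
  finally show ?thesis .
qed

section \<open>Error of the sum\<close>

definition "F = exp (2 * pi + 7 * pi * Im \<eta> - pi * (Im \<eta>)\<^sup>2)"

lemma T_nonzero: "T \<noteq> 0" using \<eta>_nonzero by (simp add: T_def)

lemma k_ge_q: "q \<le> k"
proof -
  have "2 * Re \<eta> \<le> 4 * pi * (19/100) * Re \<eta>"
    using pi_gt3 Re_\<eta> by (intro mult_right_mono) auto
  also have "\<dots> \<le> 4 * pi * Im \<eta> * Re \<eta>"
    using Im_\<eta> Re_\<eta> by (intro mult_right_mono mult_left_mono) auto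
  also have "\<dots> = k" by (simp add: k_eq)
  finally show ?thesis using Im_less_Re unfolding q_def by linarith
qed

lemma of_real_in_HP: "u \<ge> 0 \<Longrightarrow> of_real (q + u) \<in> HP"
  by (simp add: HP_def)

text \<open>At real points \<open>gauss 1 0\<close> has modulus 1, so only the power
  remains.\<close>

lemma norm_T_exp_H:
  assumes x: "of_real x \<in> HP" and "x > 0"
  shows "norm T * exp (Re (H (of_real x))) = x powr (- k)"
proof -
  have "norm T * exp (Re (H (of_real x))) = norm (T * exp (H (of_real x)))" by (simp add: norm_mult)
  also have "T * exp (H (of_real x)) = of_real x powr (s - 1) * gauss 1 0 (of_real x)"
    by (rule powr_gauss_eq[OF x, symmetric])
  also have "norm \<dots> = x powr (- k)"
    using \<open>x > 0\<close> by (simp add: norm_mult norm_powr_real_powr k_def gauss_def power2_eq_square)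
  finally show ?thesis .
qed

text \<open>Relative to the value at \<open>q\<close>, which \<open>Re_H_line_le\<close> bounds by
  \<open>F\<close>, the modulus is exactly \<open>(1 + u / q) powr (- k)\<close>. Bernoulli's
  inequality with exponent \<open>k / m\<close>, together with \<open>q \<le> k\<close>, turns this
  into a fixed power of \<open>1 + u / 6\<close>, uniformly in \<eta>.\<close>

lemma exp_Re_H_real:
  assumes u: "u \<ge> 0" and m: "real m \<le> k" "m \<le> 6" "m > 0"
  shows "exp (Re (H (of_real (q + u)))) \<le> F / (1 + u / 6) ^ m"
proof -
  have qu: "q + u > 0" "q > 0" using u q_pos by auto
  have "q + u = q * (1 + u / q)" using qu by (simp add: field_simps)
  then have "norm T * exp (Re (H (of_real (q + u)))) = q powr (- k) * (1 + u / q) powr (- k)"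
    using norm_T_exp_H[OF of_real_in_HP[OF u]] qu u by (metis powr_mult)
  also have "q powr (- k) = norm T * exp (Re (H (of_real q)))"
    using norm_T_exp_H[of q] of_real_in_HP[of 0] qu by simp
  finally have eq: "exp (Re (H (of_real (q + u)))) = exp (Re (H (of_real q))) * (1 + u / q) powr (- k)"
    using T_nonzero by simp
  have "line (q + 0) 0 = of_real q" by (simp add: line_def)
  then have Hq: "exp (Re (H (of_real q))) \<le> F"
    using Re_H_line_le[of 0 0] Im_\<eta> by (simp add: F_def)
  have mpos: "real m > 0" using m by simp
  have "1 + u / 6 \<le> 1 + (k / m) * (u / q)"
  proof -
    have "u / 6 \<le> u / m" using m u by (intro divide_left_mono) auto
    also have "\<dots> = (1 / m) * u * 1" by simp
    also have "\<dots> \<le> (1 / m) * u * (k / q)" using k_ge_q qu u by (intro mult_left_mono) auto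
    finally show ?thesis by (simp add: mult_ac)
  qed
  also have "\<dots> \<le> (1 + u / q) powr (k / m)"
    using u qu m mpos by (intro one_plus_mult_le_powr) auto
  finally have "(1 + u / 6) ^ m \<le> ((1 + u / q) powr (k / m)) ^ m"
    using u by (intro power_mono) auto
  also have "\<dots> = (1 + u / q) powr k"
  proof -
    have "u / q \<ge> 0" using u qu by simp
    then have "(1 + u / q) powr (k / m) > 0" unfolding powr_gt_zero by linarith
    then have "((1 + u / q) powr (k / m)) ^ m = ((1 + u / q) powr (k / m)) powr real m"
      by (rule powr_realpow[symmetric])
    then show ?thesis using mpos by (simp add: powr_powr)
  qed
  finally have "(1 + u / 6) ^ m \<le> (1 + u / q) powr k" .
  then have "1 / (1 + u / q) powr k \<le> 1 / (1 + u / 6) ^ m"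
  proof (intro divide_left_mono mult_pos_pos)
    have "u / q \<ge> 0" using u qu by simp
    then show "0 < (1 + u / q) powr k" unfolding powr_gt_zero by linarith
  qed (use u in auto)
  then have "(1 + u / q) powr (- k) \<le> 1 / (1 + u / 6) ^ m"
    by (simp only: powr_minus inverse_eq_divide)
  then have "exp (Re (H (of_real q))) * (1 + u / q) powr (- k) \<le> F * (1 / (1 + u / 6) ^ m)"
    using Hq by (intro mult_mono) (auto simp: F_def)
  then show ?thesis unfolding eq by simp
qed

text \<open>The model decays like \<open>exp (- 4 pi Im \<eta> u)\<close>; it is weakened to the
  shape of the bound for \<open>H\<close>.\<close>

lemma exp_Re_HM_real:
  assumes u: "u \<ge> 0" and m: "m \<le> 6"
  shows "exp (Re (HM (of_real (q + u)))) \<le> F / (1 + u / 6) ^ m"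
proof -
  have "Re (HM (of_real (q + u))) = - 4 * pi * (Im \<eta>)\<^sup>2 - 4 * pi * Im \<eta> * u"
  proof -
    have "complex_of_real (q + u) - \<eta> = Complex (u + Im \<eta>) (- Im \<eta>)" by (simp add: complex_eq_iff q_def)
    then have "Re (HM (of_real (q + u))) = 4 * pi * ((u + Im \<eta>) * - Im \<eta>)"
      by (simp add: HM_def power2_eq_square)
    then show ?thesis by (simp add: power2_eq_square algebra_simps)
  qed
  also have "\<dots> \<le> (2 * pi + 7 * pi * Im \<eta> - pi * (Im \<eta>)\<^sup>2) - 2 * u"
  proof -
    have "2 * u \<le> 4 * pi * (19/100) * u" using pi_gt3 u by (intro mult_right_mono) auto
    also have "\<dots> \<le> 4 * pi * Im \<eta> * u" using Im_\<eta> u by (intro mult_right_mono mult_left_mono) auto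
    finally have "2 * u \<le> 4 * pi * Im \<eta> * u" .
    moreover have "pi * (Im \<eta>)\<^sup>2 \<le> 4 * pi * (Im \<eta>)\<^sup>2" by (intro mult_right_mono) auto
    moreover have "0 \<le> 7 * pi * Im \<eta>" using Im_\<eta> by simp
    moreover have "- X - Y \<le> (P + Z - W) - V" if "V \<le> Y" "W \<le> X" "0 \<le> Z" "0 \<le> P" for X Y Z W V P :: real
      using that by linarith
    moreover have "0 \<le> 2 * pi" by simp
    ultimately have "- (4 * pi * (Im \<eta>)\<^sup>2) - 4 * pi * Im \<eta> * u \<le> (2 * pi + 7 * pi * Im \<eta> - pi * (Im \<eta>)\<^sup>2) - 2 * u"
      by blast
    then show ?thesis by simp
  qed
  finally have "exp (Re (HM (of_real (q + u)))) \<le> F * exp (- (2 * u))"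
    unfolding F_def exp_add[symmetric] by simp
  also have "\<dots> \<le> F * (1 / (1 + u / 6) ^ m)"
  proof (rule mult_left_mono)
    have "(1 + u / 6) ^ m \<le> exp (u / 6) ^ m"
      using u exp_ge_add_one_self[of "u / 6"] by (intro power_mono) auto
    also have "\<dots> = exp (real m * (u / 6))" by (simp add: exp_of_nat_mult[symmetric])
    also have "\<dots> \<le> exp (2 * u)"
    proof -
      have "real m * (u / 6) \<le> 6 * (u / 6)" using m u by (intro mult_right_mono) auto
      then show ?thesis using u by simp
    qed
    finally have "(1 + u / 6) ^ m \<le> exp (2 * u)" .
    then have "1 / exp (2 * u) \<le> 1 / (1 + u / 6) ^ m"
      using u by (intro divide_left_mono mult_pos_pos) auto
    then show "exp (- (2 * u)) \<le> 1 / (1 + u / 6) ^ m" by (simp only: exp_minus inverse_eq_divide)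
  qed (simp add: F_def)
  finally show ?thesis by simp
qed

text \<open>
  For \<open>k < 6\<close> the terms decay too slowly to sum the cubic Taylor error, but then \<open>Im s\<close> is bounded
  and the triangle inequality is enough.
\<close>

lemma exp_H_minus_exp_HM_real:
  assumes u: "u \<ge> 0"
  shows "norm (exp (H (of_real (q + u))) - exp (HM (of_real (q + u)))) \<le>
    sum_factor / sqrt (Im s) * ((1 + 2 * Im \<eta>) ^ 3 * F) * (1 / (1 + u / 6)\<^sup>2)"
proof -
  define x where "x = complex_of_real (q + u)"
  define w where "w = 1 + u / 6"
  have w: "w \<ge> 1" using u by (simp add: w_def)
  have x: "x \<in> HP" unfolding x_def by (rule of_real_in_HP[OF u])
  have F0: "F > 0" by (simp add: F_def)
  have t0: "sqrt (Im s) > 0" using t_ge_1 by simp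
  have V1: "1 \<le> (1 + 2 * Im \<eta>) ^ 3" using Im_\<eta> by (intro one_le_power) auto
  show ?thesis
  proof (cases "k \<ge> 6")
    case True
    \<comment> \<open>The cube of \<open>norm (x - \<eta>)\<close> grows like \<open>w ^ 3\<close>;
      the exponent 6 leaves \<open>w ^ 3\<close> in the denominator, enough to sum.\<close>
    have "norm (exp (H x) - exp (HM x)) \<le> 54 * pi * norm (x - \<eta>) ^ 3 / r * (F / w ^ 6)"
      unfolding x_def w_def
      using True u by (intro exp_H_minus_exp_HM of_real_in_HP exp_Re_H_real exp_Re_HM_real) auto
    also have "\<dots> \<le> 54 * pi * (216 * (1 + 2 * Im \<eta>) ^ 3 * w ^ 3) * (3 / sqrt (Im s)) * (F / w ^ 6)"
    proof -
      have "norm (x - \<eta>) \<le> \<bar>Re (x - \<eta>)\<bar> + \<bar>Im (x - \<eta>)\<bar>" by (rule cmod_le)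
      also have "\<dots> = u + 2 * Im \<eta>" using u Im_\<eta> by (simp add: x_def q_def)
      also have "\<dots> \<le> 6 * (1 + 2 * Im \<eta>) * w"
        using u Im_\<eta> by (simp add: w_def algebra_simps)
      finally have "norm (x - \<eta>) ^ 3 \<le> (6 * (1 + 2 * Im \<eta>) * w) ^ 3" by (intro power_mono) auto
      also have "\<dots> = 216 * (1 + 2 * Im \<eta>) ^ 3 * w ^ 3" by (simp only: power_mult_distrib) simp
      finally have v3: "norm (x - \<eta>) ^ 3 \<le> 216 * (1 + 2 * Im \<eta>) ^ 3 * w ^ 3" .
      have "54 * pi * norm (x - \<eta>) ^ 3 * (1 / r) \<le> 54 * pi * (216 * (1 + 2 * Im \<eta>) ^ 3 * w ^ 3) * (3 / sqrt (Im s))"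
        using v3 inverse_r_le r_ge_1 w Im_\<eta> by (intro mult_mono mult_left_mono) auto
      then show ?thesis using F0 w by (intro mult_right_mono) auto
    qed
    also have "\<dots> = 3 * (54 * pi * 216) / sqrt (Im s) * ((1 + 2 * Im \<eta>) ^ 3 * F) * (w ^ 3 / w ^ 6)"
      by simp
    also have "\<dots> \<le> sum_factor / sqrt (Im s) * ((1 + 2 * Im \<eta>) ^ 3 * F) * (1 / w\<^sup>2)"
    proof (intro mult_mono divide_right_mono order_refl)
      have w6: "w ^ 6 = w ^ 3 * w ^ 3" by (simp add: power_add[symmetric])
      have "z / (z * z) = 1 / z" if "z \<noteq> 0" for z :: real using that by simp
      from this[of "w ^ 3"] have "w ^ 3 / w ^ 6 = 1 / w ^ 3" unfolding w6 using w by simp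
      also have "\<dots> \<le> 1 / w\<^sup>2" using w by (intro divide_left_mono power_increasing) auto
      finally show "w ^ 3 / w ^ 6 \<le> 1 / w\<^sup>2" .
    qed (use w F0 t0 Im_\<eta> in \<open>auto simp: sum_factor_def intro!: mult_nonneg_nonneg divide_nonneg_nonneg\<close>)
    finally show ?thesis by (simp add: x_def w_def)
  next
    case False
    have k2: "real 2 \<le> k" using k_ge_2 by (simp add: k_def)
    have "norm (exp (H x) - exp (HM x)) \<le> norm (exp (H x)) + norm (exp (HM x))" by (rule norm_triangle_ineq4)
    also have "\<dots> \<le> F / w ^ 2 + F / w ^ 2"
      unfolding norm_exp_eq_Re x_def w_def
      by (intro add_mono exp_Re_H_real exp_Re_HM_real u) (use k2 in auto)
    also have "\<dots> = 2 * 1 * F * (1 / w\<^sup>2)" by simp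
    also have "\<dots> \<le> 2 * (6 / sqrt (Im s) * (1 + 2 * Im \<eta>) ^ 3) * F * (1 / w\<^sup>2)"
    proof (intro mult_right_mono mult_left_mono)
      \<comment> \<open>Here \<open>Im s \<le> k^2 \<le> 36\<close>, so a factor
        \<open>6 / sqrt (Im s)\<close> can be inserted for free.\<close>
      have "k\<^sup>2 \<le> 6\<^sup>2" using False k2 by (intro power_mono) auto
      then have "sqrt (Im s) \<le> 6" using t_le by (intro real_le_lsqrt) (auto simp: k_def)
      then have "1 \<le> 6 / sqrt (Im s)" using t0 by simp
      then have "1 * 1 \<le> 6 / sqrt (Im s) * (1 + 2 * Im \<eta>) ^ 3" using V1 t_ge_1 by (intro mult_mono) auto
      then show "1 \<le> 6 / sqrt (Im s) * (1 + 2 * Im \<eta>) ^ 3" by simp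
    qed (use F0 in auto)
    also have "\<dots> = 12 / sqrt (Im s) * ((1 + 2 * Im \<eta>) ^ 3 * F) * (1 / w\<^sup>2)" by simp
    also have "\<dots> \<le> sum_factor / sqrt (Im s) * ((1 + 2 * Im \<eta>) ^ 3 * F) * (1 / w\<^sup>2)"
      using F0 t0 w Im_\<eta>
      by (intro mult_right_mono divide_right_mono) (auto simp: sum_factor_def intro!: mult_nonneg_nonneg)
    finally show ?thesis by (simp add: x_def w_def)
  qed
qed

text \<open>The Gaussian factor of \<open>F\<close> beats the cube,
  \<open>exp (7 pi Im \<eta>)\<close> and the further \<open>exp (pi Im \<eta>)\<close> needed to
  match the size of the main term.\<close>

lemma F_le: "(1 + 2 * Im \<eta>) ^ 3 * F \<le> exp_factor * exp (- pi * Im \<eta>)"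
proof -
  have "(1 + 2 * Im \<eta>) ^ 3 \<le> exp (2 * Im \<eta>) ^ 3"
    using exp_ge_add_one_self[of "2 * Im \<eta>"] Im_\<eta> by (intro power_mono) auto
  also have "\<dots> = exp (6 * Im \<eta>)" by (simp add: exp_of_nat_mult[symmetric])
  finally have "(1 + 2 * Im \<eta>) ^ 3 * F \<le> exp (6 * Im \<eta>) * F" by (intro mult_right_mono) (auto simp: F_def)
  also have "\<dots> = exp (2 * pi) * exp (- pi * Im \<eta>) * exp ((6 + 8 * pi) * \<bar>Im \<eta>\<bar> - pi * (Im \<eta>)\<^sup>2)"
    using Im_\<eta> unfolding F_def exp_add[symmetric] by (simp add: algebra_simps)
  also have "\<dots> \<le> exp (2 * pi) * exp (- pi * Im \<eta>) * (exp ((6 + 8 * pi + 1)\<^sup>2 / (4 * pi)) * exp (- \<bar>Im \<eta>\<bar>))"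
    by (intro mult_left_mono quadratic_exp_bound) auto
  also have "\<dots> \<le> exp (2 * pi) * exp (- pi * Im \<eta>) * (exp ((6 + 8 * pi + 1)\<^sup>2 / (4 * pi)) * 1)"
    by (intro mult_left_mono) auto
  also have "\<dots> = exp_factor * exp (- pi * Im \<eta>)" by (simp add: exp_factor_def exp_add)
  finally show ?thesis .
qed

definition "sum_error n = of_nat (n + N + 1) powr (s - 1) - C * gauss 1 (2 * \<eta>) (of_nat (n + N + 1))"

lemma norm_sum_error_le:
  "norm (sum_error n) \<le> sum_factor * exp_factor / sqrt (Im s) * (norm T * exp (- pi * Im \<eta>)) * (1 / (1 + real n / 6)\<^sup>2)"
proof -
  define u where "u = real (n + N + 1) - q"
  have u: "u \<ge> real n" "u \<ge> 0" using q_less by (auto simp: u_def)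
  have x: "complex_of_nat (n + N + 1) = of_real (q + u)" by (simp add: u_def)
  have hp: "complex_of_real (q + u) \<in> HP" by (rule of_real_in_HP[OF u(2)])
  have g1: "norm (gauss 1 0 (complex_of_nat (n + N + 1))) = 1"
    using gauss_of_nat[of 1 0 "n + N + 1"] by (simp add: norm_power)
  \<comment> \<open>The inserted factor is 1 or -1 at integers. It gives the terms the form
    \<open>T * exp (H x)\<close> already estimated.\<close>
  have "norm (sum_error n) = norm (sum_error n * gauss 1 0 (complex_of_nat (n + N + 1)))"
    unfolding norm_mult g1 by simp
  also have "sum_error n * gauss 1 0 (complex_of_nat (n + N + 1)) = T * (exp (H (of_real (q + u))) - exp (HM (of_real (q + u))))"
    unfolding sum_error_def left_diff_distrib x powr_gauss_eq[OF hp] C_gauss_1 by (simp only: right_diff_distrib)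
  also have "norm \<dots> \<le> norm T * (sum_factor / sqrt (Im s) * ((1 + 2 * Im \<eta>) ^ 3 * F) * (1 / (1 + u / 6)\<^sup>2))"
    unfolding norm_mult by (intro mult_left_mono exp_H_minus_exp_HM_real u) auto
  also have "\<dots> \<le> norm T * (sum_factor / sqrt (Im s) * (exp_factor * exp (- pi * Im \<eta>)) * (1 / (1 + real n / 6)\<^sup>2))"
  proof (intro mult_left_mono mult_mono[OF mult_left_mono[OF F_le]])
    have "(1 + real n / 6)\<^sup>2 \<le> (1 + u / 6)\<^sup>2" using u by (intro power_mono) auto
    then show "1 / (1 + u / 6)\<^sup>2 \<le> 1 / (1 + real n / 6)\<^sup>2"
      using u by (intro divide_left_mono mult_pos_pos) auto
  qed (use t_ge_1 in \<open>auto simp: sum_factor_def exp_factor_def intro!: mult_nonneg_nonneg divide_nonneg_nonneg\<close>)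
  also have "\<dots> = sum_factor * exp_factor / sqrt (Im s) * (norm T * exp (- pi * Im \<eta>)) * (1 / (1 + real n / 6)\<^sup>2)"
    by simp
  finally show ?thesis .
qed

lemma sum_error_bound:
  "norm (\<Sum>n. sum_error n) \<le> sum_factor * exp_factor * sum_const / sqrt (Im s) * (norm T * exp (- pi * Im \<eta>))"
proof -
  define K where "K = sum_factor * exp_factor / sqrt (Im s) * (norm T * exp (- pi * Im \<eta>))"
  have b: "norm (sum_error n) \<le> K * (1 / (1 + real n / 6)\<^sup>2)" for n
    unfolding K_def by (rule norm_sum_error_le)
  have s: "summable (\<lambda>n. K * (1 / (1 + real n / 6)\<^sup>2))" by (intro summable_mult summable_sum_const)
  have sn: "summable (\<lambda>n. norm (sum_error n))"
    by (rule summable_comparison_test'[OF s, of 0]) (use b in simp)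
  have "norm (\<Sum>n. sum_error n) \<le> (\<Sum>n. norm (sum_error n))" by (rule summable_norm[OF sn])
  also have "\<dots> \<le> (\<Sum>n. K * (1 / (1 + real n / 6)\<^sup>2))" by (rule suminf_le[OF b sn s])
  also have "\<dots> = K * sum_const" unfolding sum_const_def by (rule suminf_mult[OF summable_sum_const])
  also have "\<dots> = sum_factor * exp_factor * sum_const / sqrt (Im s) * (norm T * exp (- pi * Im \<eta>))"
    by (simp add: K_def)
  finally show ?thesis .
qed

end

section \<open>The asymptotic formula\<close>

text \<open>The 8 comes from \<open>norm_G_ge\<close>, the 3 from
  \<open>inverse_r_le\<close>.\<close>

definition error_const :: real where
  "error_const = 8 * (3 * (162 * pi * exp (2 * pi) * line_const) + sum_factor * exp_factor * sum_const)"

context saddle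
begin

definition "G = sqrt 2 * exp (3 * pi * \<i> / 8) * sin (pi * \<eta>) / (2 * cos (2 * pi * \<eta>))"

text \<open>The sine is at least \<open>exp (pi Im \<eta>) / 4\<close> and the cosine at most
  \<open>exp (2 pi Im \<eta>)\<close>. The former needs \<open>Im \<eta>\<close> bounded below,
  since the zeros of the sine are real.\<close>

lemma norm_G_ge: "exp (- pi * Im \<eta>) / 8 \<le> norm G"
proof -
  have cc: "norm (cos (2 * pi * \<eta>)) \<le> exp (2 * pi * Im \<eta>)"
  proof -
    have "2 * cos (2 * pi * \<eta>) = exp (\<i> * (2 * pi * \<eta>)) + exp (- (\<i> * (2 * pi * \<eta>)))"
      by (simp add: cos_exp_eq)
    then have "norm (2 * cos (2 * pi * \<eta>)) \<le> norm (exp (\<i> * (2 * pi * \<eta>))) + norm (exp (- (\<i> * (2 * pi * \<eta>))))"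
      by (metis norm_triangle_ineq)
    also have "\<dots> = exp (- (2 * pi * Im \<eta>)) + exp (2 * pi * Im \<eta>)" by simp
    also have "\<dots> \<le> exp (2 * pi * Im \<eta>) + exp (2 * pi * Im \<eta>)" using Im_\<eta> by simp
    finally show ?thesis by (simp add: norm_mult)
  qed
  have c0: "cos (2 * pi * \<eta>) \<noteq> 0"
  proof
    assume "cos (2 * pi * \<eta>) = 0"
    then obtain n :: int where "complex_of_real (2 * pi) * \<eta> = of_real (n * pi) + of_real pi / 2"
      by (auto simp: cos_eq_0)
    then have "Im (complex_of_real (2 * pi) * \<eta>) = Im (of_real (n * pi) + of_real pi / 2)" by (rule arg_cong)
    then show False using Im_\<eta> by simp
  qed
  have "exp (pi * Im \<eta>) / 4 \<le> sinh (pi * Im \<eta>)"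
  proof -
    have "1 \<le> 2 * (pi * Im \<eta>)"
    proof -
      have "3 * (19/100) \<le> pi * Im \<eta>" using Im_\<eta> pi_gt3 by (intro mult_mono) auto
      then show ?thesis by simp
    qed
    then have "2 \<le> exp (2 * (pi * Im \<eta>))" using exp_ge_add_one_self[of "2 * (pi * Im \<eta>)"] by linarith
    also have "\<dots> = exp (pi * Im \<eta>) * exp (pi * Im \<eta>)" by (simp add: exp_add[symmetric])
    finally have "2 * inverse (exp (pi * Im \<eta>)) \<le> exp (pi * Im \<eta>)" by (simp add: field_simps)
    then show ?thesis by (simp add: sinh_field_def exp_minus)
  qed
  also have "\<dots> \<le> norm (sin (pi * \<eta>))" using norm_sin_ge_sinh[of "pi * \<eta>"] by simp
  finally have ss: "exp (pi * Im \<eta>) / 4 \<le> norm (sin (pi * \<eta>))" .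
  have "exp (- pi * Im \<eta>) / 8 = 1 * (exp (pi * Im \<eta>) / 4) / (2 * exp (2 * pi * Im \<eta>))"
    by (simp add: exp_minus exp_double field_simps power2_eq_square flip: exp_add)
  also have "\<dots> \<le> sqrt 2 * norm (sin (pi * \<eta>)) / (2 * norm (cos (2 * pi * \<eta>)))"
    using ss cc c0 by (intro frac_le mult_mono) auto
  also have "\<dots> = norm G"
  proof -
    have "norm (exp (3 * pi * \<i> / 8)) = 1" by simp
    then show ?thesis unfolding G_def norm_mult norm_divide by simp
  qed
  finally show ?thesis .
qed

theorem riemann_aux_saddle:
  "\<exists>U. riemann_aux s = - chi s * (T * G) * (1 + U) \<and> norm U \<le> error_const / sqrt (Im s)"
proof -
  define J where "J = line_integral (real N + 1/2) (mellin_integrand s)"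
  define Z where "Z = (\<Sum>n. complex_of_nat (n + N + 1) powr (s - 1))"
  define M where "M = (\<Sum>n. gauss 1 (2 * \<eta>) (of_nat (n + N + 1)))"
  define E where "E = (\<Sum>n. sum_error n) + (J - C * mordell N 2 (2 * \<eta>))"
  \<comment> \<open>\<open>k_ge_2\<close> is precisely the range in which the exact formula has been
    proved.\<close>
  have s1: "Re s \<le> -1" using k_ge_2 by simp
  have t0: "Im s \<noteq> 0" using t_ge_1 by simp
  have I0: "Im \<eta> > 0" using Im_\<eta> by simp
  have "(\<Sum>n. sum_error n) = Z - C * M"
    unfolding sum_error_def Z_def M_def
    using mellin_geometric(1)[OF s1, of N] mordell_gauss_2(1)[OF I0, of N]
    by (subst suminf_diff[symmetric]) (auto simp: suminf_mult intro: summable_mult)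
  then have ZJ: "Z + J = C * (M + mordell N 2 (2 * \<eta>)) + E"
    by (simp add: E_def algebra_simps)
  have "C * (M + mordell N 2 (2 * \<eta>)) = - (C * exp (2 * pi * \<i> * \<eta>\<^sup>2) * G)"
    unfolding M_def mordell_gauss_2(2)[OF I0] G_def by simp
  also have "\<dots> = - (T * G)" unfolding C_exp ..
  finally have main: "Z + J = - (T * G) + E" using ZJ by simp
  have R: "riemann_aux s = chi s * (Z + J)"
    unfolding Z_def J_def by (rule riemann_aux_eq[OF s1 t0])
  have "norm E \<le> sum_factor * exp_factor * sum_const / sqrt (Im s) * (norm T * exp (- pi * Im \<eta>)) +
      162 * pi * exp (2 * pi) * line_const / r * (norm T * exp (- pi * Im \<eta>))"
    unfolding E_def J_def by (rule order_trans[OF norm_triangle_ineq add_mono[OF sum_error_bound line_integral_error]])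
  also have "\<dots> \<le> sum_factor * exp_factor * sum_const / sqrt (Im s) * (norm T * exp (- pi * Im \<eta>)) +
      162 * pi * exp (2 * pi) * line_const * (3 / sqrt (Im s)) * (norm T * exp (- pi * Im \<eta>))"
  proof (intro add_left_mono mult_right_mono)
    have "line_const \<ge> 0" unfolding line_const_def by (intro integral_nonneg_AE AE_I2 line_weight_nonneg)
    then have "162 * pi * exp (2 * pi) * line_const * (1 / r) \<le> 162 * pi * exp (2 * pi) * line_const * (3 / sqrt (Im s))"
      using inverse_r_le by (intro mult_left_mono) auto
    then show "162 * pi * exp (2 * pi) * line_const / r \<le> 162 * pi * exp (2 * pi) * line_const * (3 / sqrt (Im s))" by simp
  qed auto
  also have "\<dots> = error_const / sqrt (Im s) * (norm T * (exp (- pi * Im \<eta>) / 8))"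
  proof -
    have "a / t * w + b * (3 / t) * w = 8 * (3 * b + a) / t * (w / 8)" for a b t w :: real
      by (simp add: add_divide_distrib distrib_left distrib_right)
    then show ?thesis unfolding error_const_def times_divide_eq_right[of "norm T"] .
  qed
  also have "\<dots> \<le> error_const / sqrt (Im s) * (norm T * norm G)"
  proof (intro mult_left_mono norm_G_ge)
    have "line_const \<ge> 0" unfolding line_const_def by (intro integral_nonneg_AE AE_I2 line_weight_nonneg)
    moreover have "sum_const \<ge> 0" unfolding sum_const_def by (intro suminf_nonneg summable_sum_const) auto
    ultimately show "0 \<le> error_const / sqrt (Im s)"
      using t_ge_1 by (auto simp: error_const_def sum_factor_def exp_factor_def)
  qed auto
  finally have nE: "norm E \<le> error_const / sqrt (Im s) * norm (T * G)" by (simp add: norm_mult)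
  have "norm G > 0" using norm_G_ge by (rule less_le_trans[rotated]) simp
  then have TG: "T * G \<noteq> 0" using T_nonzero by auto
  define U where "U = - (E / (T * G))"
  have "norm U \<le> error_const / sqrt (Im s)"
    using nE TG by (simp add: U_def norm_divide pos_divide_le_eq)
  moreover have "riemann_aux s = - chi s * (T * G) * (1 + U)"
  proof -
    have "T * G * (1 + U) = T * G - E" using TG by (simp add: U_def right_diff_distrib)
    then have "Z + J = - (T * G * (1 + U))" unfolding main by simp
    then show ?thesis unfolding R by (simp add: mult.assoc)
  qed
  ultimately show ?thesis by blast
qed

end

section \<open>From the domain to the saddle point hypotheses\<close>

lemma eta_eq_csqrt:
  assumes "Im s > 0"
  shows "eta s = csqrt ((s - 1) / (2 * pi * \<i>))" and "Re (eta s) > 0"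
proof -
  define z where "z = (s - 1) / (2 * pi * \<i>)"
  have Rz: "Re z = Im s / (2 * pi)" by (simp add: z_def Re_divide power2_eq_square)
  then have z: "Re z > 0" using assms by simp
  have c: "(csqrt z)\<^sup>2 = z" "Re (csqrt z) > 0"
  proof -
    show "(csqrt z)\<^sup>2 = z" by simp
    then have "Re z = (Re (csqrt z))\<^sup>2 - (Im (csqrt z))\<^sup>2"
      using Re_power2[of "csqrt z"] by (simp only:)
    then have "(Re (csqrt z))\<^sup>2 > 0"
      using z zero_le_power2[of "Im (csqrt z)"] by linarith
    then have "Re (csqrt z) \<noteq> 0" unfolding zero_less_power2 .
    then show "Re (csqrt z) > 0" using csqrt_principal[of z] by auto
  qed
  \<comment> \<open>A square with positive real part has roots with \<open>|Im| < |Re|\<close>, so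
    the sign condition on \<open>Re + Im\<close> selects the principal root.\<close>
  have pos: "Re (csqrt z) + Im (csqrt z) > 0"
  proof -
    have "Re z = (Re (csqrt z))\<^sup>2 - (Im (csqrt z))\<^sup>2"
      using Re_power2[of "csqrt z"] unfolding c(1) .
    then have "(Im (csqrt z))\<^sup>2 < (Re (csqrt z))\<^sup>2" using z by linarith
    then have "\<bar>Im (csqrt z)\<bar>\<^sup>2 < \<bar>Re (csqrt z)\<bar>\<^sup>2" by (simp only: power2_abs)
    then have "\<bar>Im (csqrt z)\<bar> < \<bar>Re (csqrt z)\<bar>" by (rule power2_less_imp_less) simp
    then show ?thesis using c(2) by simp
  qed
  have "eta s = csqrt z"
    unfolding eta_def z_def[symmetric]
  proof (rule the_equality)
    show "(csqrt z)\<^sup>2 = z \<and> 0 < Re (csqrt z) + Im (csqrt z)" using c pos by simp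
    fix w assume w: "w\<^sup>2 = z \<and> 0 < Re w + Im w"
    then have "w\<^sup>2 = (csqrt z)\<^sup>2" using c by simp
    then have "w = csqrt z \<or> w = - csqrt z" unfolding power2_eq_iff .
    then show "w = csqrt z"
    proof
      assume m: "w = - csqrt z"
      have "Re w + Im w = - (Re (csqrt z) + Im (csqrt z))"
        unfolding m uminus_complex.sel by (simp only: minus_add_distrib)
      then show ?thesis using pos w by linarith
    qed
  qed
  then show "eta s = csqrt ((s - 1) / (2 * pi * \<i>))" "Re (eta s) > 0" using c by (auto simp: z_def)
qed

lemma saddle_Omega1:
  assumes \<delta>: "\<delta> > 1/2" and s: "s \<in> Omega1 \<epsilon> \<delta>"
  shows "saddle s (eta s)"
proof -
  define \<eta> where "\<eta> = eta s"
  define t where "t = Im s"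
  define k where "k = 1 - Re s"
  have t: "t \<ge> 1" and kt: "k \<ge> t powr \<delta>" "t powr \<delta> \<ge> 2" and n: "norm (s - 1) \<ge> 4 * pi"
    using s by (auto simp: Omega1_def Omega_def t_def k_def)
  have k2: "k \<ge> 2" using kt by simp
  \<comment> \<open>This is where \<open>\<delta> > 1/2\<close> enters.\<close>
  have "sqrt t \<le> k"
  proof -
    have "sqrt t = t powr (1/2)" using t by (simp add: powr_half_sqrt)
    also have "\<dots> \<le> t powr \<delta>" using t \<delta> by (intro powr_mono) auto
    finally show ?thesis using kt by simp
  qed
  then have "(sqrt t)\<^sup>2 \<le> k\<^sup>2" using t by (intro power_mono) auto
  then have tk: "t \<le> k\<^sup>2" using t by simp
  have "\<eta>\<^sup>2 = (s - 1) / (2 * pi * \<i>)" and Rp: "Re \<eta> > 0"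
    using eta_eq_csqrt[of s] t by (simp_all add: \<eta>_def t_def)
  then have se: "s - 1 = 2 * pi * \<i> * \<eta>\<^sup>2" by simp
  define x y where "x = Re \<eta>" and "y = Im \<eta>"
  have Re1: "k = 4 * pi * (x * y)"
  proof -
    have "Re (s - 1) = Re (2 * pi * \<i> * \<eta>\<^sup>2)" by (simp only: se)
    then show ?thesis by (simp add: k_def x_def y_def power2_eq_square algebra_simps)
  qed
  have Im1: "t = 2 * pi * (x\<^sup>2 - y\<^sup>2)"
  proof -
    have "Im (s - 1) = Im (2 * pi * \<i> * \<eta>\<^sup>2)" by (simp only: se)
    then show ?thesis by (simp add: t_def x_def y_def power2_eq_square algebra_simps)
  qed
  have x0: "x > 0" using Rp by (simp add: x_def)
  have "0 < 4 * pi * (x * y)" using Re1 k2 by simp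
  then have "0 < x * y" by (rule zero_less_mult_pos) simp
  then have y0: "y > 0" by (rule zero_less_mult_pos[OF _ x0])
  have xy: "y\<^sup>2 < x\<^sup>2"
  proof -
    have "0 < 2 * pi * (x\<^sup>2 - y\<^sup>2)" using Im1 t by simp
    then show ?thesis by (simp add: zero_less_mult_iff)
  qed
  then have yx: "y < x" using x0 by (simp add: power_less_imp_less_base)
  have x1: "x \<ge> 1"
  proof -
    have "4 * pi \<le> 2 * pi * (x\<^sup>2 + y\<^sup>2)"
    proof -
      have "norm (s - 1) = 2 * pi * (norm \<eta>)\<^sup>2" unfolding se by (simp add: norm_mult norm_power)
      then show ?thesis using n by (simp add: cmod_power2 x_def y_def)
    qed
    then have "4 * pi \<le> (2 * (x\<^sup>2 + y\<^sup>2)) * pi" by (simp add: mult_ac)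
    then have "4 \<le> 2 * (x\<^sup>2 + y\<^sup>2)" by (rule mult_right_le_imp_le) simp
    then have "1\<^sup>2 \<le> x\<^sup>2" using xy by simp
    then show ?thesis by (rule power2_le_imp_le) (use x0 in simp)
  qed
  \<comment> \<open>The inequality \<open>t \<le> k^2\<close> reads
    \<open>x^2 - y^2 \<le> 8 pi x^2 y^2\<close>. If \<open>y < 19/100\<close>, then
    \<open>8 pi y^2 < 0.91\<close>, which forces \<open>x^2 < 1\<close>.\<close>
  have "y \<ge> 19/100"
  proof (rule ccontr)
    assume "\<not> y \<ge> 19/100"
    then have "y\<^sup>2 \<le> (19/100)\<^sup>2" using y0 by (intro power_mono) auto
    then have y2: "y\<^sup>2 \<le> 361/10000" by (simp add: power2_eq_square)
    have "2 * pi * (x\<^sup>2 - y\<^sup>2) \<le> 2 * pi * (8 * pi * (x\<^sup>2 * y\<^sup>2))"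
    proof -
      have "(4 * pi * (x * y))\<^sup>2 = 2 * pi * (8 * pi * (x\<^sup>2 * y\<^sup>2))"
        by (simp add: power_mult_distrib) (simp add: power2_eq_square)
      then show ?thesis using tk unfolding Im1 Re1 by (simp only:)
    qed
    then have "x\<^sup>2 - y\<^sup>2 \<le> 8 * pi * (x\<^sup>2 * y\<^sup>2)" by (rule mult_left_le_imp_le) simp
    also have "\<dots> \<le> (8 * 3.15) * (x\<^sup>2 * (361/10000))"
      using y2 pi_approx by (intro mult_mono) auto
    finally have "x\<^sup>2 \<le> 361/10000 + (8 * 3.15) * (x\<^sup>2 * (361/10000))" using y2 by simp
    moreover have "1\<^sup>2 \<le> x\<^sup>2" using x1 by (intro power_mono) auto
    ultimately show False by simp
  qed
  then show ?thesis
    using se x1 yx k2 t tk by unfold_locales (auto simp: \<eta>_def x_def y_def k_def t_def)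
qed

theorem theorem6:
  shows "\<exists>A::real. \<forall>\<epsilon> \<delta> :: real. 0 < \<epsilon> \<and> \<epsilon> < 1/2 \<and> \<delta> > 1/2 \<longrightarrow>
    (\<forall>s \<in> Omega1 \<epsilon> \<delta>. \<exists>U::complex.
       riemann_aux s =
         - chi s * eta s powr (s - 1) * exp (- (pi * \<i> * (eta s)\<^sup>2))
           * (sqrt 2 * exp (3 * pi * \<i> / 8) * sin (pi * eta s) / (2 * cos (2 * pi * eta s)))
           * (1 + U)
       \<and> cmod U \<le> A * Im s powr (-1/2))"
proof (intro exI[of _ error_const] allI impI ballI)
  fix \<epsilon> \<delta> :: real and s
  assume \<delta>: "0 < \<epsilon> \<and> \<epsilon> < 1/2 \<and> \<delta> > 1/2" and s: "s \<in> Omega1 \<epsilon> \<delta>"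
  interpret saddle s "eta s" by (rule saddle_Omega1[OF _ s]) (use \<delta> in simp)
  obtain U where U: "riemann_aux s = - chi s * (T * G) * (1 + U)" "norm U \<le> error_const / sqrt (Im s)"
    using riemann_aux_saddle by blast
  have "Im s powr (-1/2) = 1 / sqrt (Im s)"
    using t_ge_1 powr_minus[of "Im s" "1/2"] by (simp add: powr_half_sqrt inverse_eq_divide)
  then have "norm U \<le> error_const * Im s powr (-1/2)" using U(2) by simp
  moreover have "riemann_aux s =
         - chi s * eta s powr (s - 1) * exp (- (pi * \<i> * (eta s)\<^sup>2))
           * (sqrt 2 * exp (3 * pi * \<i> / 8) * sin (pi * eta s) / (2 * cos (2 * pi * eta s)))
           * (1 + U)"
    unfolding U(1) T_def G_def by (simp only: mult.assoc)
  ultimately show "\<exists>U. riemann_aux s =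
         - chi s * eta s powr (s - 1) * exp (- (pi * \<i> * (eta s)\<^sup>2))
           * (sqrt 2 * exp (3 * pi * \<i> / 8) * sin (pi * eta s) / (2 * cos (2 * pi * eta s)))
           * (1 + U)
       \<and> cmod U \<le> error_const * Im s powr (-1/2)" by blast
qed

end
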